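(* Let $k \in \mathbb{Z}_{\geqslant 1}$ be fixed and let $f$ be an integer-valued prime-independent multiplicative function such that $f(p)=1$ for every prime $p$, and let $r \in \mathbb{Z}_{\geqslant 2}$ be such that $g(1)=\dotsb=g(r-1)=1$ and $g(\alpha)>1$ for all $\alpha \geqslant r$, where $g$ is the map with $f(p^\alpha)=g(\alpha)$ for all prime powers $p^\alpha$. Let $\varepsilon>0$ and let $x,y$ be real numbers with $x^{\frac{1}{2r+1}+\varepsilon} \leqslant y \leqslant 4^{-2r^2} x$. Then the local density $d_{f,k}=\lim_{x\to\infty} \frac{1}{x}\#\{n\leqslant x : f(n)=k\}$ exists, and $$\sum_{\substack{x < n \leqslant x+y \\ f(n)=k}} 1 = d_{f,k}\, y + O_{r,\varepsilon}\left\{ \left( x^{r-1} y^{r+1} \right)^{\frac{1}{2r^2}} x^\varepsilon + y\, x^{-\frac{1}{6(4r-1)(2r-1)}+\varepsilon} + y^{1-\frac{2(r-1)}{r(3r-1)}} x^\varepsilon \right\}.$$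
   Context: A prime-independent multiplicative function is a multiplicative arithmetic function $f$ with $f(1)=1$ for which there is a map $g:\mathbb{Z}_{\geqslant 0}\to\mathbb{R}$ with $g(0)=1$ and $f(p^\alpha)=g(\alpha)$ for every prime $p$ and every $\alpha\geqslant 1$. For $k\in\mathbb{Z}_{\geqslant 1}$, the local density is $d_{f,k}:=\lim_{x\to\infty} x^{-1}\sum_{n\leqslant x,\, f(n)=k} 1$ when the limit exists. *)

theory Defs
  imports Complex_Main "HOL-Computational_Algebra.Primes"
begin

text \<open>
  Arithmetic functions are functions on the positive integers; they are represented by functions
  on \<open>nat\<close> whose value at \<open>0\<close> is never inspected.
\<close>

definition multiplicative :: "(nat \<Rightarrow> real) \<Rightarrow> bool" where
  "multiplicative f \<longleftrightarrow> f 1 = 1 \<and> (\<forall>m\<ge>1. \<forall>n\<ge>1. coprime m n \<longrightarrow> f (m * n) = f m * f n)"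

definition prime_independent :: "(nat \<Rightarrow> real) \<Rightarrow> (nat \<Rightarrow> real) \<Rightarrow> bool" where
  "prime_independent f g \<longleftrightarrow>
     multiplicative f \<and> g 0 = 1 \<and> (\<forall>p \<alpha>. prime p \<longrightarrow> \<alpha> \<ge> 1 \<longrightarrow> f (p ^ \<alpha>) = g \<alpha>)"

definition mean_count :: "(nat \<Rightarrow> real) \<Rightarrow> nat \<Rightarrow> real \<Rightarrow> real" where
  "mean_count f k x = real (card {n::nat. 1 \<le> n \<and> real n \<le> x \<and> f n = real k}) / x"

text \<open>Meaningful only if \<open>mean_count f k\<close> converges at infinity.\<close>

definition local_density :: "(nat \<Rightarrow> real) \<Rightarrow> nat \<Rightarrow> real" where
  "local_density f k = Lim at_top (mean_count f k)"

end

theory Submission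
  imports Defs
begin

text \<open>
  The indicator function \<open>F\<close> of \<open>f n = k\<close> depends only on the \<open>r\<close>-full part of \<open>n\<close>, so
  \<open>F = 1 * G\<close> with \<open>G\<close> supported on \<open>r\<close>-full numbers and bounded by the divisor function. Every
  \<open>r\<close>-full number is \<open>v\<^sup>r w\<close> with \<open>w\<close> dividing \<open>v\<^bsup>r-1\<^esup>\<close>, so the error term of the convolution
  is governed by the integers of \<open>(x, x+y]\<close> that are divisible by \<open>v\<^sup>r\<close> for some large \<open>v\<close>.

  These are counted by the method of Filaseta and Trifonov. Suppose \<open>u\<^sub>1\<close>, \<open>u\<^sub>2\<close> lie in \<open>(N, 2N]\<close> and
  \<open>m\<^sub>i u\<^sub>i\<^sup>r\<close> in \<open>(x, x+y]\<close>. The Pade approximants to a binomial power give an integer combination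
  of \<open>m\<^sub>1\<close>, \<open>m\<^sub>2\<close> that is \<open>x (u\<^sub>2-u\<^sub>1)\<^bsup>2r-1\<^esup> / (u\<^sub>1u\<^sub>2)\<^sup>r + O(y/N)\<close>. It cannot vanish for all
  pairs from three close points, and for three consecutive points with gaps \<open>a\<close>, \<open>b\<close> the two integers
  \<open>k\<close>, \<open>l\<close> attached to the gaps, together with \<open>a\<close> and \<open>b\<close>, determine the points. Since \<open>k / l\<close> is
  close to \<open>(a / b)\<^bsup>2r-1\<^esup>\<close>, spacing of reduced fractions bounds the number of such quadruples,
  and the count is \<open>O((xy)\<^bsup>1/(2r+2)+\<epsilon>\<^esup>)\<close>; this is at most the first error term when
  \<open>y \<ge> x\<^bsup>1/(2r+1)\<^esup>\<close>, and the second comes from cutting long intervals into short ones.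
\<close>

section \<open>Pade approximants to binomial powers\<close>

text \<open>The delicate point is that the data \<open>a\<close>, \<open>b\<close>,
  \<open>k\<close>, \<open>l\<close> of a triple determine its first point. Translating the triple
  by h changes one relation by about x a^(2r-1) h / N^(2r+1), which its own error y / N can hide. In
  the second difference rel(u,w) - rel(u,v) - rel(v,w) the errors nearly cancel and shrink to about
  y (a+b) / N^2, while its main term still decreases strictly in u, because t^(2r-1) is strictly
  superadditive. When y is small against N, the integer rel(u,w) is forced by the two other
  relations, so these two suffice as data; otherwise the second difference itself is recorded.

  Gaps are cut at N / D with D = (x y)^(1/(2r+2)): about D points have a long gap next to them, and
  D is also the order of the bound for triples with two short gaps.

  On the arithmetic side F is an indicator and in general not multiplicative, so G cannot be
  computed from prime powers; that its support is r-full comes from an induction over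
  divisors.\<close>

lemma power_add_superadditive:
  fixes a b :: real
  assumes "a \<ge> 0" "b \<ge> 0" "n \<ge> 1"
  shows "a ^ n + b ^ n \<le> (a + b) ^ n"
  using assms(3)
proof (induction n rule: dec_induct)
  case (step n)
  have "a ^ Suc n + b ^ Suc n \<le> a * (a ^ n + b ^ n) + b * (a ^ n + b ^ n)"
    using assms by (simp add: algebra_simps)
  also have "\<dots> = (a + b) * (a ^ n + b ^ n)" by (simp add: algebra_simps)
  also have "\<dots> \<le> (a + b) * (a + b) ^ n"
    using assms step by (intro mult_left_mono) auto
  finally show ?case by simp
qed simp

text \<open>The cross terms appear on multiplying out (a + b)(a^(n-1) + b^(n-1)). They quantify how
  far t^n is from additive; \<open>near_additive_power_far\<close> and
  \<open>second_diff_determines_point\<close> live on this surplus.\<close>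

lemma power_add_lower:
  fixes a b :: real
  assumes "a \<ge> 0" "b \<ge> 0" "n \<ge> 2"
  shows "a ^ n + b ^ n + b * a ^ (n - 1) + a * b ^ (n - 1) \<le> (a + b) ^ n"
proof -
  obtain k where k: "n = Suc k" "k \<ge> 1" using assms(3) by (cases n) auto
  have "a ^ n + b ^ n + b * a ^ (n - 1) + a * b ^ (n - 1) = (a + b) * (a ^ k + b ^ k)"
    by (simp add: k algebra_simps)
  also have "\<dots> \<le> (a + b) * (a + b) ^ k"
    using assms k by (intro mult_left_mono power_add_superadditive) auto
  finally show ?thesis by (simp add: k)
qed

text \<open>The mean value bound n M^(n-1) |a - b|, multiplied by M so that no truncated exponent n
  - 1 occurs and n = 0 is no exception.\<close>

lemma abs_power_diff_le:
  fixes a b M :: real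
  assumes "0 \<le> a" "a \<le> M" "0 \<le> b" "b \<le> M"
  shows "M * \<bar>a ^ n - b ^ n\<bar> \<le> n * M ^ n * \<bar>a - b\<bar>"
proof (induction n)
  case (Suc n)
  have M: "M \<ge> 0" using assms by simp
  have "a ^ Suc n - b ^ Suc n = a * (a ^ n - b ^ n) + (a - b) * b ^ n"
    by (simp add: algebra_simps)
  hence "\<bar>a ^ Suc n - b ^ Suc n\<bar> \<le> a * \<bar>a ^ n - b ^ n\<bar> + \<bar>a - b\<bar> * b ^ n"
    using assms by (metis abs_mult abs_of_nonneg abs_triangle_ineq zero_le_power)
  hence "M * \<bar>a ^ Suc n - b ^ Suc n\<bar> \<le> M * (a * \<bar>a ^ n - b ^ n\<bar> + \<bar>a - b\<bar> * b ^ n)"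
    using M by (intro mult_left_mono)
  also have "\<dots> = a * (M * \<bar>a ^ n - b ^ n\<bar>) + M * (\<bar>a - b\<bar> * b ^ n)"
    by (simp add: algebra_simps)
  also have "\<dots> \<le> M * (n * M ^ n * \<bar>a - b\<bar>) + M * (\<bar>a - b\<bar> * M ^ n)"
    using assms M Suc by (intro add_mono mult_mono[of a M] mult_left_mono power_mono) auto
  finally show ?case by (simp add: algebra_simps)
qed simp

text \<open>The first half of the binomial expansion of (w - v)^(2s-1) with w^s taken out;
  \<open>pade s w v / pade s v w\<close> is the diagonal Pade approximant to (w/v)^s. The ring is
  left open because integrality is read off at \<open>int\<close> and size at
  \<open>real\<close>.\<close>

definition pade :: "nat \<Rightarrow> 'a::comm_ring_1 \<Rightarrow> 'a \<Rightarrow> 'a" where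
  "pade s v w = (\<Sum>i<s. of_nat ((2 * s - 1) choose i) * (-1) ^ i * w ^ (s - 1 - i) * v ^ i)"

lemma of_int_pade: "of_int (pade s v w) = pade s (of_int v) (of_int w)"
  by (simp add: pade_def)

text \<open>Cut the expansion of (w - v)^(2s-1) in the middle. Indices below s carry w^s and the
  others carry v^s; since 2s-1 is odd, the reflection i -> 2s-1-i turns the upper half into minus
  the lower half with v and w exchanged.\<close>

lemma pade_identity:
  assumes "s \<ge> 1"
  shows "pade s v w * w ^ s - pade s w v * v ^ s = (w - v) ^ (2 * s - 1)"
proof -
  let ?q = "2 * s - 1"
  let ?t = "\<lambda>i. of_nat (?q choose i) * (- v) ^ i * w ^ (?q - i)"
  have "(w - v) ^ ?q = (- v + w) ^ ?q" by simp
  also have "\<dots> = (\<Sum>i\<le>?q. ?t i)" by (rule binomial_ring)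
  also have "{..?q} = {..<s} \<union> {s..?q}" using assms by auto
  also have "(\<Sum>i\<in>\<dots>. ?t i) = (\<Sum>i<s. ?t i) + (\<Sum>i=s..?q. ?t i)"
    by (intro sum.union_disjoint) auto
  also have "(\<Sum>i<s. ?t i) = pade s v w * w ^ s"
    unfolding pade_def sum_distrib_right
  proof (intro sum.cong refl)
    fix i assume "i \<in> {..<s}"
    hence "?q - i = (s - 1 - i) + s" by auto
    thus "?t i = of_nat (?q choose i) * (-1) ^ i * w ^ (s - 1 - i) * v ^ i * w ^ s"
      by (simp only: power_add power_minus[of v] mult_ac)
  qed
  also have "(\<Sum>i=s..?q. ?t i) = (\<Sum>i<s. ?t (?q - i))"
    by (rule sum.reindex_bij_witness[of _ "\<lambda>i. ?q - i" "\<lambda>i. ?q - i"]) (use assms in auto)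
  also have "\<dots> = (\<Sum>i<s. - (of_nat (?q choose i) * (-1) ^ i * v ^ (s - 1 - i) * w ^ i * v ^ s))"
  proof (intro sum.cong refl)
    fix i assume "i \<in> {..<s}"
    hence i: "i < s" by simp
    have e: "?q - (?q - i) = i" "?q - i = (s - 1 - i) + s" "i \<le> ?q" using i by auto
    have c: "(?q choose (?q - i)) = (?q choose i)" using binomial_symmetric[OF e(3)] by simp
    have "odd ?q" using assms by simp
    hence "even (?q - i) \<longleftrightarrow> odd i" using e(3) by (simp only: even_diff_nat) auto
    hence "(- 1 :: 'a) ^ (?q - i) = - ((- 1) ^ i)" by (cases "even i") auto
    hence "(- v) ^ (?q - i) = - ((-1) ^ i) * v ^ (?q - i)"
      by (metis power_minus)
    hence vv: "(- v) ^ (?q - i) = - ((-1) ^ i) * (v ^ (s - 1 - i) * v ^ s)"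
      by (simp only: e(2) power_add)
    show "?t (?q - i) = - (of_nat (?q choose i) * (-1) ^ i * v ^ (s - 1 - i) * w ^ i * v ^ s)"
      unfolding vv c e(1) by (simp add: algebra_simps)
  qed
  also have "\<dots> = - (pade s w v * v ^ s)"
    unfolding pade_def sum_distrib_right sum_negf by simp
  finally show ?thesis by simp
qed

lemma sum_binomial_prefix_le: "(\<Sum>i<s. real ((2 * s - 1) choose i)) \<le> 4 ^ s"
proof (cases "s = 0")
  case False
  have "(\<Sum>i<s. real ((2 * s - 1) choose i)) \<le> (\<Sum>i\<le>2*s-1. real ((2 * s - 1) choose i))"
    by (intro sum_mono2) auto
  also have "\<dots> = real (2 ^ (2 * s - 1))"
    by (simp only: of_nat_sum [symmetric] choose_row_sum)
  also have "\<dots> \<le> 2 ^ (2 * s)" unfolding of_nat_power by (simp add: power_increasing)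
  finally show ?thesis by (simp add: power_mult)
qed simp

text \<open>In 8^s, the factor 4^s pays for the binomial coefficients and 2^s for the arguments
  being up to 2N.\<close>

lemma abs_pade_le:
  fixes v w N :: real
  assumes "0 \<le> v" "v \<le> 2 * N" "0 \<le> w" "w \<le> 2 * N" "s \<ge> 1"
  shows "\<bar>pade s v w\<bar> \<le> 8 ^ s * N ^ (s - 1)"
proof -
  have N: "N \<ge> 0" using assms by simp
  have "\<bar>pade s v w\<bar> \<le> (\<Sum>i<s. real ((2 * s - 1) choose i) * (2 * N) ^ (s - 1))"
    unfolding pade_def
  proof (rule order_trans[OF sum_abs], intro sum_mono)
    fix i assume "i \<in> {..<s}"
    hence e: "s - 1 = (s - 1 - i) + i" by auto
    have "w ^ (s - 1 - i) * v ^ i \<le> (2 * N) ^ (s - 1 - i) * (2 * N) ^ i"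
      using assms by (intro mult_mono power_mono) auto
    also have "\<dots> = (2 * N) ^ (s - 1)" using e by (metis power_add)
    finally show "\<bar>real (2 * s - 1 choose i) * (- 1) ^ i * w ^ (s - 1 - i) * v ^ i\<bar>
        \<le> real (2 * s - 1 choose i) * (2 * N) ^ (s - 1)"
      using assms by (simp add: abs_mult power_abs mult.assoc mult_left_mono)
  qed
  also have "\<dots> \<le> 4 ^ s * (2 * N) ^ (s - 1)"
    unfolding sum_distrib_right[symmetric]
    using N by (intro mult_right_mono sum_binomial_prefix_le) auto
  also have "\<dots> \<le> 4 ^ s * (2 ^ s * N ^ (s - 1))"
    unfolding power_mult_distrib using N by (intro mult_left_mono mult_right_mono) auto
  also have "\<dots> = (4 * 2) ^ s * N ^ (s - 1)" unfolding power_mult_distrib by (simp only: mult_ac)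
  also have "\<dots> = 8 ^ s * N ^ (s - 1)" by simp
  finally show ?thesis .
qed

lemma abs_pade_diff_le:
  fixes v w v' w' N :: real
  assumes "0 \<le> v" "v \<le> 2 * N" "0 \<le> w" "w \<le> 2 * N" "0 \<le> v'" "v' \<le> 2 * N" "0 \<le> w'" "w' \<le> 2 * N"
    "N > 0" "s \<ge> 1"
  shows "\<bar>pade s v w - pade s v' w'\<bar> \<le> real s * 8 ^ s * N ^ (s - 1) * ((\<bar>v - v'\<bar> + \<bar>w - w'\<bar>) / N)"
proof -
  let ?d = "\<bar>v - v'\<bar> + \<bar>w - w'\<bar>" and ?M = "2 * N"
  have "?M * \<bar>pade s v w - pade s v' w'\<bar> \<le> ?M * (\<Sum>i<s. real ((2 * s - 1) choose i) * \<bar>w ^ (s - 1 - i) * v ^ i - w' ^ (s - 1 - i) * v' ^ i\<bar>)"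
    unfolding pade_def sum_subtractf[symmetric] using assms
    by (intro mult_left_mono order_trans[OF sum_abs] sum_mono)
       (auto simp: abs_mult power_abs mult.assoc simp flip: right_diff_distrib)
  also have "\<dots> \<le> (\<Sum>i<s. real ((2 * s - 1) choose i) * (s * ?M ^ (s - 1) * ?d))"
    unfolding sum_distrib_left
  proof (intro sum_mono)
    fix i assume "i \<in> {..<s}"
    hence i: "i < s" by auto
    hence e: "s - 1 = (s - 1 - i) + i" by auto
    let ?k = "s - 1 - i"
    have "w ^ ?k * v ^ i - w' ^ ?k * v' ^ i = w ^ ?k * (v ^ i - v' ^ i) + (w ^ ?k - w' ^ ?k) * v' ^ i"
      by (simp add: algebra_simps)
    hence "\<bar>w ^ ?k * v ^ i - w' ^ ?k * v' ^ i\<bar> \<le> w ^ ?k * \<bar>v ^ i - v' ^ i\<bar> + \<bar>w ^ ?k - w' ^ ?k\<bar> * v' ^ i"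
      using abs_triangle_ineq[of "w ^ ?k * (v ^ i - v' ^ i)" "(w ^ ?k - w' ^ ?k) * v' ^ i"] assms
      by (simp add: abs_mult)
    hence "?M * \<bar>w ^ ?k * v ^ i - w' ^ ?k * v' ^ i\<bar> \<le> ?M * (w ^ ?k * \<bar>v ^ i - v' ^ i\<bar> + \<bar>w ^ ?k - w' ^ ?k\<bar> * v' ^ i)"
      using assms by (intro mult_left_mono) auto
    also have "\<dots> = w ^ ?k * (?M * \<bar>v ^ i - v' ^ i\<bar>) + (?M * \<bar>w ^ ?k - w' ^ ?k\<bar>) * v' ^ i"
      by (simp add: algebra_simps)
    also have "\<dots> \<le> ?M ^ ?k * (i * ?M ^ i * \<bar>v - v'\<bar>) + (?k * ?M ^ ?k * \<bar>w - w'\<bar>) * ?M ^ i"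
      using assms by (intro add_mono mult_mono power_mono abs_power_diff_le) auto
    also have "\<dots> = (?M ^ ?k * ?M ^ i) * (i * \<bar>v - v'\<bar> + ?k * \<bar>w - w'\<bar>)"
      by algebra
    also have "\<dots> = ?M ^ (s - 1) * (i * \<bar>v - v'\<bar> + ?k * \<bar>w - w'\<bar>)"
      using e by (metis power_add)
    also have "\<dots> \<le> ?M ^ (s - 1) * (s * \<bar>v - v'\<bar> + s * \<bar>w - w'\<bar>)"
      using assms i by (intro mult_left_mono add_mono mult_right_mono) auto
    finally have "?M * \<bar>w ^ ?k * v ^ i - w' ^ ?k * v' ^ i\<bar> \<le> s * ?M ^ (s - 1) * ?d"
      by (simp add: algebra_simps)
    from mult_left_mono[OF this, of "real ((2 * s - 1) choose i)"]
    show "?M * (real ((2 * s - 1) choose i) * \<bar>w ^ ?k * v ^ i - w' ^ ?k * v' ^ i\<bar>)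
      \<le> real ((2 * s - 1) choose i) * (s * ?M ^ (s - 1) * ?d)"
      by (simp add: mult_ac)
  qed
  also have "\<dots> \<le> 4 ^ s * (s * ?M ^ (s - 1) * ?d)"
    unfolding sum_distrib_right[symmetric]
    using assms by (intro mult_right_mono sum_binomial_prefix_le) auto
  also have "\<dots> \<le> 4 ^ s * (s * (2 ^ s * N ^ (s - 1)) * ?d)"
    unfolding power_mult_distrib using assms by (intro mult_left_mono mult_right_mono) auto
  also have "\<dots> = (4 * 2) ^ s * (real s * N ^ (s - 1) * ?d)"
    unfolding power_mult_distrib by (simp only: mult_ac)
  also have "\<dots> = N * (real s * 8 ^ s * N ^ (s - 1) * (?d / N))"
    using assms by simp
  also have "\<dots> \<le> ?M * (real s * 8 ^ s * N ^ (s - 1) * (?d / N))"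
    using assms by (intro mult_right_mono) auto
  finally show ?thesis by (rule mult_left_le_imp_le) (use assms in simp)
qed

text \<open>On the diagonal \<open>pade\<close> is an alternating partial sum of row 2s-1 of
  Pascal's triangle times v^(s-1). Such a sum collapses to a single binomial coefficient, here the
  central one of row 2s-2 up to sign, so there is no cancellation to zero.\<close>

lemma abs_pade_diag_ge:
  fixes v N :: real
  assumes "0 \<le> N" "N \<le> v" "s \<ge> 1"
  shows "\<bar>pade s v v\<bar> \<ge> N ^ (s - 1)"
proof -
  let ?q = "2 * s - 1"
  have "pade s v v = (\<Sum>i<s. of_nat (?q choose i) * (-1) ^ i * v ^ (s - 1))"
    unfolding pade_def
  proof (intro sum.cong refl)
    fix i assume "i \<in> {..<s}"
    hence "s - 1 = (s - 1 - i) + i" by auto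
    hence "v ^ (s - 1) = v ^ (s - 1 - i) * v ^ i" by (metis power_add)
    thus "of_nat (?q choose i) * (-1) ^ i * v ^ (s - 1 - i) * v ^ i = of_nat (?q choose i) * (-1) ^ i * v ^ (s - 1)"
      by simp
  qed
  also have "\<dots> = (\<Sum>i\<le>s - 1. (real ?q gchoose i) * (-1) ^ i) * v ^ (s - 1)"
    unfolding sum_distrib_right using assms
    by (intro sum.cong) (auto simp: binomial_gbinomial)
  also have "\<dots> = (-1) ^ (s - 1) * (real ?q - 1 gchoose (s - 1)) * v ^ (s - 1)"
    by (subst gbinomial_sum_lower_neg) simp
  also have "real ?q - 1 = real (2 * s - 2)" using assms by (simp add: of_nat_diff)
  also have "(\<dots> gchoose (s - 1)) = real ((2 * s - 2) choose (s - 1))"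
    by (simp add: binomial_gbinomial)
  finally have eq: "\<bar>pade s v v\<bar> = real ((2 * s - 2) choose (s - 1)) * v ^ (s - 1)"
    using assms by (simp add: abs_mult power_abs)
  have "(2 * s - 2) choose (s - 1) \<ge> 1" by (simp add: Suc_le_eq)
  hence "1 * N ^ (s - 1) \<le> real ((2 * s - 2) choose (s - 1)) * v ^ (s - 1)"
    using assms by (intro mult_mono power_mono) auto
  thus ?thesis using eq by simp
qed

text \<open>The Lipschitz bound spreads the diagonal estimate to nearby arguments; the last
  hypothesis is what limits the loss to one half.\<close>

lemma abs_pade_ge:
  fixes v w N :: real
  assumes "N \<le> v" "v \<le> 2 * N" "N \<le> w" "w \<le> 2 * N" "N > 0" "s \<ge> 1"
    "2 * real s * 8 ^ s * \<bar>v - w\<bar> \<le> N"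
  shows "\<bar>pade s v w\<bar> \<ge> N ^ (s - 1) / 2"
proof -
  have "\<bar>pade s v w - pade s v v\<bar> \<le> real s * 8 ^ s * N ^ (s - 1) * ((\<bar>v - v\<bar> + \<bar>w - v\<bar>) / N)"
    using assms by (intro abs_pade_diff_le) auto
  also have "\<dots> = N ^ (s - 1) / 2 * ((2 * real s * 8 ^ s * \<bar>v - w\<bar>) / N)"
    by (simp add: abs_minus_commute)
  also have "\<dots> \<le> N ^ (s - 1) / 2 * 1"
    using assms by (intro mult_left_mono) auto
  finally show ?thesis using abs_pade_diag_ge[of N v s] assms by linarith
qed

text \<open>The surplus \<open>\<beta> * \<alpha> ^ (q - 1)\<close> of the q-th power has to be paid
  by the deviations of \<open>\<rho>1\<close> and \<open>\<rho>2\<close> from 1. Both payments carry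
  the same factor \<open>\<beta> * \<alpha> ^ (q - 1)\<close>, the first because its deviation is
  proportional to the smaller number \<open>\<beta>\<close>; after cancellation
  \<open>\<alpha>\<close> must be of order N.\<close>

lemma near_additive_power_far:
  fixes \<alpha> \<beta> N C \<rho>1 \<rho>2 :: real
  assumes "0 < \<beta>" "\<beta> \<le> \<alpha>" "N > 0" "C > 0" "q \<ge> 2"
    and eq: "(\<alpha> + \<beta>) ^ q * \<rho>1 = \<alpha> ^ q + \<beta> ^ q * \<rho>2"
    and r1: "\<bar>\<rho>1 - 1\<bar> \<le> C * \<beta> / N" and r2: "\<bar>\<rho>2 - 1\<bar> \<le> 2 * C * \<alpha> / N"
  shows "N \<le> C * (2 + 2 ^ q) * \<alpha>"
proof -
  obtain k where k: "q = Suc k" "k \<ge> 1" using assms(5) by (cases q) auto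
  have a: "\<alpha> > 0" using assms by linarith
  have 1: "(\<alpha> + \<beta>) ^ q \<le> 2 ^ q * \<alpha> ^ q"
    using power_mono[of "\<alpha> + \<beta>" "2 * \<alpha>" q] assms by (simp add: power_mult_distrib)
  have 2: "\<alpha> ^ q + \<beta> ^ q + \<beta> * \<alpha> ^ (q - 1) \<le> (\<alpha> + \<beta>) ^ q"
  proof -
    have "0 \<le> \<alpha> * \<beta> ^ (q - 1)" using a assms by simp
    thus ?thesis using power_add_lower[of \<alpha> \<beta> q] a assms by linarith
  qed
  have 3: "(\<alpha> + \<beta>) ^ q * \<rho>1 \<ge> (\<alpha> + \<beta>) ^ q * (1 - C * \<beta> / N)"
    using r1 a assms by (intro mult_left_mono) auto
  have 4: "\<beta> ^ q * \<rho>2 \<le> \<beta> ^ q * (1 + 2 * C * \<alpha> / N)"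
    using r2 a assms by (intro mult_left_mono) auto
  have "\<beta> * \<alpha> ^ (q - 1) \<le> (\<alpha> + \<beta>) ^ q * (C * \<beta> / N) + \<beta> ^ q * (2 * C * \<alpha> / N)"
    using 2 3 4 eq by (simp add: algebra_simps)
  also have "\<dots> \<le> 2 ^ q * \<alpha> ^ q * (C * \<beta> / N) + (\<beta> * \<alpha> ^ k) * (2 * C * \<alpha> / N)"
    using 1 a assms by (intro add_mono mult_right_mono) (auto simp: k intro!: mult_left_mono power_mono)
  also have "\<dots> = (\<beta> * \<alpha> ^ (q - 1)) * (C * (2 + 2 ^ q) * \<alpha> / N)"
    by (simp add: k add_divide_distrib algebra_simps)
  finally have "(\<beta> * \<alpha> ^ (q - 1)) * 1 \<le> (\<beta> * \<alpha> ^ (q - 1)) * (C * (2 + 2 ^ q) * \<alpha> / N)"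
    by simp
  hence "1 \<le> C * (2 + 2 ^ q) * \<alpha> / N"
    by (rule mult_left_le_imp_le) (use a assms in simp)
  thus ?thesis using assms by (simp add: field_simps)
qed

lemma pade_ratio_near_one:
  fixes v w v' w' N :: real
  assumes "N \<le> v" "v \<le> 2 * N" "N \<le> w" "w \<le> 2 * N" "N \<le> v'" "v' \<le> 2 * N" "N \<le> w'" "w' \<le> 2 * N"
    "N > 0" "s \<ge> 1" "2 * real s * 8 ^ s * \<bar>v' - w'\<bar> \<le> N"
  shows "\<bar>pade s v w / pade s v' w' - 1\<bar> \<le> 2 * real s * 8 ^ s * (\<bar>v - v'\<bar> + \<bar>w - w'\<bar>) / N"
    and "pade s v' w' \<noteq> 0"
proof -
  have g: "\<bar>pade s v' w'\<bar> \<ge> N ^ (s - 1) / 2" using assms by (intro abs_pade_ge) auto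
  have p: "N ^ (s - 1) / 2 > 0" using assms by simp
  show nz: "pade s v' w' \<noteq> 0" using g p by auto
  have "\<bar>pade s v w / pade s v' w' - 1\<bar> = \<bar>pade s v w - pade s v' w'\<bar> / \<bar>pade s v' w'\<bar>"
    using nz by (simp add: field_simps flip: abs_divide)
  also have "\<dots> \<le> (real s * 8 ^ s * N ^ (s - 1) * ((\<bar>v - v'\<bar> + \<bar>w - w'\<bar>) / N)) / (N ^ (s - 1) / 2)"
    using assms g p by (intro frac_le abs_pade_diff_le) auto
  also have "\<dots> = 2 * real s * 8 ^ s * (\<bar>v - v'\<bar> + \<bar>w - w'\<bar>) / N"
    using p by simp
  finally show "\<bar>pade s v w / pade s v' w' - 1\<bar> \<le> 2 * real s * 8 ^ s * (\<bar>v - v'\<bar> + \<bar>w - w'\<bar>) / N" .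
qed

text \<open>With \<open>n\<^sub>i = m\<^sub>i u\<^sub>i\<^sup>s\<close>, a relation between \<open>i\<close> and \<open>j\<close> says that \<open>n\<^sub>j - n\<^sub>i\<close> is
  nearly proportional to \<open>(u\<^sub>j - u\<^sub>i)\<^bsup>2s-1\<^esup>\<close>, which is not additive.\<close>

lemma pade_three_relations_far:
  fixes u1 u2 u3 N m1 m2 m3 :: real
  assumes u: "N \<le> u1" "u1 < u2" "u2 < u3" "u3 \<le> 2 * N" and N: "N > 0" and s: "s \<ge> 2"
    and m: "m1 > 0" "m2 > 0" "m3 > 0"
    and e12: "pade s u1 u2 * m1 = pade s u2 u1 * m2"
    and e23: "pade s u2 u3 * m2 = pade s u3 u2 * m3"
    and e13: "pade s u1 u3 * m1 = pade s u3 u1 * m3"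
  shows "N < 8 * real s * 32 ^ s * (u3 - u1)"
proof (rule ccontr)
  assume "\<not> ?thesis"
  hence far: "8 * real s * 32 ^ s * (u3 - u1) \<le> N" by simp
  define q where "q = 2 * s - 1"
  define C where "C = 2 * real s * 8 ^ s"
  have C: "C > 0" using s by (simp add: C_def)
  have q: "q \<ge> 2" using s by (simp add: q_def)
  have near: "C * \<bar>v - w\<bar> \<le> N" if "u1 \<le> v" "v \<le> u3" "u1 \<le> w" "w \<le> u3" for v w
  proof -
    have "C * \<bar>v - w\<bar> \<le> C * (u3 - u1)" using that C by (intro mult_left_mono) auto
    also have "\<dots> \<le> 8 * real s * 32 ^ s * (u3 - u1)"
    proof (intro mult_right_mono)
      have "(8::real) ^ s \<le> 32 ^ s" by (intro power_mono) auto
      thus "C \<le> 8 * real s * 32 ^ s" unfolding C_def by (simp add: mult_mono)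
    qed (use u in auto)
    finally show ?thesis using far by simp
  qed
  define P where "P v w = pade s v w * w ^ s" for v w :: real
  have Pd: "P v w - P w v = (w - v) ^ q" for v w
    unfolding P_def q_def by (intro pade_identity) (use s in auto)
  define n1 n2 n3 where "n1 = m1 * u1 ^ s" "n2 = m2 * u2 ^ s" "n3 = m3 * u3 ^ s"
  have pos: "u1 > 0" "u2 > 0" "u3 > 0" using u N by auto
  have npos: "n1 > 0" "n2 > 0" "n3 > 0" using m pos by (auto simp: n1_n2_n3_def)
  note ratio = pade_ratio_near_one[where N = N and s = s, folded C_def]
  have nz: "pade s v w \<noteq> 0" if "v \<in> {u1, u2, u3}" "w \<in> {u1, u2, u3}" for v w
    using that u N s near[of v w] by (intro ratio(2)[of v w]) auto
  have Pnz: "P v w \<noteq> 0" if "v \<in> {u1, u2, u3}" "w \<in> {u1, u2, u3}" for v w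
    using nz[OF that] that pos by (auto simp: P_def)
  have E: "P u1 u2 * n1 = P u2 u1 * n2" "P u2 u3 * n2 = P u3 u2 * n3" "P u1 u3 * n1 = P u3 u1 * n3"
  proof -
    have *: "p * w * (m * v) = p' * v * (m' * w)" if "p * m = p' * m'" for p w m v p' m' :: real
    proof -
      have "p * w * (m * v) = p * m * (v * w)" by (simp only: mult_ac)
      also have "\<dots> = p' * v * (m' * w)" unfolding that by (simp only: mult_ac)
      finally show ?thesis .
    qed
    show "P u1 u2 * n1 = P u2 u1 * n2" "P u2 u3 * n2 = P u3 u2 * n3" "P u1 u3 * n1 = P u3 u1 * n3"
      unfolding P_def n1_n2_n3_def by (intro * e12 e23 e13)+
  qed
  define a b where "a = u2 - u1" "b = u3 - u2"
  have ab: "a > 0" "b > 0" "a + b = u3 - u1" using u by (auto simp: a_b_def)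
  \<comment> \<open>A vanishing relation makes n_i / P(u_j,u_i) and n_j / P(u_i,u_j) equal. With
    R_ij for the common value, \<open>pade_identity\<close> gives n_j - n_i = R_ij (u_j - u_i)^q,
    and adding two such differences must give the third.\<close>
  define R12 R13 R23 where "R12 = n1 / P u2 u1" "R13 = n1 / P u3 u1" "R23 = n2 / P u3 u2"
  have R': "R12 = n2 / P u1 u2" "R13 = n3 / P u1 u3" "R23 = n3 / P u2 u3"
    unfolding R12_R13_R23_def using E Pnz by (auto simp: field_simps)
  have d12: "n2 - n1 = R12 * a ^ q"
  proof -
    have "R12 * a ^ q = R12 * P u1 u2 - R12 * P u2 u1"
      by (simp add: a_b_def Pd[symmetric] algebra_simps)
    also have "R12 * P u1 u2 = n2" unfolding R' using Pnz by simp
    also have "R12 * P u2 u1 = n1" unfolding R12_R13_R23_def using Pnz by simp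
    finally show ?thesis by simp
  qed
  have d23: "n3 - n2 = R23 * b ^ q"
  proof -
    have "R23 * b ^ q = R23 * P u2 u3 - R23 * P u3 u2"
      by (simp add: a_b_def Pd[symmetric] algebra_simps)
    also have "R23 * P u2 u3 = n3" unfolding R' using Pnz by simp
    also have "R23 * P u3 u2 = n2" unfolding R12_R13_R23_def using Pnz by simp
    finally show ?thesis by simp
  qed
  have d13: "n3 - n1 = R13 * (a + b) ^ q"
  proof -
    have "R13 * (a + b) ^ q = R13 * P u1 u3 - R13 * P u3 u1"
      by (simp add: a_b_def Pd[symmetric] algebra_simps)
    also have "R13 * P u1 u3 = n3" unfolding R' using Pnz by simp
    also have "R13 * P u3 u1 = n1" unfolding R12_R13_R23_def using Pnz by simp
    finally show ?thesis by simp
  qed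
  have Req: "R13 * (a + b) ^ q = R12 * a ^ q + R23 * b ^ q"
    using d12 d13 d23 by simp
  have Rnz: "R12 \<noteq> 0" "R23 \<noteq> 0"
    using npos Pnz by (auto simp: R12_R13_R23_def)
  \<comment> \<open>Divide by the ratio R of the longer gap. It shares an endpoint with R13, and the
    other endpoints differ only by the shorter gap, which is the proportionality that
    \<open>near_additive_power_far\<close> asks for.\<close>
  have bound: "N \<le> C * (2 + 2 ^ q) * (u3 - u1)"
  proof (cases "a \<le> b")
    case True
    have "N \<le> C * (2 + 2 ^ q) * b"
    proof (rule near_additive_power_far[of a b N C q "R13 / R23" "R12 / R23"])
      show "(b + a) ^ q * (R13 / R23) = b ^ q + a ^ q * (R12 / R23)"
        using Req Rnz by (simp add: field_simps)
      have "R13 / R23 = pade s u2 u3 / pade s u1 u3"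
        unfolding R' using npos pos nz by (simp add: P_def)
      thus "\<bar>R13 / R23 - 1\<bar> \<le> C * a / N"
        using ratio(1)[of u2 u3 u1 u3] near[of u1 u3] u N s by (simp add: a_b_def)
      have "R12 / R23 = pade s u3 u2 / pade s u1 u2"
        unfolding R'(1) R12_R13_R23_def using npos pos nz by (simp add: P_def)
      hence "\<bar>R12 / R23 - 1\<bar> \<le> C * (u3 - u1) / N"
        using ratio(1)[of u3 u2 u1 u2] near[of u1 u2] u N s by simp
      also have "\<dots> \<le> C * (2 * b) / N" using True C N ab
        by (intro divide_right_mono mult_left_mono) auto
      finally show "\<bar>R12 / R23 - 1\<bar> \<le> 2 * C * b / N" by (simp add: mult_ac)
    qed (use ab True N C q in auto)
    also have "\<dots> \<le> C * (2 + 2 ^ q) * (u3 - u1)" using ab C by (intro mult_left_mono) auto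
    finally show ?thesis .
  next
    case False
    have "N \<le> C * (2 + 2 ^ q) * a"
    proof (rule near_additive_power_far[of b a N C q "R13 / R12" "R23 / R12"])
      show "(a + b) ^ q * (R13 / R12) = a ^ q + b ^ q * (R23 / R12)"
        using Req Rnz by (simp add: field_simps)
      have "R13 / R12 = pade s u2 u1 / pade s u3 u1"
        unfolding R12_R13_R23_def using npos pos nz by (simp add: P_def)
      thus "\<bar>R13 / R12 - 1\<bar> \<le> C * b / N"
        using ratio(1)[of u2 u1 u3 u1] near[of u3 u1] u N s by (simp add: a_b_def)
      have "R23 / R12 = pade s u1 u2 / pade s u3 u2"
        unfolding R'(1) R12_R13_R23_def using npos pos nz by (simp add: P_def)
      hence "\<bar>R23 / R12 - 1\<bar> \<le> C * (u3 - u1) / N"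
        using ratio(1)[of u1 u2 u3 u2] near[of u3 u2] u N s by simp
      also have "\<dots> \<le> C * (2 * a) / N" using False C N ab
        by (intro divide_right_mono mult_left_mono) auto
      finally show "\<bar>R23 / R12 - 1\<bar> \<le> 2 * C * a / N" by (simp add: mult_ac)
    qed (use ab False N C q in auto)
    also have "\<dots> \<le> C * (2 + 2 ^ q) * (u3 - u1)" using ab C by (intro mult_left_mono) auto
    finally show ?thesis .
  qed
  have "C * (2 + 2 ^ q) < 8 * real s * 32 ^ s"
  proof -
    have "(2::real) ^ q \<le> 4 ^ s"
    proof -
      have "(2::real) ^ q \<le> 2 ^ (2 * s)" by (intro power_increasing) (auto simp: q_def)
      thus ?thesis by (simp add: power_mult)
    qed
    moreover have "(2::real) \<le> 4 ^ s" using s power_increasing[of 1 s "4::real"] by simp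
    ultimately have "C * (2 + 2 ^ q) \<le> C * (2 * 4 ^ s)" using C by (intro mult_left_mono) auto
    also have "\<dots> = 4 * real s * (8 * 4) ^ s"
      unfolding C_def power_mult_distrib by (simp only: mult_ac)
    also have "\<dots> = 4 * real s * 32 ^ s" by simp
    also have "\<dots> < 8 * real s * 32 ^ s" using s by simp
    finally show ?thesis by simp
  qed
  hence "C * (2 + 2 ^ q) * (u3 - u1) < 8 * real s * 32 ^ s * (u3 - u1)"
    using u by (intro mult_strict_right_mono) auto
  with bound far show False by simp
qed

section \<open>Quadruples with nearly equal power ratios\<close>

lemma harmonic_sum_le:
  assumes "n \<ge> 1"
  shows "(\<Sum>d=1..n. 1 / real d) \<le> 1 + ln (real n)"
  using assms
proof (induction n rule: dec_induct)
  case (step n)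
  have "ln (real n / real (Suc n)) \<le> real n / real (Suc n) - 1"
    using step by (intro ln_le_minus_one) auto
  also have "\<dots> = - (1 / real (Suc n))" by (simp add: field_simps)
  finally have "1 / real (Suc n) \<le> ln (real (Suc n)) - ln (real n)"
    using step by (simp add: ln_div)
  thus ?case using step by simp
qed simp

lemma card_le_fibres:
  fixes B :: real
  assumes "finite Q" "finite P" "g ` Q \<subseteq> P" "\<And>p. p \<in> P \<Longrightarrow> real (card {z \<in> Q. g z = p}) \<le> B"
  shows "real (card Q) \<le> real (card P) * B"
proof -
  have "Q = (\<Union>p\<in>P. {z \<in> Q. g z = p})" using assms by auto
  hence "card Q \<le> (\<Sum>p\<in>P. card {z \<in> Q. g z = p})"
    using card_UN_le[OF assms(2), of "\<lambda>p. {z \<in> Q. g z = p}"] by simp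
  hence "real (card Q) \<le> (\<Sum>p\<in>P. real (card {z \<in> Q. g z = p}))"
    by (metis of_nat_le_iff of_nat_sum)
  also have "\<dots> \<le> (\<Sum>p\<in>P. B)" using assms by (intro sum_mono) auto
  finally show ?thesis by simp
qed

lemma card_spaced_le:
  fixes R :: "real set"
  assumes "finite R" "\<eta> > 0" "l \<ge> 0"
    and diam: "\<And>r r'. r \<in> R \<Longrightarrow> r' \<in> R \<Longrightarrow> r' - r \<le> l"
    and sp: "\<And>r r'. r \<in> R \<Longrightarrow> r' \<in> R \<Longrightarrow> r < r' \<Longrightarrow> r' - r \<ge> \<eta>"
  shows "real (card R) \<le> l / \<eta> + 1"
proof (cases "R = {}")
  case False
  define f where "f r = \<lfloor>(r - Min R) / \<eta>\<rfloor>" for r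
  have lt: "f r < f r'" if "r \<in> R" "r' \<in> R" "r < r'" for r r'
  proof -
    have "(r - Min R) / \<eta> + 1 \<le> (r' - Min R) / \<eta>"
    proof -
      have "((r' - Min R) - (r - Min R)) / \<eta> \<ge> \<eta> / \<eta>"
        using sp[OF that] assms(2) by (intro divide_right_mono) auto
      thus ?thesis using assms(2) by (simp add: diff_divide_distrib)
    qed
    thus ?thesis unfolding f_def by linarith
  qed
  have "inj_on f R"
    by (rule inj_onI) (metis lt less_irrefl linorder_neqE)
  moreover have "f ` R \<subseteq> {0..\<lfloor>l / \<eta>\<rfloor>}"
  proof
    fix z assume "z \<in> f ` R"
    then obtain r where r: "r \<in> R" "z = f r" by auto
    have "0 \<le> (r - Min R) / \<eta>" using r assms by simp
    moreover have "(r - Min R) / \<eta> \<le> l / \<eta>"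
      using diam[of "Min R" r] r False assms by (intro divide_right_mono) auto
    ultimately show "z \<in> {0..\<lfloor>l / \<eta>\<rfloor>}" by (auto simp: r f_def floor_mono)
  qed
  ultimately have "card R \<le> card {0..\<lfloor>l / \<eta>\<rfloor>}"
    by (metis card_inj_on_le finite_atLeastAtMost_int)
  moreover have "0 \<le> \<lfloor>l / \<eta>\<rfloor>" using assms by simp
  ultimately have "real (card R) \<le> real_of_int (\<lfloor>l / \<eta>\<rfloor> + 1)"
    by (simp add: le_nat_iff)
  thus ?thesis by linarith
qed (use assms in simp)

text \<open>Both cross products are multiples of e^2, so a nonzero difference is at least e^2, over
  denominators of size at most L^2. Prescribing the gcd gains the factor e^2 over the usual spacing,
  which matches the density 1/e^2 of pairs with that gcd.\<close>

lemma fraction_spacing: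
  fixes k l k' l' e :: nat
  assumes "gcd k l = e" "gcd k' l' = e" "real k / l < real k' / l'" "l > 0" "l' > 0" "real l \<le> L" "real l' \<le> L"
  shows "real k' / l' - real k / l \<ge> (e / L) ^ 2"
proof -
  have L: "L > 0" using assms by linarith
  have lt: "k * l' < k' * l"
    using assms(3-5) by (simp add: field_simps flip: of_nat_mult)
  have "e * e dvd k * l'" "e * e dvd k' * l"
    using assms(1,2) by (metis gcd_dvd1 gcd_dvd2 mult_dvd_mono)+
  hence "e * e dvd k' * l - k * l'" by (intro dvd_diff_nat)
  hence "e * e \<le> k' * l - k * l'" using lt by (intro dvd_imp_le) auto
  hence "real (e * e) \<le> real (k' * l - k * l')" by (simp only: of_nat_le_iff)
  also have "\<dots> = real k' * l - real k * l'" using lt by (simp add: of_nat_diff)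
  finally have 1: "real e * e \<le> real k' * l - real k * l'" by simp
  have "(e / L) ^ 2 = real e * e / (L * L)" by (simp add: power2_eq_square)
  also have "\<dots> \<le> real e * e / (real l * l')"
    using assms by (intro divide_left_mono mult_mono) auto
  also have "\<dots> \<le> (real k' * l - real k * l') / (real l * l')"
    using 1 by (intro divide_right_mono) auto
  also have "\<dots> = real k' / l' - real k / l"
    using assms by (simp add: field_simps)
  finally show ?thesis .
qed

lemma fraction_eq_imp_eq:
  fixes k l k' l' e :: nat
  assumes "gcd k l = e" "gcd k' l' = e" "real k / l = real k' / l'" "l > 0" "l' > 0"
  shows "k = k' \<and> l = l'"
proof -
  have e: "e > 0" using assms(1,4) by auto
  obtain a b where ab: "k = a * e" "l = b * e" "coprime a b"
    using gcd_coprime_exists[of k l] e assms by auto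
  obtain a' b' where ab': "k' = a' * e" "l' = b' * e" "coprime a' b'"
    using gcd_coprime_exists[of k' l'] e assms by auto
  have "real (k * l') = real (k' * l)" using assms by (simp add: field_simps)
  hence "k * l' = k' * l" by (simp only: of_nat_eq_iff)
  hence "a * b' = a' * b" using e by (simp add: ab ab' algebra_simps)
  hence "a = a' \<and> b' = b"
    using coprime_crossproduct_nat[of a b a' b'] ab ab' by (metis coprime_commute mult.commute)
  thus ?thesis by (simp add: ab ab')
qed

lemma card_pairs_gcd_le:
  fixes A B :: real and d :: nat
  assumes "A \<ge> 0" "B \<ge> 0" "d > 0" "S \<subseteq> {(a, b). a > 0 \<and> b > 0 \<and> real a \<le> A \<and> real b \<le> B \<and> gcd a b = d}"
  shows "finite S" "real (card S) \<le> A * B / real d ^ 2"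
proof -
  define g where "g = (\<lambda>(a::nat, b::nat). (a div d, b div d))"
  define T where "T = {1..nat \<lfloor>A / d\<rfloor>} \<times> {1..nat \<lfloor>B / d\<rfloor>}"
  have fT: "finite T" by (simp add: T_def)
  have inj: "inj_on g S"
  proof (rule inj_onI, clarify)
    fix a b a' b' assume "(a, b) \<in> S" "(a', b') \<in> S" "g (a, b) = g (a', b')"
    hence "d dvd a" "d dvd b" "d dvd a'" "d dvd b'" "a div d = a' div d" "b div d = b' div d"
      using assms by (auto simp: g_def)
    thus "a = a' \<and> b = b'" by (metis dvd_div_mult_self)
  qed
  have sub: "g ` S \<subseteq> T"
  proof
    fix z assume "z \<in> g ` S"
    then obtain a b where ab: "(a, b) \<in> S" and z: "z = g (a, b)" by auto
    hence *: "d dvd a" "d dvd b" "a > 0" "b > 0" "real a \<le> A" "real b \<le> B" using assms by auto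
    have "real (a div d) = a / d" "real (b div d) = b / d" using * by (simp_all add: real_of_nat_div)
    moreover have "real a / d \<le> A / d" "real b / d \<le> B / d" using * by (auto intro!: divide_right_mono)
    ultimately have "a div d \<le> nat \<lfloor>A / d\<rfloor>" "b div d \<le> nat \<lfloor>B / d\<rfloor>" by (auto simp: le_nat_floor)
    moreover have "a div d \<ge> 1" "b div d \<ge> 1" using * assms
      by (auto simp: Suc_le_eq div_greater_zero_iff dvd_imp_le)
    ultimately show "z \<in> T" by (auto simp: z g_def T_def)
  qed
  show fin: "finite S" using inj sub fT by (metis finite_imageD finite_subset)
  have "card S \<le> card T" using inj sub fT by (metis card_inj_on_le)
  hence "real (card S) \<le> real (nat \<lfloor>A / d\<rfloor>) * real (nat \<lfloor>B / d\<rfloor>)"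
    by (simp add: T_def flip: of_nat_mult)
  also have "\<dots> \<le> (A / d) * (B / d)" using assms by (intro mult_mono) auto
  also have "\<dots> = A * B / real d ^ 2" by (simp add: power2_eq_square)
  finally show "real (card S) \<le> A * B / real d ^ 2" .
qed

text \<open>Let X and Y bound the numbers of pairs (a,b) and (k,l). Over a fixed (a,b) the fractions
  k/l lie in a short interval and are spaced, and the same holds with the roles exchanged. The two
  resulting bounds are X + 4c\<Delta>XY and Y + 4c\<Delta>XY, and min(X,Y) is at most the square
  root of XY. The constant c says that the denominators b and l stay within a factor c of their
  maxima, so that the ratios are controlled by A/B and K/L.\<close>

lemma card_near_power_fixed_gcds:
  fixes A B K L c \<Delta> :: real and Q :: "(nat \<times> nat \<times> nat \<times> nat) set" and d e q :: nat
  assumes fin: "finite Q" and pos: "A > 0" "B > 0" "K > 0" "L > 0" and c: "c \<ge> 1" and D: "\<Delta> \<ge> 0"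
    and q: "q \<ge> 1" and de: "d > 0" "e > 0"
    and Q: "\<And>a b k l. (a, b, k, l) \<in> Q \<Longrightarrow> a > 0 \<and> b > 0 \<and> k > 0 \<and> l > 0 \<and> real a \<le> A \<and> real b \<le> B \<and> B \<le> c * b
      \<and> real k \<le> K \<and> real l \<le> L \<and> L \<le> c * l \<and> gcd a b = d \<and> gcd k l = e
      \<and> \<bar>real k * real b ^ q - real l * real a ^ q\<bar> \<le> \<Delta> * (real l * real a ^ q)"
  shows "real (card Q) \<le> sqrt (A * B * K * L) / (real d * real e) + 4 * c * \<Delta> * (A * B * K * L) / (real d * real e)"
proof -
  define X Y where "X = A * B / real d ^ 2" and "Y = K * L / real e ^ 2"
  have XY: "X > 0" "Y > 0" using pos de by (auto simp: X_def Y_def)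
  define g where "g = (\<lambda>(a::nat, b::nat, k::nat, l::nat). (a, b))"
  define h where "h = (\<lambda>(a::nat, b::nat, k::nat, l::nat). (k, l))"
  have gX: "finite (g ` Q)" "real (card (g ` Q)) \<le> X"
  proof -
    have "g ` Q \<subseteq> {(a, b). a > 0 \<and> b > 0 \<and> real a \<le> A \<and> real b \<le> B \<and> gcd a b = d}"
      using Q by (force simp: g_def)
    from card_pairs_gcd_le[OF _ _ de(1) this] pos show "finite (g ` Q)" "real (card (g ` Q)) \<le> X"
      by (auto simp: X_def)
  qed
  have hY: "finite (h ` Q)" "real (card (h ` Q)) \<le> Y"
  proof -
    have "h ` Q \<subseteq> {(a, b). a > 0 \<and> b > 0 \<and> real a \<le> K \<and> real b \<le> L \<and> gcd a b = e}"
      using Q by (force simp: h_def)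
    from card_pairs_gcd_le[OF _ _ de(2) this] pos show "finite (h ` Q)" "real (card (h ` Q)) \<le> Y"
      by (auto simp: Y_def)
  qed
  have main: "real (card Q) \<le> sqrt (X * Y) + 4 * c * \<Delta> * (X * Y)"
  proof (cases "\<Delta> \<le> 1 / 2")
    \<comment> \<open>For large \<Delta> the trivial bound XY is already below the second term, as
      4c\<Delta> exceeds 1. The other case may then divide by 1 - \<Delta>.\<close>
    case False
    have "Q \<subseteq> (\<lambda>((a, b), (k, l)). (a, b, k, l)) ` (g ` Q \<times> h ` Q)"
      by (force simp: g_def h_def image_iff)
    hence "card Q \<le> card ((\<lambda>((a, b), (k, l)). (a, b, k, l)) ` (g ` Q \<times> h ` Q))"
      using gX hY by (intro card_mono) auto
    also have "\<dots> \<le> card (g ` Q \<times> h ` Q)" using gX hY by (intro card_image_le) auto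
    finally have "real (card Q) \<le> real (card (g ` Q)) * real (card (h ` Q))"
      by (simp add: card_cartesian_product flip: of_nat_mult)
    also have "\<dots> \<le> X * Y" using gX hY XY by (intro mult_mono) auto
    also have "\<dots> \<le> 4 * c * \<Delta> * (X * Y)"
    proof -
      have "1 * (1/2) \<le> c * \<Delta>" using False c D by (intro mult_mono) auto
      hence "1 \<le> 4 * c * \<Delta>" by linarith
      thus ?thesis using XY by (metis mult_le_cancel_right1 mult_pos_pos not_less_iff_gr_or_eq)
    qed
    also have "\<dots> \<le> sqrt (X * Y) + 4 * c * \<Delta> * (X * Y)" using XY by simp
    finally show ?thesis .
  next
    case True
    have near: "\<bar>real k / l - (real a / b) ^ q\<bar> \<le> \<Delta> * (real a / b) ^ q" if "(a, b, k, l) \<in> Q" for a b k l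
    proof -
      note * = Q[OF that]
      have "\<bar>real k / l - (real a / b) ^ q\<bar> = \<bar>real k * real b ^ q - real l * real a ^ q\<bar> / (l * real b ^ q)"
      proof -
        have "real k / l - (real a / b) ^ q = (real k * real b ^ q - real l * real a ^ q) / (l * real b ^ q)"
          using * by (simp add: power_divide field_simps)
        thus ?thesis by (simp add: abs_mult)
      qed
      also have "\<dots> \<le> (\<Delta> * (real l * real a ^ q)) / (l * real b ^ q)"
        using * by (intro divide_right_mono) auto
      also have "\<dots> = \<Delta> * (real a / b) ^ q" using * by (simp add: power_divide field_simps)
      finally show ?thesis .
    qed
    \<comment> \<open>All k/l lie within \<Delta>\<rho> of \<rho> = (a/b)^q. Any single member of
      the fibre bounds \<rho> by 2cK/L, which turns the ratio of interval length and spacing into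
      4c\<Delta>Y.\<close>
    have fib1: "real (card {z \<in> Q. g z = p}) \<le> 4 * c * \<Delta> * Y + 1" if p: "p \<in> g ` Q" for p
    proof -
      obtain a b where ab: "p = (a, b)" by (cases p)
      define F where "F = {z \<in> Q. g z = p}"
      define w where "w = (\<lambda>(a::nat, b::nat, k::nat, l::nat). real k / l)"
      have F: "z \<in> F \<Longrightarrow> \<exists>k l. z = (a, b, k, l) \<and> (a, b, k, l) \<in> Q" for z
        by (cases z) (auto simp: F_def g_def ab)
      define \<rho> where "\<rho> = (real a / b) ^ q"
      from p obtain k0 l0 where kl0: "(a, b, k0, l0) \<in> Q" by (auto simp: ab g_def)
      have \<rho>0: "\<rho> \<ge> 0" by (simp add: \<rho>_def)
      have \<rho>: "\<rho> \<le> 2 * c * K / L"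
      proof -
        have "\<rho> - real k0 / l0 \<le> \<rho> / 2"
          using near[OF kl0] True \<rho>0 mult_right_mono[of \<Delta> "1/2" \<rho>] unfolding \<rho>_def[symmetric] by linarith
        hence "\<rho> \<le> 2 * (k0 / l0)" by linarith
        also have "real k0 / l0 \<le> c * K / L"
        proof -
          have "L * real k0 \<le> (c * l0) * K" using Q[OF kl0] pos c by (intro mult_mono) auto
          thus ?thesis using Q[OF kl0] pos by (simp add: field_simps)
        qed
        finally show ?thesis by simp
      qed
      have "inj_on w F"
      proof (rule inj_onI)
        fix z z' assume z: "z \<in> F" "z' \<in> F" "w z = w z'"
        obtain k l k' l' where "z = (a, b, k, l)" "z' = (a, b, k', l')" "(a, b, k, l) \<in> Q" "(a, b, k', l') \<in> Q"
          using F[OF z(1)] F[OF z(2)] by auto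
        thus "z = z'" using z(3) fraction_eq_imp_eq[of k l e k' l'] by (auto simp: w_def dest!: Q)
      qed
      hence "card F = card (w ` F)" by (simp add: card_image)
      also have "real \<dots> \<le> (2 * \<Delta> * \<rho>) / (e / L) ^ 2 + 1"
      proof (rule card_spaced_le)
        show "finite (w ` F)" using fin by (simp add: F_def)
        show "0 < (e / L) ^ 2" using pos de by simp
        show "0 \<le> 2 * \<Delta> * \<rho>" using D \<rho>0 by simp
        fix r r' assume r: "r \<in> w ` F" "r' \<in> w ` F"
        then obtain k l k' l' where kl: "r = real k / l" "r' = real k' / l'" "(a, b, k, l) \<in> Q" "(a, b, k', l') \<in> Q"
          using F by (fastforce simp: w_def)
        show "r' - r \<le> 2 * \<Delta> * \<rho>"
          using near[OF kl(3)] near[OF kl(4)] unfolding kl \<rho>_def by linarith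
        show "(e / L) ^ 2 \<le> r' - r" if "r < r'"
          using that kl unfolding kl by (intro fraction_spacing) (auto dest!: Q)
      qed
      also have "\<dots> = (2 * \<Delta> * L ^ 2 / e ^ 2) * \<rho> + 1" using pos de by (simp add: field_simps)
      also have "\<dots> \<le> (2 * \<Delta> * L ^ 2 / e ^ 2) * (2 * c * K / L) + 1"
        using \<rho> D by (intro add_mono mult_left_mono) auto
      also have "\<dots> = 4 * c * \<Delta> * Y + 1" using pos by (simp add: Y_def power2_eq_square)
      finally show ?thesis by (simp add: F_def)
    qed
    \<comment> \<open>With k/l fixed, two admissible ratios satisfy (r'/r)^q <=
      (1+\<Delta>)/(1-\<Delta>) <= 1 + 4\<Delta>. For r' > r the ratio r'/r is at most its q-th
      power, so no root has to be extracted.\<close>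
    have fib2: "real (card {z \<in> Q. h z = p}) \<le> 4 * c * \<Delta> * X + 1" if p: "p \<in> h ` Q" for p
    proof -
      obtain k l where kl: "p = (k, l)" by (cases p)
      define F where "F = {z \<in> Q. h z = p}"
      define w where "w = (\<lambda>(a::nat, b::nat, k::nat, l::nat). real a / b)"
      have F: "z \<in> F \<Longrightarrow> \<exists>a b. z = (a, b, k, l) \<and> (a, b, k, l) \<in> Q" for z
        by (cases z) (auto simp: F_def h_def kl)
      have "inj_on w F"
      proof (rule inj_onI)
        fix z z' assume z: "z \<in> F" "z' \<in> F" "w z = w z'"
        obtain a b a' b' where "z = (a, b, k, l)" "z' = (a', b', k, l)" "(a, b, k, l) \<in> Q" "(a', b', k, l) \<in> Q"
          using F[OF z(1)] F[OF z(2)] by auto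
        thus "z = z'" using z(3) fraction_eq_imp_eq[of a b d a' b'] by (auto simp: w_def dest!: Q)
      qed
      hence "card F = card (w ` F)" by (simp add: card_image)
      also have "real \<dots> \<le> (4 * \<Delta> * (c * A / B)) / (d / B) ^ 2 + 1"
      proof (rule card_spaced_le)
        show "finite (w ` F)" using fin by (simp add: F_def)
        show "0 < (d / B) ^ 2" using pos de by simp
        show nn: "0 \<le> 4 * \<Delta> * (c * A / B)" using D c pos by simp
        fix r r' assume r: "r \<in> w ` F" "r' \<in> w ` F"
        then obtain a b a' b' where ab: "r = real a / b" "r' = real a' / b'" "(a, b, k, l) \<in> Q" "(a', b', k, l) \<in> Q"
          using F by (fastforce simp: w_def)
        show "(d / B) ^ 2 \<le> r' - r" if "r < r'"
          using that ab unfolding ab by (intro fraction_spacing) (auto dest!: Q)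
        show "r' - r \<le> 4 * \<Delta> * (c * A / B)"
        proof (cases "r < r'")
          case lt: True
          have r0: "r > 0" using Q[OF ab(3)] by (simp add: ab)
          have r1: "r \<le> c * A / B"
          proof -
            have "B * real a \<le> (c * b) * A" using Q[OF ab(3)] pos c by (intro mult_mono) auto
            thus ?thesis using Q[OF ab(3)] pos by (simp add: ab field_simps)
          qed
          have 1: "r' ^ q * (1 - \<Delta>) \<le> r ^ q * (1 + \<Delta>)"
            using near[OF ab(3)] near[OF ab(4)] unfolding ab[symmetric] by (simp add: algebra_simps)
          have 2: "1 + \<Delta> \<le> (1 + 4 * \<Delta>) * (1 - \<Delta>)"
          proof -
            have "\<Delta> * (1/2 - \<Delta>) \<ge> 0" using True D by simp
            thus ?thesis by (simp add: algebra_simps)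
          qed
          have "r' ^ q * (1 - \<Delta>) \<le> (r ^ q * (1 + 4 * \<Delta>)) * (1 - \<Delta>)"
            using order_trans[OF 1 mult_left_mono[OF 2, of "r ^ q"]] r0 by (simp add: mult_ac)
          hence 3: "r' ^ q \<le> r ^ q * (1 + 4 * \<Delta>)"
            by (rule mult_right_le_imp_le) (use True in simp)
          have "r' / r \<le> (r' / r) ^ q" using q lt r0 by (intro self_le_power) auto
          also have "\<dots> \<le> 1 + 4 * \<Delta>" using 3 r0 by (simp add: power_divide field_simps)
          finally have "r' - r \<le> 4 * \<Delta> * r" using r0 by (simp add: field_simps)
          also have "\<dots> \<le> 4 * \<Delta> * (c * A / B)" using r1 D by (intro mult_left_mono) auto
          finally show ?thesis .
        qed (use nn in linarith)
      qed
      also have "\<dots> = 4 * c * \<Delta> * X + 1" using pos de by (simp add: X_def power2_eq_square field_simps)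
      finally show ?thesis by (simp add: F_def)
    qed
    have nn: "0 \<le> 4 * c * \<Delta> * Y + 1" "0 \<le> 4 * c * \<Delta> * X + 1" using c D XY by auto
    have b1: "real (card Q) \<le> X * (4 * c * \<Delta> * Y + 1)"
      using card_le_fibres[OF fin gX(1) order_refl fib1] mult_right_mono[OF gX(2) nn(1)] by linarith
    have b2: "real (card Q) \<le> Y * (4 * c * \<Delta> * X + 1)"
      using card_le_fibres[OF fin hY(1) order_refl fib2] mult_right_mono[OF hY(2) nn(2)] by linarith
    have "min X Y \<le> sqrt (X * Y)"
      using XY by (intro real_le_rsqrt) (auto simp: power2_eq_square min_def mult_left_mono mult_right_mono)
    thus ?thesis using b1 b2 by (auto simp: algebra_simps min_def split: if_splits)
  qed
  have XYeq: "X * Y = A * B * K * L / (real d * e) ^ 2"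
    by (simp add: X_def Y_def power_mult_distrib)
  have s: "sqrt (X * Y) = sqrt (A * B * K * L) / (real d * e)"
    unfolding XYeq by (simp add: real_sqrt_divide)
  \<comment> \<open>One factor 1/(de) is given away, so that both terms become harmonic sums when d
    and e vary.\<close>
  have "X * Y \<le> A * B * K * L / (real d * e)"
  proof -
    have "real d * e \<ge> 1 * 1" using de by (intro mult_mono) auto
    hence "(real d * e) \<le> (real d * e) ^ 2" by (simp add: self_le_power)
    thus ?thesis unfolding XYeq using pos de by (intro divide_left_mono) auto
  qed
  hence "4 * c * \<Delta> * (X * Y) \<le> 4 * c * \<Delta> * (A * B * K * L / (real d * e))"
    using c D by (intro mult_left_mono) auto
  thus ?thesis using main s by simp
qed

text \<open>Split by the two gcds. They are at most a <= A and k <= K, and each of the two harmonic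
  sums costs one logarithm.\<close>

lemma card_near_power:
  fixes A B K L c \<Delta> :: real and Q :: "(nat \<times> nat \<times> nat \<times> nat) set" and q :: nat
  assumes fin: "finite Q" and pos: "A \<ge> 1" "B > 0" "K \<ge> 1" "L > 0" and c: "c \<ge> 1" and D: "\<Delta> \<ge> 0" and q: "q \<ge> 1"
    and Q: "\<And>a b k l. (a, b, k, l) \<in> Q \<Longrightarrow> a > 0 \<and> b > 0 \<and> k > 0 \<and> l > 0 \<and> real a \<le> A \<and> real b \<le> B \<and> B \<le> c * b
      \<and> real k \<le> K \<and> real l \<le> L \<and> L \<le> c * l
      \<and> \<bar>real k * real b ^ q - real l * real a ^ q\<bar> \<le> \<Delta> * (real l * real a ^ q)"
  shows "real (card Q) \<le> (1 + ln A) * (1 + ln K) * (sqrt (A * B * K * L) + 4 * c * \<Delta> * (A * B * K * L))"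
proof -
  define Z where "Z = sqrt (A * B * K * L) + 4 * c * \<Delta> * (A * B * K * L)"
  define D where "D = {1..nat \<lfloor>A\<rfloor>}"
  define E where "E = {1..nat \<lfloor>K\<rfloor>}"
  define QQ where "QQ d e = {z \<in> Q. case z of (a, b, k, l) \<Rightarrow> gcd a b = d \<and> gcd k l = e}" for d e :: nat
  have Z: "Z \<ge> 0" using pos c assms(7) by (simp add: Z_def)
  have "Q \<subseteq> (\<Union>d\<in>D. \<Union>e\<in>E. QQ d e)"
  proof
    fix z assume z: "z \<in> Q"
    obtain a b k l where abkl: "z = (a, b, k, l)" by (cases z)
    have *: "a > 0" "k > 0" "real a \<le> A" "real k \<le> K" using Q z unfolding abkl by auto
    hence "gcd a b \<in> D" "gcd k l \<in> E"
      by (auto simp: D_def E_def Suc_le_eq intro!: le_nat_floor order_trans[OF _ *(3)] order_trans[OF _ *(4)] gcd_le1_nat)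
    thus "z \<in> (\<Union>d\<in>D. \<Union>e\<in>E. QQ d e)" using z by (auto simp: QQ_def abkl)
  qed
  hence "card Q \<le> card (\<Union>d\<in>D. \<Union>e\<in>E. QQ d e)"
    using fin by (intro card_mono) (auto simp: D_def E_def QQ_def)
  also have "\<dots> \<le> (\<Sum>d\<in>D. card (\<Union>e\<in>E. QQ d e))" by (intro card_UN_le) (simp add: D_def)
  also have "\<dots> \<le> (\<Sum>d\<in>D. \<Sum>e\<in>E. card (QQ d e))" by (intro sum_mono card_UN_le) (simp add: E_def)
  finally have "real (card Q) \<le> (\<Sum>d\<in>D. \<Sum>e\<in>E. real (card (QQ d e)))"
    by (simp flip: of_nat_sum)
  also have "\<dots> \<le> (\<Sum>d\<in>D. \<Sum>e\<in>E. 1 / real d * (1 / real e) * Z)"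
  proof (intro sum_mono)
    fix d e assume de: "d \<in> D" "e \<in> E"
    have "real (card (QQ d e)) \<le> sqrt (A * B * K * L) / (real d * real e) + 4 * c * \<Delta> * (A * B * K * L) / (real d * real e)"
      using fin pos c assms(7) q de
      by (intro card_near_power_fixed_gcds[where q = q]) (auto simp: QQ_def D_def E_def dest!: Q)
    thus "real (card (QQ d e)) \<le> 1 / real d * (1 / real e) * Z"
      by (simp add: Z_def add_divide_distrib)
  qed
  also have "\<dots> = (\<Sum>d\<in>D. 1 / real d) * (\<Sum>e\<in>E. 1 / real e) * Z"
    unfolding sum_product by (simp only: sum_distrib_right)
  also have "\<dots> \<le> (1 + ln A) * (1 + ln K) * Z"
  proof (intro mult_right_mono mult_mono Z sum_nonneg)
    have *: "(\<Sum>d=1..nat \<lfloor>x\<rfloor>. 1 / real d) \<le> 1 + ln x" if "x \<ge> 1" for x :: real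
    proof -
      have "nat \<lfloor>x\<rfloor> \<ge> 1" using that by linarith
      hence "(\<Sum>d=1..nat \<lfloor>x\<rfloor>. 1 / real d) \<le> 1 + ln (real (nat \<lfloor>x\<rfloor>))" by (rule harmonic_sum_le)
      also have "\<dots> \<le> 1 + ln x" using that by simp
      finally show ?thesis .
    qed
    show "(\<Sum>d\<in>D. 1 / real d) \<le> 1 + ln A" "(\<Sum>e\<in>E. 1 / real e) \<le> 1 + ln K"
      unfolding D_def E_def using pos by (intro *; simp)+
  qed (use pos in auto)
  finally show ?thesis by (simp add: Z_def)
qed

section \<open>Integer relations between near multiples\<close>

text \<open>By \<open>pade_identity\<close> this equals pade(v,w)/v^s - pade(w,v)/w^s: the value of
  an integer relation when the multipliers are replaced by 1/v^s and 1/w^s.\<close>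

definition pade_gap :: "nat \<Rightarrow> real \<Rightarrow> real \<Rightarrow> real" where
  "pade_gap s v w = (w - v) ^ (2 * s - 1) / (v ^ s * w ^ s)"

lemma pade_gap_bounds:
  assumes "N > 0" "N \<le> v" "v \<le> w" "w \<le> 2 * N"
  shows "(w - v) ^ (2 * s - 1) / (2 * N) ^ (2 * s) \<le> pade_gap s v w"
    and "pade_gap s v w \<le> (w - v) ^ (2 * s - 1) / N ^ (2 * s)"
proof -
  have e: "c ^ (2 * s) = c ^ s * c ^ s" for c :: real by (metis power_add mult_2)
  have *: "N ^ s * N ^ s \<le> v ^ s * w ^ s" "v ^ s * w ^ s \<le> (2 * N) ^ s * (2 * N) ^ s"
    using assms by (intro mult_mono power_mono; simp)+
  have p: "0 < v ^ s * w ^ s" using assms by simp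
  show "(w - v) ^ (2 * s - 1) / (2 * N) ^ (2 * s) \<le> pade_gap s v w"
    unfolding pade_gap_def e using assms * p by (intro divide_left_mono) auto
  show "pade_gap s v w \<le> (w - v) ^ (2 * s - 1) / N ^ (2 * s)"
    unfolding pade_gap_def e using assms * p by (intro divide_left_mono) auto
qed

text \<open>A single factor v/(v+h) already produces a relative drop of h/(2N); all other factors of
  the quotient are at most 1 and are discarded.\<close>

lemma inverse_power_shift_lower:
  fixes v w h N :: real
  assumes "N > 0" "N \<le> v" "N \<le> w" "h \<ge> 0" "v + h \<le> 2 * N" "w + h \<le> 2 * N" "s \<ge> 1"
  shows "h / (2 * N) ^ (2 * s + 1) \<le> 1 / (v ^ s * w ^ s) - 1 / ((v + h) ^ s * (w + h) ^ s)"
proof -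
  have p: "v > 0" "w > 0" using assms by auto
  have "v ^ s * w ^ s / ((v + h) ^ s * (w + h) ^ s) \<le> v / (v + h)"
  proof -
    have "v ^ s * w ^ s / ((v + h) ^ s * (w + h) ^ s) = (v / (v + h)) ^ s * (w / (w + h)) ^ s"
      by (simp add: power_divide)
    also have "\<dots> \<le> (v / (v + h)) ^ 1 * 1"
      using p assms by (intro mult_mono power_decreasing power_le_one) auto
    finally show ?thesis by simp
  qed
  moreover have "1 - v / (v + h) = h / (v + h)" using p assms by (simp add: field_simps)
  moreover have "h / (v + h) \<ge> h / (2 * N)" using p assms by (intro divide_left_mono) auto
  ultimately have 1: "h / (2 * N) \<le> 1 - v ^ s * w ^ s / ((v + h) ^ s * (w + h) ^ s)" by simp
  have "h / (2 * N) ^ (2 * s + 1) = h / (2 * N) * (1 / ((2 * N) ^ s * (2 * N) ^ s))"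
  proof -
    have "(2 * N) ^ (2 * s + 1) = 2 * N * ((2 * N) ^ s * (2 * N) ^ s)"
    proof -
      have "2 * s + 1 = 1 + (s + s)" by simp
      thus ?thesis by (simp only: power_add power_one_right)
    qed
    thus ?thesis by simp
  qed
  also have "\<dots> \<le> h / (2 * N) * (1 / (v ^ s * w ^ s))"
    using p assms by (intro mult_left_mono divide_left_mono mult_mono power_mono) auto
  also have "\<dots> \<le> (1 - v ^ s * w ^ s / ((v + h) ^ s * (w + h) ^ s)) * (1 / (v ^ s * w ^ s))"
    using 1 p by (intro mult_right_mono) auto
  also have "\<dots> = 1 / (v ^ s * w ^ s) - 1 / ((v + h) ^ s * (w + h) ^ s)"
  proof -
    have "(1 - X / Z) * (1 / X) = 1 / X - 1 / Z" if "X \<noteq> 0" for X Z :: real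
      using that unfolding left_diff_distrib by simp
    thus ?thesis using p by (metis mult_eq_0_iff power_not_zero less_irrefl)
  qed
  finally show ?thesis .
qed

lemma inverse_power_shift_upper:
  fixes v w h N :: real
  assumes "N > 0" "N \<le> v" "N \<le> w" "h \<ge> 0" "v + h \<le> 2 * N" "w + h \<le> 2 * N" "s \<ge> 1"
  shows "1 / (v ^ s * w ^ s) - 1 / ((v + h) ^ s * (w + h) ^ s) \<le> real s * 4 ^ s * h / N ^ (2 * s + 1)"
proof -
  define X where "X = (v + h) * (w + h)"
  define Y where "Y = v * w"
  have p: "v > 0" "w > 0" "X > 0" "Y > 0" "Y \<le> X" using assms by (auto simp: X_def Y_def intro: mult_mono)
  have NX: "N ^ 2 \<le> Y" "X \<le> 4 * N ^ 2"
    using mult_mono[of N v N w] mult_mono[of "v + h" "2 * N" "w + h" "2 * N"] assms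
    by (auto simp: X_def Y_def power2_eq_square)
  have XY: "X - Y \<le> 4 * N * h"
  proof -
    have "X - Y = h * (v + (w + h))" by (simp add: X_def Y_def algebra_simps)
    also have "\<dots> \<le> h * (4 * N)" using assms by (intro mult_left_mono) auto
    finally show ?thesis by (simp add: mult_ac)
  qed
  have "4 * N\<^sup>2 * \<bar>X ^ s - Y ^ s\<bar> \<le> s * (4 * N\<^sup>2) ^ s * \<bar>X - Y\<bar>"
    using p NX by (intro abs_power_diff_le) auto
  also have "\<dots> \<le> s * (4 * N\<^sup>2) ^ s * (4 * N * h)"
    using p XY by (intro mult_left_mono) auto
  finally have "4 * N\<^sup>2 * (X ^ s - Y ^ s) \<le> s * (4 * N\<^sup>2) ^ s * (4 * N * h)"
    using p by (simp add: power_mono)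
  then have 1: "(X ^ s - Y ^ s) \<le> s * (4 * N\<^sup>2) ^ s * (h / N)"
  proof -
    assume "4 * N\<^sup>2 * (X ^ s - Y ^ s) \<le> s * (4 * N\<^sup>2) ^ s * (4 * N * h)"
    also have "\<dots> = 4 * N\<^sup>2 * (s * (4 * N\<^sup>2) ^ s * (h / N))"
      using assms by (simp add: power2_eq_square)
    finally show ?thesis by (rule mult_left_le_imp_le) (use assms in simp)
  qed
  have 2: "(N ^ 2) ^ s * (N ^ 2) ^ s \<le> Y ^ s * X ^ s"
    using p NX by (intro mult_mono power_mono) auto
  have "1 / (v ^ s * w ^ s) - 1 / ((v + h) ^ s * (w + h) ^ s) = (X ^ s - Y ^ s) / (Y ^ s * X ^ s)"
  proof -
    have "v ^ s * w ^ s = Y ^ s" "(v + h) ^ s * (w + h) ^ s = X ^ s"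
      by (simp_all only: X_def Y_def power_mult_distrib)
    moreover have "Y ^ s \<noteq> 0" "X ^ s \<noteq> 0" using p by auto
    ultimately show ?thesis by (simp add: diff_frac_eq)
  qed
  also have "\<dots> \<le> (s * (4 * N\<^sup>2) ^ s * (h / N)) / ((N ^ 2) ^ s * (N ^ 2) ^ s)"
    using 1 2 assms p by (intro frac_le) auto
  also have "\<dots> = real s * 4 ^ s * (h / N) / (N ^ 2) ^ s"
    using assms by (simp add: power_mult_distrib)
  also have "\<dots> = real s * 4 ^ s * h / N ^ (2 * s + 1)"
  proof -
    have "N ^ (2 * s + 1) = N * (N ^ 2) ^ s" by (simp add: power_mult)
    thus ?thesis by (simp only: times_divide_eq_right divide_divide_eq_left)
  qed
  finally show ?thesis .
qed

text \<open>A translation leaves the numerator alone, so only the denominators change. The lower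
  bound converts equality of two relations into a bound on h; the upper bound transports this to the
  union of two gaps.\<close>

lemma pade_gap_shift:
  assumes "N > 0" "N \<le> v" "v \<le> w" "h \<ge> 0" "w + h \<le> 2 * N" "s \<ge> 1"
  shows "(w - v) ^ (2 * s - 1) * h / (2 * N) ^ (2 * s + 1) \<le> pade_gap s v w - pade_gap s (v + h) (w + h)"
    and "pade_gap s v w - pade_gap s (v + h) (w + h) \<le> (w - v) ^ (2 * s - 1) * (real s * 4 ^ s * h) / N ^ (2 * s + 1)"
proof -
  have eq: "pade_gap s v w - pade_gap s (v + h) (w + h) =
      (w - v) ^ (2 * s - 1) * (1 / (v ^ s * w ^ s) - 1 / ((v + h) ^ s * (w + h) ^ s))"
    by (simp add: pade_gap_def right_diff_distrib)
  have nn: "(w - v) ^ (2 * s - 1) \<ge> 0" using assms by simp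
  have bounds: "h / (2 * N) ^ (2 * s + 1) \<le> 1 / (v ^ s * w ^ s) - 1 / ((v + h) ^ s * (w + h) ^ s)"
    "1 / (v ^ s * w ^ s) - 1 / ((v + h) ^ s * (w + h) ^ s) \<le> real s * 4 ^ s * h / N ^ (2 * s + 1)"
    using assms inverse_power_shift_lower[of N v w h s] inverse_power_shift_upper[of N v w h s] by auto
  show "(w - v) ^ (2 * s - 1) * h / (2 * N) ^ (2 * s + 1) \<le> pade_gap s v w - pade_gap s (v + h) (w + h)"
    unfolding eq using mult_left_mono[OF bounds(1) nn] by simp
  show "pade_gap s v w - pade_gap s (v + h) (w + h) \<le> (w - v) ^ (2 * s - 1) * (real s * 4 ^ s * h) / N ^ (2 * s + 1)"
    unfolding eq using mult_left_mono[OF bounds(2) nn] by simp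
qed

text \<open>Up to the factor \<open>((u+a)(u+a+b))\<^sup>-\<^sup>s\<close>, the second difference of \<open>pade_gap\<close> is a
  polynomial in \<open>1/u\<close> with nonnegative coefficients.\<close>

lemma pade_gap_second_diff_shift:
  assumes "N > 0" "N \<le> u" "a \<ge> 0" "b \<ge> 0" "h \<ge> 0" "u + a + b + h \<le> 2 * N" "s \<ge> 1"
  defines "\<Psi> \<equiv> \<lambda>u. pade_gap s u (u + a + b) - pade_gap s u (u + a) - pade_gap s (u + a) (u + a + b)"
  shows "((a + b) ^ (2 * s - 1) - a ^ (2 * s - 1) - b ^ (2 * s - 1)) * h / (2 * N) ^ (2 * s + 1) \<le> \<Psi> u - \<Psi> (u + h)"
proof -
  define q where "q = 2 * s - 1"
  define M where "M z = (a + b) ^ q * (1 + a * z) ^ s - a ^ q * (1 + (a + b) * z) ^ s - b ^ q" for z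
  define W where "W u = 1 / ((u + a) ^ s * (u + a + b) ^ s)" for u
  have \<Psi>: "\<Psi> t = M (1 / t) * W t" if "t > 0" for t
  proof -
    have 1: "1 + a * (1 / t) = (t + a) / t" "1 + (a + b) * (1 / t) = (t + a + b) / t"
      using that by (simp_all add: field_simps)
    have nz: "t + a > 0" "t + a + b > 0" using that assms by auto
    have gen: "X / (P * R) - Y / (P * Q) - Z / (Q * R) = (X * (Q / P) - Y * (R / P) - Z) * (1 / (Q * R))"
      if "P > 0" "Q > 0" "R > 0" for P Q R X Y Z :: real
    proof -
      have "X * (Q / P) * (1 / (Q * R)) = X / (P * R)" "Y * (R / P) * (1 / (Q * R)) = Y / (P * Q)"
        using that by simp_all
      thus ?thesis unfolding left_diff_distrib by simp
    qed
    have d: "t + a + b - t = a + b" "t + a - t = a" "t + a + b - (t + a) = b" by auto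
    show ?thesis
      unfolding \<Psi>_def pade_gap_def M_def W_def 1 power_divide q_def[symmetric] d
      using that nz by (intro gen) auto
  qed
  have Meq: "M z = (\<Sum>j\<le>s. of_nat (s choose j) * z ^ j * ((a + b) ^ q * a ^ j - a ^ q * (a + b) ^ j)) - b ^ q" for z
  proof -
    have e: "(1 + c * z) ^ s = (\<Sum>j\<le>s. of_nat (s choose j) * c ^ j * z ^ j)" for c
      using binomial_ring[of "c * z" 1 s] by (simp add: add.commute power_mult_distrib mult.assoc)
    show ?thesis unfolding M_def e
      by (simp add: sum_distrib_left sum_subtractf[symmetric] algebra_simps)
  qed
  \<comment> \<open>Since j <= s <= q, the factor a^j (a+b)^j can be taken out of both products, and
    a^(q-j) <= (a+b)^(q-j) remains.\<close>
  have co: "(a + b) ^ q * a ^ j - a ^ q * (a + b) ^ j \<ge> 0" if "j \<le> s" for j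
  proof -
    have "j \<le> q" using that assms by (simp add: q_def)
    hence pq: "c ^ q = c ^ (q - j) * c ^ j" for c :: real by (metis le_add_diff_inverse2 power_add)
    have "a ^ q * (a + b) ^ j = a ^ (q - j) * (a ^ j * (a + b) ^ j)"
      unfolding pq by (simp only: mult_ac)
    also have "\<dots> \<le> (a + b) ^ (q - j) * (a ^ j * (a + b) ^ j)"
      using assms by (intro mult_right_mono power_mono) auto
    also have "\<dots> = (a + b) ^ q * a ^ j"
      unfolding pq by (simp only: mult_ac)
    finally show ?thesis by simp
  qed
  have Mmono: "M z \<le> M z'" if "0 \<le> z" "z \<le> z'" for z z'
    unfolding Meq using that co by (intro diff_right_mono sum_mono mult_right_mono mult_left_mono power_mono) auto
  have M0: "M 0 = (a + b) ^ q - a ^ q - b ^ q" by (simp add: M_def)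
  have M0p: "M 0 \<ge> 0"
  proof -
    have "q \<ge> 1" using assms by (simp add: q_def)
    thus ?thesis using power_add_superadditive[of a b q] assms unfolding M0 by linarith
  qed
  have u: "u > 0" "u + h > 0" using assms by auto
  have Wd: "h / (2 * N) ^ (2 * s + 1) \<le> W u - W (u + h)"
    using inverse_power_shift_lower[of N "u + a" "u + a + b" h s] assms
    by (simp add: W_def add_ac)
  have W0: "W u \<ge> 0" "h / (2 * N) ^ (2 * s + 1) \<ge> 0" using assms u by (auto simp: W_def)
  \<comment> \<open>Both M(1/u) and W(u) decrease in u. Keeping M at its later value M(1/(u+h)) >=
    M(0) and letting only W drop gives a lower bound for the drop of the product.\<close>
  have "M 0 * (h / (2 * N) ^ (2 * s + 1)) \<le> M (1 / (u + h)) * (W u - W (u + h))"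
    using M0p Wd W0 Mmono[of 0 "1 / (u + h)"] u by (intro mult_mono) auto
  also have "\<dots> = M (1 / (u + h)) * W u - M (1 / (u + h)) * W (u + h)" by (simp add: algebra_simps)
  also have "\<dots> \<le> M (1 / u) * W u - M (1 / (u + h)) * W (u + h)"
    using u assms W0 by (intro diff_right_mono mult_right_mono Mmono) (auto simp: frac_le)
  finally show ?thesis using \<Psi> u by (simp add: M0 q_def)
qed

text \<open>Only the points u are counted, so one multiplier \<open>m u\<close> per point is fixed
  in advance.\<close>

locale near_multiples =
  fixes s :: nat and x y N :: real and S :: "nat set" and m :: "nat \<Rightarrow> nat"
  assumes s: "s \<ge> 2" and x: "x > 0" and y: "y > 0" and N: "N > 0" and fin: "finite S"
    and range: "\<And>u. u \<in> S \<Longrightarrow> N < real u \<and> real u \<le> 2 * N"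
    and mult: "\<And>u. u \<in> S \<Longrightarrow> x < real u ^ s * real (m u) \<and> real u ^ s * real (m u) \<le> x + y"
begin

text \<open>An integer because \<open>pade\<close> has integer coefficients; this integrality is the
  only arithmetic input of the method.\<close>

definition rel :: "nat \<Rightarrow> nat \<Rightarrow> int" where
  "rel u v = pade s (int u) (int v) * int (m u) - pade s (int v) (int u) * int (m v)"

definition excess :: "nat \<Rightarrow> real" where "excess u = real u ^ s * real (m u) - x"

lemma excess: "u \<in> S \<Longrightarrow> 0 \<le> excess u \<and> excess u \<le> y"
  using mult[of u] by (auto simp: excess_def)

text \<open>Insert m(u) = x/u^s + excess(u)/u^s. The formula is kept exact, with the coefficient of
  each excess visible, because the second difference below relies on cancellation between these
  coefficients.\<close>

lemma real_rel:
  assumes "u \<in> S" "v \<in> S"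
  shows "real_of_int (rel u v) = x * pade_gap s u v
    + pade s (real u) (real v) * (excess u / real u ^ s) - pade s (real v) (real u) * (excess v / real v ^ s)"
proof -
  have p: "real u > 0" "real v > 0" using range[OF assms(1)] range[OF assms(2)] N by auto
  have id: "pade s (real u) (real v) * real v ^ s - pade s (real v) (real u) * real u ^ s = (real v - real u) ^ (2 * s - 1)"
    using s by (intro pade_identity) auto
  have mm: "real (m w) = x / real w ^ s + excess w / real w ^ s" if "real w > 0" for w
    using that by (simp add: excess_def field_simps)
  have "real_of_int (rel u v) = pade s (real u) (real v) * real (m u) - pade s (real v) (real u) * real (m v)"
    by (simp add: rel_def of_int_pade)
  also have "\<dots> = x * (pade s (real u) (real v) / real u ^ s - pade s (real v) (real u) / real v ^ s)
    + pade s (real u) (real v) * (excess u / real u ^ s) - pade s (real v) (real u) * (excess v / real v ^ s)"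
    unfolding mm[OF p(1)] mm[OF p(2)] by (simp add: algebra_simps)
  also have "pade s (real u) (real v) / real u ^ s - pade s (real v) (real u) / real v ^ s = pade_gap s u v"
    unfolding pade_gap_def id[symmetric] using p by (simp add: field_simps)
  finally show ?thesis .
qed

lemma excess_div: "u \<in> S \<Longrightarrow> 0 \<le> excess u / real u ^ s \<and> excess u / real u ^ s \<le> y / N ^ s"
  using excess[of u] range[of u] N y by (auto intro!: frac_le power_mono)

lemma Npow: "N ^ (s - 1) * (y / N ^ s) = y / N"
proof -
  obtain k where "s = Suc k" using s by (cases s) auto
  thus ?thesis using N by simp
qed

lemma rel_approx:
  assumes "u \<in> S" "v \<in> S"
  shows "\<bar>real_of_int (rel u v) - x * pade_gap s u v\<bar> \<le> 2 * 8 ^ s * (y / N)"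
proof -
  have b: "\<bar>pade s (real u) (real v) * (excess u / real u ^ s)\<bar> \<le> 8 ^ s * (y / N)" if "u \<in> S" "v \<in> S" for u v
  proof -
    have "\<bar>pade s (real u) (real v)\<bar> * \<bar>excess u / real u ^ s\<bar> \<le> (8 ^ s * N ^ (s - 1)) * (y / N ^ s)"
      using range[OF that(1)] range[OF that(2)] excess_div[OF that(1)] s N
      by (intro mult_mono abs_pade_le) auto
    also have "\<dots> = 8 ^ s * (y / N)" using Npow by (simp only: mult.assoc)
    finally show ?thesis by (simp only: abs_mult)
  qed
  show ?thesis using real_rel[OF assms] b[OF assms] b[OF assms(2,1)] by linarith
qed

text \<open>Collected at each of the three points, the excess is multiplied by a difference of two
  \<open>pade\<close> values whose arguments are at most w - u apart. The Lipschitz bound thus gains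
  a factor (w-u)/N over \<open>rel_approx\<close>.\<close>

lemma rel_second_diff_approx:
  assumes "u \<in> S" "v \<in> S" "w \<in> S" "u \<le> v" "v \<le> w"
  shows "\<bar>real_of_int (rel u w - rel u v - rel v w) - x * (pade_gap s u w - pade_gap s u v - pade_gap s v w)\<bar>
    \<le> 3 * real s * 8 ^ s * ((real w - real u) * y / N ^ 2)"
proof -
  note r = range[OF assms(1)] range[OF assms(2)] range[OF assms(3)]
  let ?p = "\<lambda>u v. pade s (real u) (real v)" and ?e = "\<lambda>u. excess u / real u ^ s"
  have b: "\<bar>(?p c d - ?p c' d') * ?e z\<bar> \<le> real s * 8 ^ s * ((real w - real u) * y / N ^ 2)"
    if "z \<in> S" "c \<in> S" "d \<in> S" "c' \<in> S" "d' \<in> S" "\<bar>real c - real c'\<bar> + \<bar>real d - real d'\<bar> \<le> real w - real u" for z c d c' d'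
  proof -
    have "\<bar>?p c d - ?p c' d'\<bar> \<le> real s * 8 ^ s * N ^ (s - 1) * ((\<bar>real c - real c'\<bar> + \<bar>real d - real d'\<bar>) / N)"
      using s N range[OF that(2)] range[OF that(3)] range[OF that(4)] range[OF that(5)]
      by (intro abs_pade_diff_le) auto
    also have "\<dots> \<le> real s * 8 ^ s * N ^ (s - 1) * ((real w - real u) / N)"
      using that N by (intro mult_left_mono divide_right_mono) auto
    finally have "\<bar>?p c d - ?p c' d'\<bar> * \<bar>?e z\<bar> \<le> (real s * 8 ^ s * N ^ (s - 1) * ((real w - real u) / N)) * (y / N ^ s)"
      using excess_div[OF that(1)] N assms by (intro mult_mono) auto
    also have "\<dots> = real s * 8 ^ s * ((real w - real u) / N) * (N ^ (s - 1) * (y / N ^ s))" by (simp only: mult_ac)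
    also have "\<dots> = real s * 8 ^ s * ((real w - real u) * y / N ^ 2)"
      unfolding Npow by (simp add: power2_eq_square)
    finally show ?thesis by (simp only: abs_mult)
  qed
  have eq: "real_of_int (rel u w - rel u v - rel v w) - x * (pade_gap s u w - pade_gap s u v - pade_gap s v w)
     = (?p u w - ?p u v) * ?e u + (?p v u - ?p v w) * ?e v + (?p w v - ?p w u) * ?e w"
    using real_rel[of u w] real_rel[of u v] real_rel[of v w] assms
    by (simp add: left_diff_distrib right_diff_distrib diff_divide_distrib)
  have "\<bar>(?p u w - ?p u v) * ?e u\<bar> \<le> real s * 8 ^ s * ((real w - real u) * y / N ^ 2)"
    "\<bar>(?p v u - ?p v w) * ?e v\<bar> \<le> real s * 8 ^ s * ((real w - real u) * y / N ^ 2)"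
    "\<bar>(?p w v - ?p w u) * ?e w\<bar> \<le> real s * 8 ^ s * ((real w - real u) * y / N ^ 2)"
    using assms by (intro b; simp)+
  thus ?thesis unfolding eq by linarith
qed

text \<open>A translation by h lowers the main term by at least x ((a+b)^q - a^q - b^q) h /
  (2N)^(2s+1), while equal second differences allow only twice the small error of
  \<open>rel_second_diff_approx\<close>. As the points are separated by h >= min(a,b), the
  hypothesis \<open>H\<close> makes this impossible.\<close>

lemma second_diff_determines_point:
  fixes u u' a b :: nat
  assumes S: "u \<in> S" "u + a \<in> S" "u + a + b \<in> S" "u' \<in> S" "u' + a \<in> S" "u' + a + b \<in> S"
    and ab: "a > 0" "b > 0" and far: "u + a \<le> u'"
    and H: "x * real (min a b) ^ (2 * s - 1) \<ge> 25 * real s * 32 ^ s * (y * N ^ (2 * s - 1))"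
  shows "rel u (u + a + b) - rel u (u + a) - rel (u + a) (u + a + b)
    \<noteq> rel u' (u' + a + b) - rel u' (u' + a) - rel (u' + a) (u' + a + b)"
proof
  assume eq: "rel u (u + a + b) - rel u (u + a) - rel (u + a) (u + a + b)
    = rel u' (u' + a + b) - rel u' (u' + a) - rel (u' + a) (u' + a + b)"
  define q where "q = 2 * s - 1"
  define h where "h = real u' - real u"
  define \<mu> where "\<mu> = real (min a b)"
  define M where "M = real (max a b)"
  have h: "h \<ge> \<mu>" "u' = u + h" using far by (auto simp: h_def \<mu>_def)
  have \<mu>: "\<mu> \<ge> 1" "\<mu> \<le> M" using ab by (auto simp: \<mu>_def M_def)
  define \<Psi> where "\<Psi> = (\<lambda>u. pade_gap s u (u + a + b) - pade_gap s u (u + a) - pade_gap s (u + a) (u + a + b))"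
  define Er where "Er = 3 * real s * 8 ^ s * ((real a + real b) * y / N ^ 2)"
  have "x * \<Psi> (real u) - x * \<Psi> (real u') \<le> 2 * Er"
  proof -
    have A: "\<bar>real_of_int (rel u (u + a + b) - rel u (u + a) - rel (u + a) (u + a + b)) - x * \<Psi> (real u)\<bar> \<le> Er"
      using rel_second_diff_approx[OF S(1-3)] by (simp add: \<Psi>_def Er_def)
    have B: "\<bar>real_of_int (rel u (u + a + b) - rel u (u + a) - rel (u + a) (u + a + b)) - x * \<Psi> (real u')\<bar> \<le> Er"
      using rel_second_diff_approx[OF S(4-6)] unfolding eq by (simp add: \<Psi>_def Er_def)
    show ?thesis using A B by linarith
  qed
  hence "x * (\<Psi> (real u) - \<Psi> (real u + h)) \<le> 2 * Er" using h by (simp add: right_diff_distrib)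
  moreover have "((real a + real b) ^ q - real a ^ q - real b ^ q) * h / (2 * N) ^ (2 * s + 1) \<le> \<Psi> (real u) - \<Psi> (real u + h)"
    unfolding \<Psi>_def q_def
    using range[OF S(1)] range[OF S(6)] h \<mu> N s
    by (intro pade_gap_second_diff_shift) auto
  ultimately have 1: "x * (((real a + real b) ^ q - real a ^ q - real b ^ q) * h / (2 * N) ^ (2 * s + 1)) \<le> 2 * Er"
    using x by (meson mult_left_mono order_trans less_imp_le)
  have q: "q \<ge> 3" using s by (simp add: q_def)
  have \<psi>: "\<mu> * M ^ (q - 1) \<le> (real a + real b) ^ q - real a ^ q - real b ^ q"
  proof -
    have "0 \<le> real b * real a ^ (q - 1)" "0 \<le> real a * real b ^ (q - 1)" by auto
    moreover have "real a ^ q + real b ^ q + real b * real a ^ (q - 1) + real a * real b ^ (q - 1) \<le> (real a + real b) ^ q"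
      using q by (intro power_add_lower) auto
    moreover have "\<mu> * M ^ (q - 1) = real a * real b ^ (q - 1) \<or> \<mu> * M ^ (q - 1) = real b * real a ^ (q - 1)"
      by (cases "a \<le> b") (simp_all add: \<mu>_def M_def)
    ultimately show ?thesis by linarith
  qed
  \<comment> \<open>The two smallness factors, one from the surplus and one from h, are completed to
    \<mu>^q at the expense of powers of M. The single M left over cancels against the M in the
    error, which is why \<open>H\<close> speaks of the smaller gap only.\<close>
  have "\<mu> ^ q * M \<le> \<mu> * M ^ (q - 1) * \<mu>"
  proof -
    define k where "k = q - 2"
    have qk: "q = k + 2" "q - 1 = k + 1" "q - 2 = k" using q by (auto simp: k_def)
    have "\<mu> ^ q = \<mu> ^ (q - 2) * \<mu> ^ 2" "M ^ (q - 1) = M ^ (q - 2) * M" unfolding qk by (simp_all add: power_add power2_eq_square)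
    moreover have "\<mu> ^ (q - 2) * (\<mu> ^ 2 * M) \<le> M ^ (q - 2) * (\<mu> ^ 2 * M)"
      using \<mu> by (intro mult_right_mono power_mono) auto
    ultimately show ?thesis by (simp add: power2_eq_square mult_ac)
  qed
  also have "\<dots> \<le> ((real a + real b) ^ q - real a ^ q - real b ^ q) * h"
    using \<psi> h \<mu> by (intro mult_mono order_trans[OF _ \<psi>]) auto
  finally have "x * (\<mu> ^ q * M) / (2 * N) ^ (2 * s + 1) \<le> x * (((real a + real b) ^ q - real a ^ q - real b ^ q) * h) / (2 * N) ^ (2 * s + 1)"
    using x N by (intro divide_right_mono mult_left_mono) auto
  also have "\<dots> \<le> 2 * Er" using 1 by simp
  also have "\<dots> \<le> 12 * real s * 8 ^ s * (M * y / N ^ 2)"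
  proof -
    have "real a + real b \<le> 2 * M" by (auto simp: M_def)
    hence "(real a + real b) * y / N ^ 2 \<le> 2 * M * y / N ^ 2"
      using y by (intro divide_right_mono mult_right_mono) auto
    hence "6 * real s * 8 ^ s * ((real a + real b) * y / N ^ 2) \<le> 6 * real s * 8 ^ s * (2 * M * y / N ^ 2)"
      by (intro mult_left_mono) auto
    thus ?thesis by (simp add: Er_def)
  qed
  finally have "x * (\<mu> ^ q * M) \<le> 12 * real s * 8 ^ s * (M * y / N ^ 2) * (2 * N) ^ (2 * s + 1)"
    using N by (simp add: pos_divide_le_eq)
  also have "\<dots> = 12 * real s * 8 ^ s * (M * y / N ^ 2) * (2 * 4 ^ s * (N ^ (2 * s - 1) * N ^ 2))"
  proof -
    have "2 * s + 1 = (2 * s - 1) + 2" using s by simp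
    hence "N ^ (2 * s + 1) = N ^ (2 * s - 1) * N ^ 2" by (metis power_add)
    moreover have "(2::real) ^ (2 * s + 1) = 2 * 4 ^ s" by (simp add: power_mult)
    ultimately show ?thesis by (simp only: power_mult_distrib)
  qed
  also have "\<dots> = M * (24 * real s * (8 * 4) ^ s * (y * N ^ (2 * s - 1)))"
    using N by (simp only: power_mult_distrib) (simp add: field_simps)
  finally have "M * (x * \<mu> ^ q) \<le> M * (24 * real s * 32 ^ s * (y * N ^ (2 * s - 1)))" by (simp add: mult_ac)
  hence "x * \<mu> ^ q \<le> 24 * real s * 32 ^ s * (y * N ^ (2 * s - 1))"
    by (rule mult_left_le_imp_le) (use \<mu> in auto)
  \<comment> \<open>The computation produces 24 s 32^s with 32 = 8 * 4; the 25 in \<open>H\<close>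
    makes the inequality strict.\<close>
  also have "\<dots> < 25 * real s * 32 ^ s * (y * N ^ (2 * s - 1))"
    using s y N by (intro mult_strict_right_mono) auto
  finally show False using H by (simp add: \<mu>_def q_def)
qed

text \<open>If both relations survive a translation, the longer gap bounds the shift h. The same h
  then moves the relation across both gaps by less than 1, so this integer is unchanged too. All
  three relations, hence the second differences, would agree, against
  \<open>second_diff_determines_point\<close>.\<close>

lemma relations_determine_point:
  fixes u u' a b :: nat
  assumes S: "u \<in> S" "u + a \<in> S" "u + a + b \<in> S" "u' \<in> S" "u' + a \<in> S" "u' + a + b \<in> S"
    and ab: "a > 0" "b > 0" and far: "u + a \<le> u'"
    and H: "x * real (min a b) ^ (2 * s - 1) \<ge> 25 * real s * 32 ^ s * (y * N ^ (2 * s - 1))"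
    and yN: "100 * real s * 512 ^ s * y \<le> N"
  shows "rel u (u + a) \<noteq> rel u' (u' + a) \<or> rel (u + a) (u + a + b) \<noteq> rel (u' + a) (u' + a + b)"
proof (rule ccontr)
  assume "\<not> ?thesis"
  hence eq: "rel u (u + a) = rel u' (u' + a)" "rel (u + a) (u + a + b) = rel (u' + a) (u' + a + b)" by auto
  define q where "q = 2 * s - 1"
  define h where "h = real u' - real u"
  define M where "M = real (max a b)"
  define e where "e = 2 * 8 ^ s * (y / N)"
  have h: "h \<ge> 0" "real u' = real u + h" using far by (auto simp: h_def)
  note r = range[OF S(1)] range[OF S(2)] range[OF S(3)] range[OF S(4)] range[OF S(5)] range[OF S(6)]
  have E: "x * (M ^ q * h / (2 * N) ^ (2 * s + 1)) \<le> 2 * e"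
  proof (cases "b \<le> a")
    case True
    have "M ^ q * h / (2 * N) ^ (2 * s + 1) \<le> pade_gap s (real u) (real (u + a)) - pade_gap s (real u + h) (real (u + a) + h)"
      using pade_gap_shift(1)[of N "real u" "real (u + a)" h s] r h N s True by (simp add: M_def q_def)
    hence "x * (M ^ q * h / (2 * N) ^ (2 * s + 1)) \<le> x * (pade_gap s (real u) (real (u + a)) - pade_gap s (real u + h) (real (u + a) + h))"
      using x by (intro mult_left_mono) auto
    also have "\<dots> \<le> 2 * e"
      using rel_approx[OF S(1,2)] rel_approx[OF S(4,5)] eq h by (simp add: e_def right_diff_distrib add_ac)
    finally show ?thesis .
  next
    case False
    have "M ^ q * h / (2 * N) ^ (2 * s + 1) \<le> pade_gap s (real (u + a)) (real (u + a + b)) - pade_gap s (real (u + a) + h) (real (u + a + b) + h)"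
      using pade_gap_shift(1)[of N "real (u + a)" "real (u + a + b)" h s] r h N s False by (simp add: M_def q_def)
    hence "x * (M ^ q * h / (2 * N) ^ (2 * s + 1)) \<le> x * (pade_gap s (real (u + a)) (real (u + a + b)) - pade_gap s (real (u + a) + h) (real (u + a + b) + h))"
      using x by (intro mult_left_mono) auto
    also have "\<dots> \<le> 2 * e"
      using rel_approx[OF S(2,3)] rel_approx[OF S(5,6)] eq h by (simp add: e_def right_diff_distrib add_ac)
    finally show ?thesis .
  qed
  have M: "M \<ge> 1" "real a + real b \<le> 2 * M" using ab by (auto simp: M_def)
  define Dl where "Dl = pade_gap s (real u) (real (u + a + b)) - pade_gap s (real u + h) (real (u + a + b) + h)"
  have Dl0: "0 \<le> Dl" "Dl \<le> (real a + real b) ^ q * (real s * 4 ^ s * h) / N ^ (2 * s + 1)"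
  proof -
    have "0 \<le> (real (u + a + b) - real u) ^ (2 * s - 1) * h / (2 * N) ^ (2 * s + 1)"
      using h N by simp
    also have "\<dots> \<le> Dl" unfolding Dl_def using r h N s by (intro pade_gap_shift(1)) auto
    finally show "0 \<le> Dl" .
    show "Dl \<le> (real a + real b) ^ q * (real s * 4 ^ s * h) / N ^ (2 * s + 1)"
      using pade_gap_shift(2)[of N "real u" "real (u + a + b)" h s] r h N s by (simp add: Dl_def q_def)
  qed
  have "x * Dl \<le> x * ((2 * M) ^ q * (real s * 4 ^ s * h) / N ^ (2 * s + 1))"
    using Dl0(2) x h M N
    by (intro mult_left_mono order_trans[OF Dl0(2)] divide_right_mono mult_right_mono power_mono) auto
  also have "\<dots> = x * (M ^ q * h / (2 * N) ^ (2 * s + 1)) * (real s * 4 ^ s * (2 ^ q * 2 ^ (2 * s + 1)))"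
    using N by (simp add: power_mult_distrib)
  also have "\<dots> \<le> 2 * e * (real s * 4 ^ s * (2 ^ q * 2 ^ (2 * s + 1)))"
    using E by (intro mult_right_mono) auto
  also have "(2::real) ^ q * 2 ^ (2 * s + 1) = 16 ^ s"
  proof -
    have "q + (2 * s + 1) = 4 * s" using s by (simp add: q_def)
    hence "(2::real) ^ q * 2 ^ (2 * s + 1) = 2 ^ (4 * s)" by (metis power_add)
    thus ?thesis by (simp add: power_mult)
  qed
  \<comment> \<open>Here 512 = 8 * 4 * 16: 8^s comes from the error of a relation, 4^s from the
    upper shift bound, and 16^s from passing from M to 2M and from 2N to N.\<close>
  also have "2 * e * (real s * 4 ^ s * 16 ^ s) = 4 * real s * ((8 * (4 * 16)) ^ s) * (y / N)"
    unfolding e_def power_mult_distrib by (simp only: mult_ac) simp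
  finally have xD: "x * Dl \<le> 4 * real s * 512 ^ s * (y / N)" by simp
  have "2 * e \<le> 4 * real s * 512 ^ s * (y / N)"
  proof -
    have "1 * (8::real) ^ s \<le> real s * 512 ^ s" using s by (intro mult_mono power_mono) auto
    hence "2 * (2 * 8 ^ s) * (y / N) \<le> 4 * (real s * 512 ^ s) * (y / N)"
      using y N by (intro mult_right_mono) auto
    thus ?thesis by (simp add: e_def)
  qed
  moreover have "8 * real s * 512 ^ s * (y / N) < 1"
  proof -
    have "8 * real s * 512 ^ s * y < 100 * real s * 512 ^ s * y" using s y by simp
    thus ?thesis using yN N by (simp add: field_simps)
  qed
  moreover have "\<bar>real_of_int (rel u (u + a + b)) - real_of_int (rel u' (u' + a + b))\<bar> \<le> x * Dl + 2 * e"
  proof -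
    have A: "\<bar>real_of_int (rel u (u + a + b)) - x * pade_gap s (real u) (real (u + a + b))\<bar> \<le> e"
      "\<bar>real_of_int (rel u' (u' + a + b)) - x * pade_gap s (real u + h) (real (u + a + b) + h)\<bar> \<le> e"
      using rel_approx[OF S(1,3)] rel_approx[OF S(4,6)] h by (simp_all add: e_def add_ac)
    have "x * pade_gap s (real u) (real (u + a + b)) - x * pade_gap s (real u + h) (real (u + a + b) + h) = x * Dl"
      by (simp add: Dl_def right_diff_distrib)
    thus ?thesis using A Dl0(1) x mult_nonneg_nonneg[of x Dl] by linarith
  qed
  moreover define Z where "Z = real s * 512 ^ s * (y / N)"
  ultimately have "\<bar>real_of_int (rel u (u + a + b)) - real_of_int (rel u' (u' + a + b))\<bar> < 1"
    using xD unfolding mult.assoc[of _ "real s" "512 ^ s"] mult.assoc[of _ "real s * 512 ^ s" "y / N"] Z_def[symmetric]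
    by linarith
  hence "rel u (u + a + b) = rel u' (u' + a + b)" by linarith
  thus False using second_diff_determines_point[OF S ab far H] eq by simp
qed

text \<open>If the points were closer, each relation among them would have main term at most 1/4 and
  error at most 1/4, hence would be the integer 0. Three vanishing relations force a distance of
  order N, and \<open>Nx\<close> makes even that too long for the assumed closeness.\<close>

lemma three_points_far:
  assumes S: "u1 \<in> S" "u2 \<in> S" "u3 \<in> S" and lt: "u1 < u2" "u2 < u3"
    and yN: "100 * real s * 512 ^ s * y \<le> N"
    and Nx: "N * (8 * real s * 32 ^ s) ^ (2 * s - 1) \<le> x"
  shows "N ^ (2 * s) < 4 * (x * (real u3 - real u1) ^ (2 * s - 1))"
proof (rule ccontr)
  assume "\<not> ?thesis"
  hence le: "x * (real u3 - real u1) ^ (2 * s - 1) \<le> N ^ (2 * s) / 4" by simp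
  define q where "q = 2 * s - 1"
  have e8: "2 * 8 ^ s * (y / N) \<le> 1 / 4"
  proof -
    have "1 * (8::real) ^ s \<le> real s * 512 ^ s" using s by (intro mult_mono power_mono) auto
    moreover have "0 \<le> real s * 512 ^ s" by simp
    ultimately have "2 * 8 ^ s \<le> 25 * (real s * 512 ^ s)" by linarith
    hence "2 * 8 ^ s * y \<le> 25 * (real s * 512 ^ s) * y" using y by (intro mult_right_mono) auto
    thus ?thesis using yN N by (simp add: field_simps)
  qed
  have z: "rel u v = 0" if "u \<in> S" "v \<in> S" "u1 \<le> u" "u \<le> v" "v \<le> u3" for u v
  proof -
    have "pade_gap s u v \<le> (real v - real u) ^ q / N ^ (2 * s)" "0 \<le> (real v - real u) ^ q / (2 * N) ^ (2 * s)"
      "(real v - real u) ^ q / (2 * N) ^ (2 * s) \<le> pade_gap s u v"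
      using pade_gap_bounds[of N "real u" "real v" s] range[OF that(1)] range[OF that(2)] that N
      by (auto simp: q_def)
    moreover have "x * ((real v - real u) ^ q / N ^ (2 * s)) \<le> 1 / 4"
    proof -
      have "x * (real v - real u) ^ q \<le> x * (real u3 - real u1) ^ q"
        using that x by (intro mult_left_mono power_mono) auto
      hence "x * (real v - real u) ^ q \<le> N ^ (2 * s) / 4" using le by (simp add: q_def)
      thus ?thesis using N by (simp add: field_simps)
    qed
    ultimately have xx: "0 \<le> x * pade_gap s u v" "x * pade_gap s u v \<le> 1 / 4"
    proof -
      assume A: "pade_gap s u v \<le> (real v - real u) ^ q / N ^ (2 * s)" "0 \<le> (real v - real u) ^ q / (2 * N) ^ (2 * s)"
        "(real v - real u) ^ q / (2 * N) ^ (2 * s) \<le> pade_gap s u v"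
        and B: "x * ((real v - real u) ^ q / N ^ (2 * s)) \<le> 1 / 4"
      show "0 \<le> x * pade_gap s u v" using order_trans[OF A(2,3)] x by simp
      show "x * pade_gap s u v \<le> 1 / 4"
        using order_trans[OF mult_left_mono[OF A(1), of x] B] x by simp
    qed
    show ?thesis using rel_approx[OF that(1,2)] e8 xx by linarith
  qed
  have mpos: "real (m u) > 0" if "u \<in> S" for u
    using mult[OF that] x by (cases "m u = 0") auto
  have zz: "pade s (real u) (real v) * real (m u) = pade s (real v) (real u) * real (m v)" if "rel u v = 0" for u v
  proof -
    have "real_of_int (rel u v) = 0" using that by simp
    thus ?thesis by (simp add: rel_def of_int_pade)
  qed
  have "N < 8 * real s * 32 ^ s * (real u3 - real u1)"
    using range[OF S(1)] range[OF S(2)] range[OF S(3)] N s lt S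
    by (intro pade_three_relations_far[of N "real u1" "real u2" "real u3" s "real (m u1)" "real (m u2)" "real (m u3)"] mpos zz z) auto
  hence "N ^ q < (8 * real s * 32 ^ s * (real u3 - real u1)) ^ q"
    using N s by (intro power_strict_mono) (auto simp: q_def)
  also have "\<dots> = (8 * real s * 32 ^ s) ^ q * (real u3 - real u1) ^ q" by (simp only: power_mult_distrib)
  finally have "x * N ^ q < (8 * real s * 32 ^ s) ^ q * (x * (real u3 - real u1) ^ q)"
    using x by (simp add: mult_ac)
  also have "\<dots> \<le> (8 * real s * 32 ^ s) ^ q * (N ^ (2 * s) / 4)"
    using le by (intro mult_left_mono) (auto simp: q_def)
  also have "\<dots> = (N * (8 * real s * 32 ^ s) ^ q) * N ^ q / 4"
  proof -
    have "2 * s = Suc q" using s by (simp add: q_def)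
    thus ?thesis by (simp only: power_Suc) (simp add: mult_ac)
  qed
  also have "\<dots> \<le> x * N ^ q / 4" using Nx N by (intro divide_right_mono mult_right_mono) (auto simp: q_def)
  also have "\<dots> < x * N ^ q" using x N by simp
  finally show False .
qed

end

text \<open>Keep every second point: set aside the two smallest, retain the first of them and
  recurse. Each gap of the thinned set then spans three points of S, so
  \<open>three_points_far\<close> applies to it.\<close>

lemma thin_out:
  fixes S :: "nat set"
  assumes "finite S"
  shows "\<exists>S'\<subseteq>S. card S \<le> 2 * card S' \<and> (\<forall>u\<in>S'. \<forall>v\<in>S'. u < v \<longrightarrow> (\<exists>w\<in>S. u < w \<and> w < v))"
  using assms
proof (induction "card S" arbitrary: S rule: less_induct)
  case less
  show ?case
  proof (cases "card S \<le> 1")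
    case True
    hence "u = v" if "u \<in> S" "v \<in> S" for u v using that less.prems by (auto simp: card_le_Suc0_iff_eq)
    thus ?thesis by (intro exI[of _ S]) fastforce
  next
    case False
    define u1 where "u1 = Min S"
    define u2 where "u2 = Min (S - {u1})"
    define R where "R = S - {u1, u2}"
    have ne: "S \<noteq> {}" using False by auto
    have u1: "u1 \<in> S" "\<And>v. v \<in> S \<Longrightarrow> u1 \<le> v" using less.prems ne by (auto simp: u1_def)
    have "card (S - {u1}) = card S - 1" using u1 less.prems by simp
    hence ne2: "S - {u1} \<noteq> {}" using False by (metis card.empty diff_is_0_eq)
    have "u2 \<in> S - {u1}" unfolding u2_def by (rule Min_in) (use less.prems ne2 in auto)
    hence u2: "u2 \<in> S" "u2 \<noteq> u1" "\<And>v. v \<in> S - {u1} \<Longrightarrow> u2 \<le> v" using less.prems by (auto simp: u2_def)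
    have cR: "card S = card R + 2"
    proof -
      have "card {u1, u2} = 2" using u2 by simp
      thus ?thesis using card_Diff_subset[of "{u1, u2}" S] u1 u2 False by (simp add: R_def)
    qed
    obtain S' where S': "S' \<subseteq> R" "card R \<le> 2 * card S'"
      "\<And>u v. u \<in> S' \<Longrightarrow> v \<in> S' \<Longrightarrow> u < v \<Longrightarrow> \<exists>w\<in>R. u < w \<and> w < v"
      using less.hyps[of R] cR less.prems by (auto simp: R_def)
    have fS': "finite S'" using S'(1) less.prems by (auto simp: R_def intro: finite_subset)
    show ?thesis
    proof (intro exI[of _ "insert u1 S'"] conjI ballI impI)
      show "insert u1 S' \<subseteq> S" using u1 S'(1) by (auto simp: R_def)
      have "u1 \<notin> S'" using S'(1) by (auto simp: R_def)
      thus "card S \<le> 2 * card (insert u1 S')" using fS' S'(2) cR by simp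
      fix u v assume uv: "u \<in> insert u1 S'" "v \<in> insert u1 S'" "u < v"
      have vR: "v \<in> R"
      proof (rule ccontr)
        assume "v \<notin> R"
        hence "v = u1" using uv S'(1) by auto
        thus False using uv u1(2)[of u] S'(1) by (auto simp: R_def)
      qed
      show "\<exists>w\<in>S. u < w \<and> w < v"
      proof (cases "u = u1")
        case True
        have "u2 < v" using u2(3)[of v] vR by (auto simp: R_def order_less_le)
        moreover have "u1 < u2" using u1(2)[OF u2(1)] u2(2) by simp
        ultimately show ?thesis using u2(1) True by auto
      next
        case False
        thus ?thesis using S'(3)[of u v] uv vR by (auto simp: R_def)
      qed
    qed
  qed
qed

text \<open>At most N/A + 1 points have no other point within A to their right. Removing these and
  the points whose successor is one of them costs twice that number. What remains starts a triple of
  consecutive points, and consecutiveness gives the separation u + a(u) <= v.\<close>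

lemma short_consecutive_gaps:
  fixes S :: "nat set" and N A :: real
  assumes fin: "finite S" and range: "\<And>u. u \<in> S \<Longrightarrow> N < real u \<and> real u \<le> 2 * N" and A: "A > 0" and N: "N > 0"
  obtains T a b where "T \<subseteq> S" "real (card S) \<le> real (card T) + 2 * (N / A + 1)"
    "\<And>u. u \<in> T \<Longrightarrow> 0 < a u \<and> real (a u) \<le> A \<and> 0 < b u \<and> real (b u) \<le> A \<and> u + a u \<in> S \<and> u + a u + b u \<in> S"
    "\<And>u v. u \<in> T \<Longrightarrow> v \<in> S \<Longrightarrow> u < v \<Longrightarrow> u + a u \<le> v"
proof -
  define nxt where "nxt u = Min {v \<in> S. u < v}" for u
  \<comment> \<open>The largest point belongs to \<open>Big\<close> vacuously, so outside
    \<open>Big\<close> the minimum in \<open>nxt\<close> is over a nonempty set.\<close>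
  define Big where "Big = {u \<in> S. \<forall>v\<in>S. u < v \<longrightarrow> real u + A < real v}"
  define a where "a u = nxt u - u" for u
  define b where "b u = nxt (nxt u) - nxt u" for u
  define T where "T = {u \<in> S. u \<notin> Big \<and> nxt u \<notin> Big}"
  have nxt: "nxt u \<in> S" "u < nxt u" "real (nxt u) \<le> real u + A" "\<And>v. v \<in> S \<Longrightarrow> u < v \<Longrightarrow> nxt u \<le> v"
    if "u \<in> S" "u \<notin> Big" for u
  proof -
    have "\<exists>w\<in>S. u < w \<and> \<not> real u + A < real w" using that by (simp add: Big_def)
    then obtain w where w: "w \<in> S" "u < w" "real w \<le> real u + A" by (auto simp: not_less)
    have "nxt u \<in> {v \<in> S. u < v}" unfolding nxt_def by (rule Min_in) (use fin w in auto)
    thus "nxt u \<in> S" "u < nxt u" by auto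
    show le: "nxt u \<le> v" if "v \<in> S" "u < v" for v unfolding nxt_def using fin that by (intro Min_le) auto
    show "real (nxt u) \<le> real u + A" using le[of w] w by linarith
  qed
  have cBig: "real (card Big) \<le> N / A + 1"
  proof -
    have "real (card (real ` Big)) \<le> N / A + 1"
    proof (rule card_spaced_le)
      show "finite (real ` Big)" using fin by (simp add: Big_def)
      fix r r' assume r: "r \<in> real ` Big" "r' \<in> real ` Big"
      then obtain u v where uv: "r = real u" "r' = real v" "u \<in> Big" "v \<in> Big" by auto
      show "r' - r \<le> N" using range[of u] range[of v] uv by (auto simp: Big_def)
      show "A \<le> r' - r" if "r < r'" using uv that by (force simp: Big_def)
    qed (use A N in auto)
    thus ?thesis by (simp add: card_image)
  qed
  have cS: "card S \<le> card T + 2 * card Big"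
  proof -
    \<comment> \<open>The successor map is strictly increasing outside \<open>Big\<close>, hence
      injective on U, so U is no larger than \<open>Big\<close>.\<close>
    define U where "U = {u \<in> S. u \<notin> Big \<and> nxt u \<in> Big}"
    have "inj_on nxt U"
    proof (rule linorder_inj_onI)
      fix u v assume "u < v" "u \<in> U" "v \<in> U"
      hence "nxt u \<le> v" "v < nxt v" using nxt(2)[of v] nxt(4)[of u v] by (auto simp: U_def)
      thus "nxt u \<noteq> nxt v" by simp
    qed auto
    moreover have "nxt ` U \<subseteq> Big" "finite Big" using fin by (auto simp: U_def Big_def)
    ultimately have "card U \<le> card Big" by (metis card_inj_on_le)
    moreover have "S \<subseteq> T \<union> (Big \<union> U)" by (auto simp: T_def U_def)
    hence "card S \<le> card (T \<union> (Big \<union> U))" using fin by (intro card_mono) (auto simp: T_def U_def Big_def)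
    moreover have "card (T \<union> (Big \<union> U)) \<le> card T + (card Big + card U)"
      by (meson add_left_mono card_Un_le order_trans)
    ultimately show ?thesis by simp
  qed
  show ?thesis
  proof (rule that[of T a b])
    show "T \<subseteq> S" by (auto simp: T_def)
    show "real (card S) \<le> real (card T) + 2 * (N / A + 1)" 
      using cBig of_nat_mono[OF cS, where ?'a = real] by simp
    fix u assume u: "u \<in> T"
    hence u1: "u \<in> S" "u \<notin> Big" "nxt u \<notin> Big" by (auto simp: T_def)
    note n1 = nxt[OF u1(1,2)] and n2 = nxt[OF nxt(1)[OF u1(1,2)] u1(3)]
    show "0 < a u \<and> real (a u) \<le> A \<and> 0 < b u \<and> real (b u) \<le> A \<and> u + a u \<in> S \<and> u + a u + b u \<in> S"
      using n1 n2 by (auto simp: a_def b_def of_nat_diff)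
    fix v assume "v \<in> S" "u < v"
    thus "u + a u \<le> v" using n1 by (auto simp: a_def)
  qed
qed

section \<open>Cardinality bounds for separated near multiples\<close>

context near_multiples
begin

lemma rel_upper:
  assumes "u \<in> S" "v \<in> S" "u \<le> v"
  shows "\<bar>real_of_int (rel u v)\<bar> \<le> x * (real v - real u) ^ (2 * s - 1) / N ^ (2 * s) + 2 * 8 ^ s * (y / N)"
proof -
  have "0 \<le> pade_gap s u v" using range[OF assms(1)] range[OF assms(2)] N assms
    by (auto simp: pade_gap_def)
  moreover have "x * pade_gap s u v \<le> x * ((real v - real u) ^ (2 * s - 1) / N ^ (2 * s))"
    using pade_gap_bounds(2)[of N "real u" "real v" s] range[OF assms(1)] range[OF assms(2)] N x assms
    by (intro mult_left_mono) auto
  moreover have "0 \<le> x * pade_gap s u v" using calculation(1) x by simp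
  moreover note rel_approx[OF assms(1,2)]
  ultimately show ?thesis unfolding times_divide_eq_right[symmetric, of x] by linarith
qed

text \<open>When y is at least comparable to N, a point is encoded by its two gaps and the second
  difference J. Gaps are at most A = N/D, and |J| is at most of the order of \<kappa> = x A^q /
  N^(2s), so A^2 \<kappa> = D N / y bounds the count up to constants.\<close>

lemma card_bound_large_y:
  assumes H: "\<And>u v. u \<in> S \<Longrightarrow> v \<in> S \<Longrightarrow> u < v \<Longrightarrow>
      x * (real v - real u) ^ (2 * s - 1) \<ge> 25 * real s * 32 ^ s * (y * N ^ (2 * s - 1))"
    and yN: "N \<le> 100 * real s * 512 ^ s * y"
    and D: "D \<ge> 1" "D ^ (2 * s + 2) = x * y"
  shows "real (card S) \<le> 4 * D + 800 * real s * 8192 ^ s * D"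
proof -
  define A where "A = N / D"
  define q where "q = 2 * s - 1"
  have A: "A > 0" using N D by (simp add: A_def)
  obtain T a b where T: "T \<subseteq> S" "real (card S) \<le> real (card T) + 2 * (N / A + 1)"
    and ab: "\<And>u. u \<in> T \<Longrightarrow> 0 < a u \<and> real (a u) \<le> A \<and> 0 < b u \<and> real (b u) \<le> A \<and> u + a u \<in> S \<and> u + a u + b u \<in> S"
    and far: "\<And>u v. u \<in> T \<Longrightarrow> v \<in> S \<Longrightarrow> u < v \<Longrightarrow> u + a u \<le> v"
    using short_consecutive_gaps[OF fin range A N] by blast
  define J where "J u = rel u (u + a u + b u) - rel u (u + a u) - rel (u + a u) (u + a u + b u)" for u
  define \<kappa> where "\<kappa> = x * A ^ q / N ^ (2 * s)"
  have \<kappa>0: "\<kappa> \<ge> 0" using x A N by (simp add: \<kappa>_def)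
  have Nq: "N ^ (2 * s) = N * N ^ q"
  proof -
    have "2 * s = Suc q" using s by (simp add: q_def)
    thus ?thesis by simp
  qed
  \<comment> \<open>\<open>H\<close> holds for an actual gap, which is at most A; so the mere
    existence of a short triple bounds \<kappa> from below.\<close>
  have gapA: "25 * real s * 32 ^ s * (y / N) \<le> \<kappa>" if "u \<in> T" for u
  proof -
    have "25 * real s * 32 ^ s * (y * N ^ q) \<le> x * real (a u) ^ q"
      using H[of u "u + a u"] ab[OF that] that T(1) by (auto simp: q_def)
    also have "\<dots> \<le> x * A ^ q" using ab[OF that] x by (intro mult_left_mono power_mono) auto
    finally have "25 * real s * 32 ^ s * (y * N ^ q) / N ^ (2 * s) \<le> \<kappa>"
      unfolding \<kappa>_def using N by (intro divide_right_mono) auto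
    thus ?thesis using N by (simp add: Nq)
  qed
  have cT: "real (card T) \<le> A ^ 2 * (8 * 16 ^ s * \<kappa>)"
  proof (cases "T = {}")
    case False
    then obtain u0 where u0: "u0 \<in> T" by auto
    have yN\<kappa>: "y / N \<le> \<kappa> / (25 * real s * 32 ^ s)"
      using gapA[OF u0] s by (simp add: field_simps)
    have "1 \<le> 100 * real s * 512 ^ s * (y / N)" using yN N by (simp add: field_simps)
    also have "\<dots> \<le> 100 * real s * 512 ^ s * (\<kappa> / (25 * real s * 32 ^ s))"
      using yN\<kappa> by (intro mult_left_mono) auto
    also have "\<dots> = 4 * 16 ^ s * \<kappa>"
    proof -
      have "(512::real) ^ s = 16 ^ s * 32 ^ s" by (simp flip: power_mult_distrib)
      thus ?thesis using s by simp
    qed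
    \<comment> \<open>This absorbs the +1 in the count 2R + 1 of possible values of J.\<close>
    finally have one: "1 \<le> 4 * 16 ^ s * \<kappa>" .
    define R where "R = 2 * 4 ^ s * \<kappa>"
    have JR: "\<bar>real_of_int (J u)\<bar> \<le> R" if u: "u \<in> T" for u
    proof -
      note abu = ab[OF u]
      have uS: "u \<in> S" using u T(1) by auto
      have k: "\<bar>real_of_int (rel v w)\<bar> \<le> 2 ^ q * \<kappa> / 1 + 2 * 8 ^ s * (y / N)"
        if "v \<in> S" "w \<in> S" "v \<le> w" "real w - real v \<le> 2 * A" for v w
      proof -
        have "x * (real w - real v) ^ q / N ^ (2 * s) \<le> x * (2 * A) ^ q / N ^ (2 * s)"
          using that x N by (intro divide_right_mono mult_left_mono power_mono) auto
        also have "\<dots> = 2 ^ q * \<kappa>" by (simp add: \<kappa>_def power_mult_distrib)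
        finally show ?thesis using rel_upper[OF that(1-3)] by (simp add: q_def)
      qed
      have "\<bar>real_of_int (J u)\<bar> \<le> \<bar>real_of_int (rel u (u + a u + b u))\<bar> + \<bar>real_of_int (rel u (u + a u))\<bar> + \<bar>real_of_int (rel (u + a u) (u + a u + b u))\<bar>"
        unfolding J_def by linarith
      also have "\<dots> \<le> 3 * (2 ^ q * \<kappa> + 2 * 8 ^ s * (y / N))"
        using k[of u "u + a u + b u"] k[of u "u + a u"] k[of "u + a u" "u + a u + b u"] abu uS by simp
      also have "2 * 8 ^ s * (y / N) \<le> \<kappa> / 6"
      proof -
        have "12 * (8::real) ^ s \<le> 25 * real s * 32 ^ s"
          using s by (intro mult_mono power_mono) auto
        hence "12 * 8 ^ s * (y / N) \<le> 25 * real s * 32 ^ s * (y / N)" using y N by (intro mult_right_mono) auto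
        thus ?thesis using gapA[OF u] by linarith
      qed
      also have "3 * (2 ^ q * \<kappa> + \<kappa> / 6) = (3 / 2 * (2 * 2 ^ q) + 1 / 2) * \<kappa>" by (simp add: algebra_simps)
      also have "2 * (2::real) ^ q = 4 ^ s"
      proof -
        have "2 * s = Suc q" using s by (simp add: q_def)
        thus ?thesis by (metis power_Suc power_mult power2_eq_square numeral_Bit0_eq_double mult_2 numeral_Bit0)
      qed
      also have "(3 / 2 * 4 ^ s + 1 / 2) * \<kappa> \<le> (2 * 4 ^ s) * \<kappa>"
      proof -
        have "(1::real) \<le> 4 ^ s" by simp
        thus ?thesis using \<kappa>0 by (intro mult_right_mono) linarith
      qed
      finally show ?thesis by (simp add: R_def)
    qed
    define P where "P = {1..nat \<lfloor>A\<rfloor>} \<times> {1..nat \<lfloor>A\<rfloor>} \<times> {- \<lfloor>R\<rfloor>..\<lfloor>R\<rfloor>}"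
    have "inj_on (\<lambda>u. (a u, b u, J u)) T"
    proof (rule linorder_inj_onI)
      fix u u' assume uu: "u < u'" "u \<in> T" "u' \<in> T"
      show "(a u, b u, J u) \<noteq> (a u', b u', J u')"
      proof
        assume eq: "(a u, b u, J u) = (a u', b u', J u')"
        have S6: "u \<in> S" "u + a u \<in> S" "u + a u + b u \<in> S" "u' \<in> S" "u' + a u \<in> S" "u' + a u + b u \<in> S"
          using ab[OF uu(2)] ab[OF uu(3)] eq uu T(1) by auto
        have "x * real (min (a u) (b u)) ^ (2 * s - 1) \<ge> 25 * real s * 32 ^ s * (y * N ^ (2 * s - 1))"
          using H[OF S6(1,2)] H[OF S6(2,3)] ab[OF uu(2)] by (auto simp: min_def)
        from second_diff_determines_point[OF S6 _ _ far[OF uu(2) S6(4) uu(1)] this]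
        show False using ab[OF uu(2)] eq by (auto simp: J_def)
      qed
    qed auto
    moreover have "(\<lambda>u. (a u, b u, J u)) ` T \<subseteq> P"
    proof
      fix z assume "z \<in> (\<lambda>u. (a u, b u, J u)) ` T"
      then obtain u where u: "u \<in> T" "z = (a u, b u, J u)" by auto
      have "a u \<le> nat \<lfloor>A\<rfloor>" "b u \<le> nat \<lfloor>A\<rfloor>" using ab[OF u(1)] by (auto intro: le_nat_floor)
      moreover have "J u \<le> \<lfloor>R\<rfloor>" "- J u \<le> \<lfloor>R\<rfloor>" using JR[OF u(1)] by (auto simp: le_floor_iff)
      ultimately show "z \<in> P" using ab[OF u(1)] by (auto simp: P_def u)
    qed
    ultimately have "card T \<le> card P" by (rule card_inj_on_le) (simp add: P_def)
    also have "real (card P) = real (nat \<lfloor>A\<rfloor>) * (real (nat \<lfloor>A\<rfloor>) * real (nat (2 * \<lfloor>R\<rfloor> + 1)))"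
      by (simp add: P_def card_cartesian_product)
    also have "\<dots> \<le> A * (A * (2 * R + 1))"
    proof -
      have "R \<ge> 0" using \<kappa>0 by (simp add: R_def)
      hence "real (nat (2 * \<lfloor>R\<rfloor> + 1)) \<le> 2 * R + 1" by linarith
      thus ?thesis using A \<open>R \<ge> 0\<close> by (intro mult_mono) auto
    qed
    also have "\<dots> \<le> A * (A * (8 * 16 ^ s * \<kappa>))"
    proof -
      have "(4::real) ^ s \<le> 16 ^ s" by (intro power_mono) auto
      hence "4 ^ s * \<kappa> \<le> 16 ^ s * \<kappa>" using \<kappa>0 by (intro mult_right_mono)
      hence "2 * R + 1 \<le> 8 * 16 ^ s * \<kappa>" using one unfolding R_def by linarith
      thus ?thesis using A by (intro mult_left_mono) auto
    qed
    finally show ?thesis by (simp add: power2_eq_square mult_ac)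
  qed (use \<kappa>0 in simp)
  \<comment> \<open>Here D^(2s+2) = xy is used: x N / D^(2s+1) becomes D N / y, and N / y is bounded
    in the present range.\<close>
  have "A ^ 2 * \<kappa> = x * N / D ^ (2 * s + 1)"
  proof -
    have "2 * s + 1 = 2 + q" using s by (simp add: q_def)
    hence "A ^ (2 * s + 1) = A ^ 2 * A ^ q" by (metis power_add)
    hence "A ^ 2 * \<kappa> = x * A ^ (2 * s + 1) / N ^ (2 * s)" by (simp add: \<kappa>_def)
    also have "\<dots> = x * N / D ^ (2 * s + 1)" unfolding A_def power_divide using N D by simp
    finally show ?thesis .
  qed
  also have "\<dots> = D * N / y"
  proof -
    have "x * y = D * D ^ (2 * s + 1)" using D by simp
    hence "x * N * y = D * N * D ^ (2 * s + 1)" by (metis mult.commute mult.left_commute)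
    thus ?thesis using y D by (simp add: field_simps)
  qed
  also have "\<dots> \<le> D * (100 * real s * 512 ^ s)"
  proof -
    have "N / y \<le> 100 * real s * 512 ^ s" using yN y by (simp add: field_simps)
    thus ?thesis using D mult_left_mono[of "N / y" _ D] by simp
  qed
  finally have "A ^ 2 * \<kappa> \<le> D * (100 * real s * 512 ^ s)" .
  hence "8 * 16 ^ s * (A ^ 2 * \<kappa>) \<le> 8 * 16 ^ s * (D * (100 * real s * 512 ^ s))" by (intro mult_left_mono) auto
  also have "\<dots> = 800 * real s * (16 * 512) ^ s * D" by (simp only: power_mult_distrib mult_ac)
  finally have "real (card T) \<le> 800 * real s * 8192 ^ s * D" using cT by (simp add: mult_ac)
  moreover have "N / A = D" using N D by (simp add: A_def)
  ultimately show ?thesis using T(2) D by simp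
qed

text \<open>The two relations are close to x a^q / (uv)^s and x b^q / (vw)^s. Cross multiplication
  removes a^q and b^q from the main terms up to the drift between 1/(uv)^s and 1/(vw)^s, which is
  small because u and w are close; the rest is the error of \<open>rel_approx\<close>.\<close>

lemma near_power_relation:
  fixes u a b :: nat
  assumes S: "u \<in> S" "u + a \<in> S" "u + a + b \<in> S" and ab: "a > 0" "b > 0"
  shows "\<bar>real_of_int (rel u (u + a)) * real b ^ (2 * s - 1) - real_of_int (rel (u + a) (u + a + b)) * real a ^ (2 * s - 1)\<bar>
    \<le> x / N ^ (2 * s) * (real s * 2 ^ s * (real a + real b) / N) * (real a ^ (2 * s - 1) * real b ^ (2 * s - 1))
      + 2 * 8 ^ s * (y / N) * (real a ^ (2 * s - 1) + real b ^ (2 * s - 1))"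
proof -
  define q where "q = 2 * s - 1"
  define v where "v = u + a"
  define w where "w = u + a + b"
  note r = range[OF S(1)] range[OF S(2), folded v_def] range[OF S(3), folded w_def]
  define Z where "Z = 1 / (real u ^ s * real v ^ s) - 1 / (real v ^ s * real w ^ s)"
  have p: "real u > 0" "real v > 0" "real w > 0" using r N by auto
  have uw: "real u ^ s \<le> real w ^ s" by (intro power_mono) (auto simp: w_def)
  have Zeq: "Z = (real w ^ s - real u ^ s) / (real u ^ s * real v ^ s * real w ^ s)"
    using p by (simp add: Z_def divide_simps)
  have Z0: "0 \<le> Z" unfolding Zeq using p uw by simp
  have "2 * N * \<bar>real w ^ s - real u ^ s\<bar> \<le> s * (2 * N) ^ s * \<bar>real w - real u\<bar>"
    using r N by (intro abs_power_diff_le) auto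
  hence "2 * N * (real w ^ s - real u ^ s) \<le> s * (2 * N) ^ s * (real a + real b)"
    using uw by (simp add: w_def)
  moreover have "N * (real w ^ s - real u ^ s) \<le> 2 * N * (real w ^ s - real u ^ s)"
    using uw N by (intro mult_right_mono) auto
  ultimately have "N * (real w ^ s - real u ^ s) \<le> s * (2 * N) ^ s * (real a + real b)" by linarith
  hence "real w ^ s - real u ^ s \<le> s * (2 * N) ^ s * (real a + real b) / N"
    using N by (simp only: pos_le_divide_eq mult.commute)
  moreover have "N ^ s * N ^ s * N ^ s \<le> real u ^ s * real v ^ s * real w ^ s"
    using r N by (intro mult_mono power_mono) auto
  ultimately have "Z \<le> (s * (2 * N) ^ s * (real a + real b) / N) / (N ^ s * N ^ s * N ^ s)"
    unfolding Zeq using N p by (intro frac_le) auto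
  also have "\<dots> = (real s * 2 ^ s * (real a + real b) / N) / (N ^ s * N ^ s)"
    using N by (simp add: power_mult_distrib)
  also have "N ^ s * N ^ s = N ^ (2 * s)" by (simp add: mult_2 power_add)
  finally have Z1: "Z \<le> (real s * 2 ^ s * (real a + real b) / N) / N ^ (2 * s)" .
  have g: "pade_gap s u v = real a ^ q / (real u ^ s * real v ^ s)" "pade_gap s v w = real b ^ q / (real v ^ s * real w ^ s)"
    by (simp_all add: pade_gap_def v_def w_def q_def)
  define e1 where "e1 = real_of_int (rel u v) - x * pade_gap s u v"
  define e2 where "e2 = real_of_int (rel v w) - x * pade_gap s v w"
  define E where "E = 2 * 8 ^ s * (y / N)"
  have e: "\<bar>e1\<bar> \<le> E" "\<bar>e2\<bar> \<le> E"
    unfolding e1_def e2_def E_def using S by (intro rel_approx; simp add: v_def w_def)+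
  have "real_of_int (rel u v) * real b ^ q - real_of_int (rel v w) * real a ^ q
     = x * Z * (real a ^ q * real b ^ q) + (e1 * real b ^ q - e2 * real a ^ q)"
    unfolding e1_def e2_def g Z_def by (simp add: algebra_simps)
  also have "\<bar>\<dots>\<bar> \<le> x * Z * (real a ^ q * real b ^ q) + (E * real b ^ q + E * real a ^ q)"
  proof -
    have "0 \<le> x * Z * (real a ^ q * real b ^ q)" using x Z0 by simp
    moreover have "\<bar>e1 * real b ^ q\<bar> \<le> E * real b ^ q" "\<bar>e2 * real a ^ q\<bar> \<le> E * real a ^ q"
      using e by (auto simp: abs_mult intro!: mult_right_mono)
    ultimately show ?thesis by linarith
  qed
  also have "\<dots> \<le> x * ((real s * 2 ^ s * (real a + real b) / N) / N ^ (2 * s)) * (real a ^ q * real b ^ q) + (E * real b ^ q + E * real a ^ q)"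
    using x Z1 by (intro add_right_mono mult_right_mono mult_left_mono) auto
  also have "\<dots> = x / N ^ (2 * s) * (real s * 2 ^ s * (real a + real b) / N) * (real a ^ q * real b ^ q)
      + E * (real a ^ q + real b ^ q)"
  proof -
    have "x * (c / d) = x / d * c" for c d :: real by simp
    thus ?thesis by (simp only: distrib_left add.commute)
  qed
  finally show ?thesis by (simp only: E_def q_def v_def w_def)
qed

text \<open>\<open>H\<close> makes the main term dominate the error of \<open>rel_approx\<close>.
  The relation is therefore positive and of known order, so it can serve as one of the natural
  numbers k, l in \<open>card_near_power\<close>.\<close>

lemma rel_two_sided:
  fixes u a :: nat
  assumes S: "u \<in> S" "u + a \<in> S"
    and H: "25 * real s * 32 ^ s * (y * N ^ (2 * s - 1)) \<le> x * real a ^ (2 * s - 1)"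
  shows "x / N ^ (2 * s) * real a ^ (2 * s - 1) \<le> 2 * 4 ^ s * real_of_int (rel u (u + a))"
    and "real_of_int (rel u (u + a)) \<le> 2 * (x / N ^ (2 * s) * real a ^ (2 * s - 1))"
proof -
  define q where "q = 2 * s - 1"
  define G where "G = x / N ^ (2 * s) * real a ^ q"
  have Nq: "N ^ (2 * s) = N * N ^ q"
  proof -
    have "2 * s = Suc q" using s by (simp add: q_def)
    thus ?thesis by simp
  qed
  have G: "25 * real s * 32 ^ s * (y / N) \<le> G"
  proof -
    have "25 * real s * 32 ^ s * (y * N ^ q) / N ^ (2 * s) \<le> x * real a ^ q / N ^ (2 * s)"
      using H N by (intro divide_right_mono) (auto simp: q_def)
    thus ?thesis using N by (simp add: Nq G_def)
  qed
  have yN: "0 \<le> y / N" using y N by simp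
  have "25 * 1 * 32 ^ s * (y / N) \<le> 25 * real s * 32 ^ s * (y / N)"
    using s yN by (intro mult_right_mono mult_left_mono) auto
  hence "25 * (4 ^ s * 8 ^ s) * (y / N) \<le> G" using G by (simp flip: power_mult_distrib)
  hence e1: "25 * (8 ^ s * (y / N)) \<le> G / 4 ^ s" by (simp add: field_simps)
  have G0: "G \<ge> 0" using x N by (simp add: G_def)
  have "1 \<le> (4::real) ^ s" by simp
  hence e2: "G / 4 ^ s \<le> G" using G0 by (simp add: divide_le_eq mult_le_cancel_left1)
  have e0: "0 \<le> 8 ^ s * (y / N)" using yN by (intro mult_nonneg_nonneg) auto
  have b: "x * (real a ^ q / (2 * N) ^ (2 * s)) \<le> x * pade_gap s u (u + a)"
    "x * pade_gap s u (u + a) \<le> x * (real a ^ q / N ^ (2 * s))"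
    using pade_gap_bounds[of N "real u" "real (u + a)" s] range[OF S(1)] range[OF S(2)] N x
    by (intro mult_left_mono; simp add: q_def)+
  have b1: "x * (real a ^ q / (2 * N) ^ (2 * s)) = G / 4 ^ s"
    by (simp add: G_def power_mult_distrib power_mult)
  have b2: "x * (real a ^ q / N ^ (2 * s)) = G" by (simp add: G_def)
  have ap: "\<bar>real_of_int (rel u (u + a)) - x * pade_gap s u (u + a)\<bar> \<le> 2 * (8 ^ s * (y / N))"
    using rel_approx[OF S] by simp
  have "G / 4 ^ s \<le> 2 * real_of_int (rel u (u + a))" using ap b e1 e0 unfolding b1 b2 by linarith
  hence "G \<le> 2 * 4 ^ s * real_of_int (rel u (u + a))" by (simp add: pos_divide_le_eq mult_ac)
  thus "x / N ^ (2 * s) * real a ^ (2 * s - 1) \<le> 2 * 4 ^ s * real_of_int (rel u (u + a))"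
    by (simp only: G_def q_def)
  have "real_of_int (rel u (u + a)) \<le> 2 * G" using ap b e1 e2 e0 unfolding b1 b2 by linarith
  thus "real_of_int (rel u (u + a)) \<le> 2 * (x / N ^ (2 * s) * real a ^ (2 * s - 1))"
    by (simp add: G_def q_def)
qed

end

section \<open>Counting near multiples of a power\<close>

context near_multiples
begin

text \<open>The first summand is the constant of the square root term in
  \<open>dyadic_class_card\<close>. The second is 4 c C times 4 * 16^s, with c = 2 * 16^s and C the
  constant in the relative error.\<close>

definition class_const :: real where
  "class_const = 2 * 4 ^ s + 16 * (2 * 16 ^ s) * (2 * 4 ^ s * (2 * real s * 2 ^ s + 4 * 8 ^ s)) * 16 ^ s"

text \<open>Fixing the dyadic sizes of both gaps also fixes those of k and l. By
  \<open>relations_determine_point\<close> the map to quadruples (a, b, k, l) is injective, and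
  \<open>near_power_relation\<close> says that k b^q and l a^q nearly agree, so
  \<open>card_near_power\<close> applies. With A = N/D both terms of its bound come out as
  O(D).\<close>

lemma dyadic_class_card:
  fixes A D :: real and T :: "nat set" and a b :: "nat \<Rightarrow> nat" and i j :: nat
  assumes H: "\<And>u v. u \<in> S \<Longrightarrow> v \<in> S \<Longrightarrow> u < v \<Longrightarrow>
      x * (real v - real u) ^ (2 * s - 1) \<ge> 25 * real s * 32 ^ s * (y * N ^ (2 * s - 1))"
    and yN: "100 * real s * 512 ^ s * y \<le> N"
    and D: "D \<ge> 1" "D ^ (2 * s + 2) = x * y" "D \<le> y" and A: "A = N / D"
    and TS: "T \<subseteq> S"
    and ab: "\<And>u. u \<in> T \<Longrightarrow> 0 < a u \<and> real (a u) \<le> A \<and> 0 < b u \<and> real (b u) \<le> A \<and> u + a u \<in> S \<and> u + a u + b u \<in> S"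
    and far: "\<And>u v. u \<in> T \<Longrightarrow> v \<in> S \<Longrightarrow> u < v \<Longrightarrow> u + a u \<le> v"
    and ij: "2 ^ i \<le> A" "2 ^ j \<le> A"
  shows "real (card {u \<in> T. 2 ^ i \<le> a u \<and> a u < 2 ^ (i + 1) \<and> 2 ^ j \<le> b u \<and> b u < 2 ^ (j + 1)})
    \<le> (1 + ln (2 * A)) * (1 + ln (4 ^ s * y)) * (class_const * D)"
proof (cases "{u \<in> T. 2 ^ i \<le> a u \<and> a u < 2 ^ (i + 1) \<and> 2 ^ j \<le> b u \<and> b u < 2 ^ (j + 1)} = {}")
  case True
  have "1 \<le> A" using ij(1) one_le_power[of "2::real" i] by linarith
  moreover have "1 * 1 \<le> 4 ^ s * y" using D by (intro mult_mono) auto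
  moreover have "class_const \<ge> 0" by (simp add: class_const_def)
  ultimately have "0 \<le> (1 + ln (2 * A)) * (1 + ln (4 ^ s * y)) * (class_const * D)"
    using D by (intro mult_nonneg_nonneg) auto
  thus ?thesis unfolding True by simp
next
  case False
  define T' where "T' = {u \<in> T. 2 ^ i \<le> a u \<and> a u < 2 ^ (i + 1) \<and> 2 ^ j \<le> b u \<and> b u < 2 ^ (j + 1)}"
  define q where "q = 2 * s - 1"
  have qs: "2 * s = Suc q" using s by (simp add: q_def)
  have two: "2 * 2 ^ q = (4::real) ^ s"
  proof -
    have "2 * 2 ^ q = (2::real) ^ (2 * s)" unfolding qs by simp
    thus ?thesis by (simp add: power_mult)
  qed
  define \<nu> where "\<nu> = x / N ^ (2 * s)"
  have \<nu>: "\<nu> > 0" using x N by (simp add: \<nu>_def)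
  have A1: "1 \<le> A" using ij(1) one_le_power[of "2::real" i] by linarith
  \<comment> \<open>Through D^(2s+2) = xy the scale x A^(2s) / N^(2s) equals D^2 / y, which is at
    most D because D <= y.\<close>
  have \<nu>A: "\<nu> * A ^ (2 * s) = D ^ 2 / y"
  proof -
    have "D ^ (2 * s) * D ^ 2 = x * y" using D(2) by (simp flip: power_add)
    moreover have "\<nu> * A ^ (2 * s) = x / D ^ (2 * s)"
      using N D by (simp add: \<nu>_def A power_divide)
    moreover have "x / D ^ (2 * s) = D ^ 2 / y \<longleftrightarrow> x * y = D ^ 2 * D ^ (2 * s)"
      using y D by (intro frac_eq_eq) auto
    ultimately show ?thesis by (simp only: mult.commute)
  qed
  have Dy: "D ^ 2 / y \<le> D" "D \<le> y" "D ^ 2 / y \<le> y"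
  proof -
    have "D * D \<le> D * y" using D by (intro mult_left_mono) auto
    thus "D ^ 2 / y \<le> D" using y by (simp add: power2_eq_square divide_le_eq)
    thus "D ^ 2 / y \<le> y" "D \<le> y" using D by auto
  qed
  define \<mu> where "\<mu> = (2::real) ^ min i j"
  have \<mu>: "\<mu> \<ge> 1" "\<mu> \<le> 2 ^ i" "\<mu> \<le> 2 ^ j" "\<mu> \<le> A"
    using ij by (auto simp: \<mu>_def min_def intro: power_increasing)
  \<comment> \<open>Y compares the error y/N of a relation with the smaller of the two main terms,
    of order \<nu>\<mu>^q; up to a constant it is the relative error in the near equality.\<close>
  define Y where "Y = y / (N * \<nu> * \<mu> ^ q)"
  have Y: "Y > 0" using y N \<nu> \<mu> by (simp add: Y_def)
  define C\<Delta> where "C\<Delta> = 2 * 4 ^ s * (2 * real s * 2 ^ s + 4 * 8 ^ s)"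
  define B1 B2 K1 L1 where "B1 = (2::real) ^ (i + 1)" "B2 = (2::real) ^ (j + 1)"
    "K1 = 2 * \<nu> * (2 ^ (i + 1)) ^ q" "L1 = 2 * \<nu> * (2 ^ (j + 1)) ^ q"
  define \<phi> where "\<phi> u = (a u, b u, nat (rel u (u + a u)), nat (rel (u + a u) (u + a u + b u)))" for u
  have Hgap: "25 * real s * 32 ^ s * (y * N ^ (2 * s - 1)) \<le> x * real (a u) ^ (2 * s - 1)"
    "25 * real s * 32 ^ s * (y * N ^ (2 * s - 1)) \<le> x * real (b u) ^ (2 * s - 1)" if "u \<in> T" for u
    using H[of u "u + a u"] H[of "u + a u" "u + a u + b u"] ab[OF that] that TS by auto
  have inj: "inj_on \<phi> T'"
  proof (rule linorder_inj_onI)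
    fix u u' assume uu: "u < u'" "u \<in> T'" "u' \<in> T'"
    hence uT: "u \<in> T" "u' \<in> T" by (auto simp: T'_def)
    show "\<phi> u \<noteq> \<phi> u'"
    proof
      assume eq: "\<phi> u = \<phi> u'"
      have S6: "u \<in> S" "u + a u \<in> S" "u + a u + b u \<in> S" "u' \<in> S" "u' + a u \<in> S" "u' + a u + b u \<in> S"
        using ab[OF uT(1)] ab[OF uT(2)] eq uT TS by (auto simp: \<phi>_def)
      have Hm: "x * real (min (a u) (b u)) ^ (2 * s - 1) \<ge> 25 * real s * 32 ^ s * (y * N ^ (2 * s - 1))"
        using Hgap[OF uT(1)] by (simp add: min_def)
      have pos: "rel v (v + a v) > 0 \<and> rel (v + a v) (v + a v + b v) > 0" if "v \<in> T" for v
      proof -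
        have "0 < x / N ^ (2 * s) * real (a v) ^ (2 * s - 1)" "0 < x / N ^ (2 * s) * real (b v) ^ (2 * s - 1)"
          using x N ab[OF that] by auto
        moreover have "v \<in> S" using that TS by auto
        ultimately have "0 < 2 * 4 ^ s * real_of_int (rel v (v + a v))" "0 < 2 * 4 ^ s * real_of_int (rel (v + a v) (v + a v + b v))"
          using rel_two_sided(1)[of v "a v"] rel_two_sided(1)[of "v + a v" "b v"] ab[OF that] Hgap[OF that] by linarith+
        thus ?thesis by (simp add: zero_less_mult_iff)
      qed
      from relations_determine_point[OF S6 _ _ far[OF uT(1) S6(4) uu(1)] Hm yN]
      show False using ab[OF uT(1)] pos[OF uT(1)] pos[OF uT(2)] eq by (auto simp: \<phi>_def eq_nat_nat_iff)
    qed
  qed auto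
  have \<nu>\<mu>: "\<nu> * \<mu> ^ q * Y = y / N" using y N \<nu> \<mu> by (simp add: Y_def)
  have near_prop: "a u > 0 \<and> b u > 0 \<and> k > 0 \<and> l > 0 \<and> real (a u) \<le> B1 \<and> real (b u) \<le> B2 \<and> B2 \<le> (2 * 16 ^ s) * real (b u)
      \<and> real k \<le> K1 \<and> real l \<le> L1 \<and> L1 \<le> (2 * 16 ^ s) * real l
      \<and> \<bar>real k * real (b u) ^ q - real l * real (a u) ^ q\<bar> \<le> C\<Delta> * Y * (real l * real (a u) ^ q)"
    if u: "u \<in> T'" and k: "k = nat (rel u (u + a u))" and l: "l = nat (rel (u + a u) (u + a u + b u))" for u k l
  proof -
    have uT: "u \<in> T" "2 ^ i \<le> a u" "a u < 2 ^ (i + 1)" "2 ^ j \<le> b u" "b u < 2 ^ (j + 1)"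
      using u by (auto simp: T'_def)
    have uS: "u \<in> S" "u + a u \<in> S" "u + a u + b u \<in> S" and ab0: "a u > 0" "b u > 0" "real (a u) \<le> A" "real (b u) \<le> A"
      using ab[OF uT(1)] uT(1) TS by auto
    have ra: "2 ^ i \<le> real (a u)" "real (a u) \<le> B1" "2 ^ j \<le> real (b u)" "real (b u) \<le> B2"
    proof -
      have "real (2 ^ i) \<le> real (a u)" "real (a u) \<le> real (2 ^ (i + 1))" "real (2 ^ j) \<le> real (b u)" "real (b u) \<le> real (2 ^ (j + 1))"
        using uT by (simp_all only: of_nat_le_iff)
      thus "2 ^ i \<le> real (a u)" "real (a u) \<le> B1" "2 ^ j \<le> real (b u)" "real (b u) \<le> B2"
        by (simp_all add: B1_B2_K1_L1_def)
    qed
    define \<alpha> \<beta> where "\<alpha> = real (a u) ^ q" "\<beta> = real (b u) ^ q"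
    have \<alpha>\<beta>: "\<alpha> > 0" "\<beta> > 0" using ab0 by (auto simp: \<alpha>_\<beta>_def)
    have k1: "\<nu> * \<alpha> \<le> 2 * 4 ^ s * real_of_int (rel u (u + a u))" "real_of_int (rel u (u + a u)) \<le> 2 * (\<nu> * \<alpha>)"
      using rel_two_sided[OF uS(1,2) Hgap(1)[OF uT(1)]] by (simp_all only: \<nu>_def \<alpha>_\<beta>_def q_def)
    have l1: "\<nu> * \<beta> \<le> 2 * 4 ^ s * real_of_int (rel (u + a u) (u + a u + b u))" "real_of_int (rel (u + a u) (u + a u + b u)) \<le> 2 * (\<nu> * \<beta>)"
      using rel_two_sided[OF uS(2,3) Hgap(2)[OF uT(1)]] by (simp_all only: \<nu>_def \<alpha>_\<beta>_def q_def)
    have "0 < 2 * 4 ^ s * real_of_int (rel u (u + a u))" "0 < 2 * 4 ^ s * real_of_int (rel (u + a u) (u + a u + b u))"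
      using mult_pos_pos[OF \<nu> \<alpha>\<beta>(1)] mult_pos_pos[OF \<nu> \<alpha>\<beta>(2)] k1(1) l1(1) by linarith+
    hence kl0: "rel u (u + a u) > 0" "rel (u + a u) (u + a u + b u) > 0" by (simp_all add: zero_less_mult_iff)
    have rk: "real k = real_of_int (rel u (u + a u))" "real l = real_of_int (rel (u + a u) (u + a u + b u))"
      using kl0 by (simp_all add: k l)
    have k_le: "real k \<le> K1"
    proof -
      have "\<alpha> \<le> B1 ^ q" unfolding \<alpha>_\<beta>_def using ra by (intro power_mono) auto
      hence "2 * (\<nu> * \<alpha>) \<le> 2 * (\<nu> * B1 ^ q)" using \<nu> by (intro mult_left_mono) auto
      thus ?thesis using k1(2) unfolding rk by (simp add: B1_B2_K1_L1_def)
    qed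
    have l_le: "real l \<le> L1"
    proof -
      have "\<beta> \<le> B2 ^ q" unfolding \<alpha>_\<beta>_def using ra by (intro power_mono) auto
      hence "2 * (\<nu> * \<beta>) \<le> 2 * (\<nu> * B2 ^ q)" using \<nu> by (intro mult_left_mono) auto
      thus ?thesis using l1(2) unfolding rk by (simp add: B1_B2_K1_L1_def)
    qed
    have L1: "L1 \<le> 2 * 16 ^ s * real l"
    proof -
      have "L1 = (2 * 2 ^ q) * (\<nu> * (2 ^ j) ^ q)" by (simp add: B1_B2_K1_L1_def power_mult_distrib)
      also have "\<dots> \<le> (2 * 2 ^ q) * (\<nu> * \<beta>)"
        unfolding \<alpha>_\<beta>_def using ra \<nu> by (intro mult_left_mono power_mono) auto
      also have "\<dots> \<le> (2 * 2 ^ q) * (2 * 4 ^ s * real l)" using l1(1) unfolding rk by (intro mult_left_mono) auto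
      also have "\<dots> = 2 * (4 * 4) ^ s * real l" unfolding two power_mult_distrib by (simp only: mult_ac)
      finally show ?thesis by simp
    qed
    have B2: "B2 \<le> 2 * 16 ^ s * real (b u)"
    proof -
      have "B2 = 2 * 2 ^ j" by (simp add: B1_B2_K1_L1_def)
      also have "\<dots> \<le> 2 * real (b u)" using ra by simp
      also have "\<dots> \<le> 2 * 16 ^ s * real (b u)"
      proof -
        have "2 * 1 \<le> 2 * (16::real) ^ s" by (intro mult_left_mono) auto
        thus ?thesis by (intro mult_right_mono) auto
      qed
      finally show ?thesis .
    qed
    have near: "\<bar>real k * \<beta> - real l * \<alpha>\<bar> \<le> C\<Delta> * Y * (real l * \<alpha>)"
    proof -
      \<comment> \<open>The drift term is no worse than Y: this amounts to \<nu> A^(2s) <= y, that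
        is, D^2 <= y^2.\<close>
      have 1: "(real (a u) + real (b u)) / N \<le> 2 * Y"
      proof -
        have "(real (a u) + real (b u)) * (\<nu> * \<mu> ^ q) \<le> (2 * A) * (\<nu> * A ^ q)"
          using ab0 \<mu> \<nu> by (intro mult_mono power_mono) auto
        also have "\<dots> = 2 * (\<nu> * A ^ (2 * s))" unfolding qs by simp
        also have "\<dots> \<le> 2 * y" using Dy unfolding \<nu>A by simp
        finally have "(real (a u) + real (b u)) \<le> 2 * y / (\<nu> * \<mu> ^ q)"
          using \<nu> \<mu> by (simp add: pos_le_divide_eq)
        hence "(real (a u) + real (b u)) / N \<le> 2 * y / (\<nu> * \<mu> ^ q) / N"
          using N by (intro divide_right_mono) auto
        thus ?thesis by (simp add: Y_def mult_ac)
      qed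
      have 2: "(y / N) * (\<alpha> + \<beta>) \<le> 2 * (\<nu> * (\<alpha> * \<beta>) * Y)"
      proof -
        have "\<mu> ^ q \<le> \<alpha>" "\<mu> ^ q \<le> \<beta>" unfolding \<alpha>_\<beta>_def using \<mu> ra by (intro power_mono; linarith)+
        hence "\<mu> ^ q * \<beta> \<le> \<alpha> * \<beta>" "\<alpha> * \<mu> ^ q \<le> \<alpha> * \<beta>" using \<alpha>\<beta> by (auto intro!: mult_right_mono mult_left_mono)
        hence "\<mu> ^ q * (\<alpha> + \<beta>) \<le> 2 * (\<alpha> * \<beta>)" by (simp add: algebra_simps)
        hence "\<nu> * Y * (\<mu> ^ q * (\<alpha> + \<beta>)) \<le> \<nu> * Y * (2 * (\<alpha> * \<beta>))" using \<nu> Y by (intro mult_left_mono) auto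
        thus ?thesis unfolding \<nu>\<mu>[symmetric] by (simp only: mult_ac)
      qed
      have "\<bar>real k * \<beta> - real l * \<alpha>\<bar> \<le> \<nu> * (real s * 2 ^ s * (real (a u) + real (b u)) / N) * (\<alpha> * \<beta>) + 2 * 8 ^ s * (y / N) * (\<alpha> + \<beta>)"
        using near_power_relation[OF uS ab0(1,2)] unfolding rk \<nu>_def \<alpha>_\<beta>_def q_def .
      also have "\<dots> = \<nu> * (real s * 2 ^ s * ((real (a u) + real (b u)) / N)) * (\<alpha> * \<beta>) + 2 * 8 ^ s * ((y / N) * (\<alpha> + \<beta>))"
        by simp
      also have "\<dots> \<le> \<nu> * (real s * 2 ^ s * (2 * Y)) * (\<alpha> * \<beta>) + 2 * 8 ^ s * (2 * (\<nu> * (\<alpha> * \<beta>) * Y))"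
        using 1 2 \<nu> \<alpha>\<beta> by (intro add_mono mult_right_mono mult_left_mono) auto
      also have "\<dots> = (2 * real s * 2 ^ s + 4 * 8 ^ s) * Y * (\<alpha> * (\<nu> * \<beta>))" by (simp add: algebra_simps)
      also have "\<dots> \<le> (2 * real s * 2 ^ s + 4 * 8 ^ s) * Y * (\<alpha> * (2 * 4 ^ s * real l))"
        using l1(1) Y \<alpha>\<beta> unfolding rk by (intro mult_left_mono) auto
      also have "\<dots> = C\<Delta> * Y * (real l * \<alpha>)" by (simp add: C\<Delta>_def)
      finally show ?thesis .
    qed
    show ?thesis using ab0 kl0 ra k_le l_le L1 B2 near by (simp add: k l \<alpha>_\<beta>_def)
  qed
  \<comment> \<open>A member of the class has a positive integer k below K1. This is why the empty
    class was set aside.\<close>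
  have K1: "K1 \<ge> 1"
  proof -
    obtain u where "u \<in> T'" using False by (auto simp: T'_def)
    from near_prop[OF this refl refl] show ?thesis by linarith
  qed
  define P where "P = B1 * B2 * K1 * L1"
  have Pe: "P = 4 * \<nu>\<^sup>2 * ((2 ^ (i + 1)) ^ (2 * s) * (2 ^ (j + 1)) ^ (2 * s))"
    by (simp add: P_def B1_B2_K1_L1_def qs power2_eq_square)
  have pw: "(2 ^ (n + 1)) ^ (2 * s) = 4 ^ s * ((2::real) ^ n) ^ (2 * s)" for n
    by (simp add: power_mult_distrib power_mult)
  have pA: "(2 ^ (n + 1)) ^ (2 * s) \<le> 4 ^ s * A ^ (2 * s)" if "2 ^ n \<le> A" for n
    unfolding pw using that by (intro mult_left_mono power_mono) auto
  have sqrtP: "sqrt P \<le> 2 * 4 ^ s * D"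
  proof -
    have "P \<le> 4 * \<nu>\<^sup>2 * ((4 ^ s * A ^ (2 * s)) * (4 ^ s * A ^ (2 * s)))"
      unfolding Pe using pA[OF ij(1)] pA[OF ij(2)] A1 by (intro mult_left_mono mult_mono) auto
    also have "\<dots> = (2 * 4 ^ s * (\<nu> * A ^ (2 * s)))\<^sup>2" by (simp add: power2_eq_square)
    finally have "sqrt P \<le> \<bar>2 * 4 ^ s * (\<nu> * A ^ (2 * s))\<bar>" using real_sqrt_le_mono by fastforce
    also have "\<dots> = 2 * 4 ^ s * (D ^ 2 / y)" unfolding \<nu>A using D y by simp
    also have "\<dots> \<le> 2 * 4 ^ s * D" using Dy by (intro mult_left_mono) auto
    finally show ?thesis .
  qed
  \<comment> \<open>The power \<mu>^q in the denominator of Y cancels all but one factor 2^e of the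
    shorter gap. That factor is at most A = N/D, and the N cancels as well.\<close>
  have YP: "Y * P \<le> 4 * 16 ^ s * D"
  proof -
    define e f where "e = min i j" "f = max i j"
    have ef: "2 ^ e \<le> A" "2 ^ f \<le> A" using ij by (auto simp: e_f_def min_def max_def)
    have "(2 ^ (i + 1)) ^ (2 * s) * (2 ^ (j + 1)) ^ (2 * s) = ((2::real) ^ (e + 1)) ^ (2 * s) * (2 ^ (f + 1)) ^ (2 * s)"
      by (cases "i \<le> j") (simp_all add: e_f_def)
    also have "\<dots> = 4 ^ s * (2 ^ e * \<mu> ^ q) * (2 ^ (f + 1)) ^ (2 * s)"
      unfolding pw[of e] unfolding qs by (simp add: \<mu>_def e_f_def)
    also have "\<dots> \<le> 4 ^ s * (A * \<mu> ^ q) * (4 ^ s * A ^ (2 * s))"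
      using ef pA[OF ef(2)] \<mu> A1 by (intro mult_mono) auto
    finally have "P \<le> 4 * \<nu>\<^sup>2 * (4 ^ s * (A * \<mu> ^ q) * (4 ^ s * A ^ (2 * s)))"
      unfolding Pe by (intro mult_left_mono) auto
    hence "Y * P \<le> Y * (4 * \<nu>\<^sup>2 * (4 ^ s * (A * \<mu> ^ q) * (4 ^ s * A ^ (2 * s))))"
      using Y by (intro mult_left_mono) auto
    also have "\<dots> = 4 * (4 ^ s * 4 ^ s) * A * (\<nu> * A ^ (2 * s)) * (\<nu> * \<mu> ^ q * Y)"
      by (simp add: power2_eq_square)
    also have "\<dots> = 4 * (4 * 4) ^ s * A * (D ^ 2 / y) * (y / N)"
      unfolding \<nu>\<mu> \<nu>A power_mult_distrib ..
    also have "\<dots> = 4 * 16 ^ s * D" using y N D by (simp add: A power2_eq_square)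
    finally show ?thesis .
  qed
  have "card T' = card (\<phi> ` T')" using inj by (simp add: card_image)
  also have "real \<dots> \<le> (1 + ln B1) * (1 + ln K1) * (sqrt (B1 * B2 * K1 * L1) + 4 * (2 * 16 ^ s) * (C\<Delta> * Y) * (B1 * B2 * K1 * L1))"
  proof (rule card_near_power[where q = q])
    show "finite (\<phi> ` T')" using fin TS by (auto simp: T'_def intro!: finite_imageI intro: finite_subset)
    show "1 \<le> B1" unfolding B1_B2_K1_L1_def by (rule one_le_power) simp
    show "0 < B2" "0 < L1" using \<nu> by (auto simp: B1_B2_K1_L1_def)
    show "1 \<le> K1" by (rule K1)
    show "1 \<le> 2 * (16::real) ^ s" using one_le_power[of "16::real" s] by linarith
    show "0 \<le> C\<Delta> * Y" using Y by (simp add: C\<Delta>_def)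
    show "1 \<le> q" using s by (simp add: q_def)
  next
    fix a' b' k l assume "(a', b', k, l) \<in> \<phi> ` T'"
    then obtain u where u: "u \<in> T'" "a' = a u" "b' = b u" "k = nat (rel u (u + a u))" "l = nat (rel (u + a u) (u + a u + b u))"
      by (auto simp: \<phi>_def)
    show "a' > 0 \<and> b' > 0 \<and> k > 0 \<and> l > 0 \<and> real a' \<le> B1 \<and> real b' \<le> B2 \<and> B2 \<le> (2 * 16 ^ s) * real b'
      \<and> real k \<le> K1 \<and> real l \<le> L1 \<and> L1 \<le> (2 * 16 ^ s) * real l
      \<and> \<bar>real k * real b' ^ q - real l * real a' ^ q\<bar> \<le> C\<Delta> * Y * (real l * real a' ^ q)"
      unfolding u(2,3) by (rule near_prop[OF u(1,4,5)])
  qed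
  also have "\<dots> = (1 + ln B1) * (1 + ln K1) * (sqrt P + 4 * (2 * 16 ^ s) * C\<Delta> * (Y * P))"
    by (simp add: P_def mult_ac)
  also have "\<dots> \<le> (1 + ln (2 * A)) * (1 + ln (4 ^ s * y)) * (class_const * D)"
  proof (intro mult_mono)
    have "B1 > 0" "B1 \<le> 2 * A" using ij by (auto simp: B1_B2_K1_L1_def)
    thus "1 + ln B1 \<le> 1 + ln (2 * A)" by simp
    have "K1 \<le> (2 * 2 ^ q) * (\<nu> * A ^ q)"
    proof -
      have "K1 = (2 * 2 ^ q) * (\<nu> * (2 ^ i) ^ q)" by (simp add: B1_B2_K1_L1_def power_mult_distrib)
      also have "\<dots> \<le> (2 * 2 ^ q) * (\<nu> * A ^ q)" using ij \<nu> by (intro mult_left_mono power_mono) auto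
      finally show ?thesis .
    qed
    also have "\<dots> \<le> 4 ^ s * (\<nu> * A ^ (2 * s))"
      unfolding two using \<nu> A1 by (intro mult_left_mono power_increasing) (auto simp: qs)
    also have "\<dots> \<le> 4 ^ s * y" unfolding \<nu>A using Dy by (intro mult_left_mono) auto
    finally show "1 + ln K1 \<le> 1 + ln (4 ^ s * y)" using K1 by simp
    have C\<Delta>: "0 \<le> 4 * (2 * 16 ^ s) * C\<Delta>" by (simp add: C\<Delta>_def)
    have "sqrt P + 4 * (2 * 16 ^ s) * C\<Delta> * (Y * P) \<le> 2 * 4 ^ s * D + 4 * (2 * 16 ^ s) * C\<Delta> * (4 * 16 ^ s * D)"
      using sqrtP mult_left_mono[OF YP C\<Delta>] by linarith
    also have "\<dots> = class_const * D" by (simp add: class_const_def C\<Delta>_def algebra_simps)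
    finally show "sqrt P + 4 * (2 * 16 ^ s) * C\<Delta> * (Y * P) \<le> class_const * D" .
    have P0: "0 \<le> P" using \<nu> by (simp add: Pe)
    show "0 \<le> sqrt P + 4 * (2 * 16 ^ s) * C\<Delta> * (Y * P)" using C\<Delta> P0 Y by simp
    show "0 \<le> 1 + ln K1" using K1 by simp
    show "0 \<le> 1 + ln (2 * A)" using A1 by simp
    have "1 * 1 \<le> 4 ^ s * y" using D by (intro mult_mono) auto
    thus "0 \<le> (1 + ln (2 * A)) * (1 + ln (4 ^ s * y))" using A1 by simp
  qed
  finally show ?thesis by (simp add: T'_def)
qed

text \<open>Two logarithms count the dyadic classes of the two gaps and two come from the gcd sums
  in \<open>card_near_power\<close>; all four are bounded by one expression.\<close>

lemma card_bound_small_y: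
  assumes H: "\<And>u v. u \<in> S \<Longrightarrow> v \<in> S \<Longrightarrow> u < v \<Longrightarrow>
      x * (real v - real u) ^ (2 * s - 1) \<ge> 25 * real s * 32 ^ s * (y * N ^ (2 * s - 1))"
    and yN: "100 * real s * 512 ^ s * y \<le> N"
    and D: "D \<ge> 1" "D ^ (2 * s + 2) = x * y" "D \<le> y" and Nx: "N \<le> x" and yx: "y \<le> x"
  shows "real (card S) \<le> 4 * D + (2 * real s + 2 * ln x + 1) ^ 4 * (class_const * D)"
proof -
  define A where "A = N / D"
  have A: "A > 0" using N D by (simp add: A_def)
  have ND: "N / A = D" using N D by (simp add: A_def)
  obtain T a b where T: "T \<subseteq> S" "real (card S) \<le> real (card T) + 2 * (N / A + 1)"
    and ab: "\<And>u. u \<in> T \<Longrightarrow> 0 < a u \<and> real (a u) \<le> A \<and> 0 < b u \<and> real (b u) \<le> A \<and> u + a u \<in> S \<and> u + a u + b u \<in> S"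
    and far: "\<And>u v. u \<in> T \<Longrightarrow> v \<in> S \<Longrightarrow> u < v \<Longrightarrow> u + a u \<le> v"
    using short_consecutive_gaps[OF fin range A N] by blast
  have x1: "1 \<le> x" using D yx by linarith
  have cc: "0 \<le> class_const" by (simp add: class_const_def)
  have lx: "0 \<le> ln x" using x1 by simp
  have "real (card T) \<le> (2 * real s + 2 * ln x + 1) ^ 4 * (class_const * D)"
  proof (cases "T = {}")
    case False
    then obtain u0 where "u0 \<in> T" by auto
    hence A1: "A \<ge> 1" using ab[of u0] by force
    define L where "L = nat \<lfloor>log 2 A\<rfloor>"
    define Tij where "Tij i j = {u \<in> T. 2 ^ i \<le> a u \<and> a u < 2 ^ (i + 1) \<and> 2 ^ j \<le> b u \<and> b u < 2 ^ (j + 1)}" for i j :: nat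
    have lg: "2 ^ i \<le> A \<longleftrightarrow> i \<le> L" for i
    proof -
      have "2 ^ i \<le> A \<longleftrightarrow> real i \<le> log 2 A" using A1 by (simp add: le_log_iff powr_realpow)
      also have "\<dots> \<longleftrightarrow> i \<le> L" using A1 by (simp add: L_def le_nat_iff le_floor_iff)
      finally show ?thesis .
    qed
    have ex: "\<exists>i\<le>L. 2 ^ i \<le> n \<and> n < 2 ^ (i + 1)" if n: "n > 0" "real n \<le> A" for n :: nat
    proof -
      obtain i where i: "2 ^ i \<le> n" "n < 2 ^ (i + 1)" using ex_power_ivl1[of 2 n] n by (auto simp: Suc_le_eq)
      have "real (2 ^ i) \<le> real n" using i(1) by (simp only: of_nat_le_iff)
      hence "2 ^ i \<le> A" using n(2) unfolding of_nat_power of_nat_numeral by linarith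
      thus ?thesis using i lg by auto
    qed
    have "T \<subseteq> (\<Union>i\<in>{..L}. \<Union>j\<in>{..L}. Tij i j)"
    proof
      fix u assume u: "u \<in> T"
      have au: "0 < a u" "real (a u) \<le> A" "0 < b u" "real (b u) \<le> A" using ab[OF u] by auto
      obtain i where "i \<le> L" "2 ^ i \<le> a u \<and> a u < 2 ^ (i + 1)" using ex[OF au(1,2)] by auto
      moreover obtain j where "j \<le> L" "2 ^ j \<le> b u \<and> b u < 2 ^ (j + 1)" using ex[OF au(3,4)] by auto
      ultimately show "u \<in> (\<Union>i\<in>{..L}. \<Union>j\<in>{..L}. Tij i j)" using u by (auto simp: Tij_def)
    qed
    moreover have "finite T" using fin T(1) by (rule finite_subset[rotated])
    ultimately have "card T \<le> card (\<Union>i\<in>{..L}. \<Union>j\<in>{..L}. Tij i j)"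
      by (intro card_mono) (auto simp: Tij_def)
    also have "\<dots> \<le> (\<Sum>i\<le>L. card (\<Union>j\<in>{..L}. Tij i j))" by (intro card_UN_le) simp
    also have "\<dots> \<le> (\<Sum>i\<le>L. \<Sum>j\<le>L. card (Tij i j))" by (intro sum_mono card_UN_le) simp
    finally have "real (card T) \<le> (\<Sum>i\<le>L. \<Sum>j\<le>L. real (card (Tij i j)))" by (simp flip: of_nat_sum)
    also have "\<dots> \<le> (\<Sum>i\<le>L. \<Sum>j\<le>L. (1 + ln (2 * A)) * (1 + ln (4 ^ s * y)) * (class_const * D))"
      unfolding Tij_def
    proof (intro sum_mono)
      fix i j assume "i \<in> {..L}" "j \<in> {..L}"
      hence "2 ^ i \<le> A" "2 ^ j \<le> A" using lg by auto
      from dyadic_class_card[OF H yN D A_def T(1) ab far this]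
      show "real (card {u \<in> T. 2 ^ i \<le> a u \<and> a u < 2 ^ (i + 1) \<and> 2 ^ j \<le> b u \<and> b u < 2 ^ (j + 1)})
        \<le> (1 + ln (2 * A)) * (1 + ln (4 ^ s * y)) * (class_const * D)" .
    qed
    also have "\<dots> = (real L + 1) * (real L + 1) * ((1 + ln (2 * A)) * (1 + ln (4 ^ s * y))) * (class_const * D)"
      by (simp add: algebra_simps)
    also have "\<dots> \<le> (2 * real s + 2 * ln x + 1) * (2 * real s + 2 * ln x + 1) * ((2 * real s + 2 * ln x + 1) * (2 * real s + 2 * ln x + 1)) * (class_const * D)"
    proof (intro mult_right_mono mult_mono)
      have Ax: "A \<le> x"
      proof -
        have "A \<le> N" unfolding A_def using D N by (simp add: divide_le_eq mult_le_cancel_left1)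
        thus ?thesis using Nx by linarith
      qed
      have lA: "ln A \<le> ln x" using Ax A1 by simp
      have l2: "ln 2 \<le> (1::real)" using ln_le_minus_one[of "2::real"] by simp
      have l2': "1 / 2 \<le> ln (2::real)" using ln_le_minus_one[of "1 / 2 :: real"] by (simp add: ln_div)
      have l4: "ln 4 \<le> (2::real)"
      proof -
        have "ln (4::real) = 2 * ln 2" using ln_realpow[of "2::real" 2] by simp
        thus ?thesis using l2 by simp
      qed
      show L1: "real L + 1 \<le> 2 * real s + 2 * ln x + 1"
      proof -
        have "real L \<le> log 2 A" using A1 by (simp add: L_def)
        also have "\<dots> = ln A / ln 2" by (simp add: log_def)
        also have "\<dots> \<le> ln A / (1 / 2)"
          using A1 l2' by (intro divide_left_mono) auto
        finally have "real L \<le> 2 * ln A" by simp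
        thus ?thesis using lA s by simp
      qed
      then show "real L + 1 \<le> 2 * real s + 2 * ln x + 1" .
      have "ln (2 * A) = ln 2 + ln A" using A1 by (simp add: ln_mult)
      moreover have "1 \<le> real s" using s by simp
      ultimately show "1 + ln (2 * A) \<le> 2 * real s + 2 * ln x + 1" using lA l2 lx by linarith
      have "ln (4 ^ s * y) = real s * ln 4 + ln y" using y by (simp add: ln_mult ln_realpow)
      moreover have "real s * ln 4 \<le> real s * 2" using l4 by (intro mult_left_mono) auto
      moreover have "ln y \<le> ln x" using yx y by simp
      ultimately show "1 + ln (4 ^ s * y) \<le> 2 * real s + 2 * ln x + 1" using lx by linarith
      have "1 * 1 \<le> 4 ^ s * y" using D by (intro mult_mono) auto
      thus y1: "0 \<le> 1 + ln (4 ^ s * y)" by simp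
      show "0 \<le> (1 + ln (2 * A)) * (1 + ln (4 ^ s * y))" using y1 A1 by simp
      show "0 \<le> class_const * D" using cc D by simp
    qed (use lx in auto)
    finally show ?thesis by (simp add: power4_eq_xxxx mult_ac)
  qed (use cc D lx in simp)
  thus ?thesis using T(2) ND D by simp
qed

end

section \<open>All near multiples in a dyadic range\<close>

lemma near_multiples_subset:
  fixes x y N :: real and S S' :: "nat set"
  assumes "near_multiples s x y N S m" "S' \<subseteq> S"
  shows "near_multiples s x y N S' m"
  using assms unfolding near_multiples_def by (auto intro: finite_subset)

text \<open>The range of N is split at a constant multiple of y. Below it, the assumption that x is
  large against y^(2s) gives \<open>H\<close> for every gap of length at least 1. Above it, the
  points are thinned first, so that \<open>three_points_far\<close> supplies
  \<open>H\<close>.\<close>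

lemma card_near_multiples_dyadic:
  assumes s: "s \<ge> (2::nat)"
  shows "\<exists>C0\<ge>1. \<exists>C\<ge>0. \<forall>x y N D :: real. x \<ge> 1 \<longrightarrow> C0 * y ^ (2 * s) \<le> x \<longrightarrow> x \<le> y ^ (2 * s + 1) \<longrightarrow> N > 0 \<longrightarrow> y > 0 \<longrightarrow>
    D \<ge> 1 \<longrightarrow> D ^ (2 * s + 2) = x * y \<longrightarrow>
    real (card {u::nat. N < real u \<and> real u \<le> 2 * N \<and> (\<exists>m::nat. x < real u ^ s * real m \<and> real u ^ s * real m \<le> x + y)})
      \<le> C * (1 + ln x) ^ 4 * D"
proof -
  define C2 where "C2 = 100 * real s * 512 ^ s"
  \<comment> \<open>Chosen so that N < C2 y and C0 y^(2s) <= x imply 25 s 32^s y N^(2s-1) <= x,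
    which is \<open>H\<close> for a gap of length 1.\<close>
  define C0 where "C0 = 25 * real s * 32 ^ s * C2 ^ (2 * s - 1)"
  define E where "E = (8 * real s * 32 ^ s) ^ (2 * s - 1)"
  define cc where "cc = 2 * 4 ^ s + 16 * (2 * 16 ^ s) * (2 * 4 ^ s * (2 * real s * 2 ^ s + 4 * 8 ^ s)) * (16::real) ^ s"
  define C where "C = (2 * E + 1) + (4 + 800 * real s * 8192 ^ s) + 2 * (4 + (2 * real s + 1) ^ 4 * cc)"
  have cc: "cc \<ge> 0" by (simp add: cc_def)
  have s1: "1 \<le> real s" using s by simp
  have C2: "C2 \<ge> 1"
  proof -
    have "1 * 1 * 1 \<le> 100 * real s * 512 ^ s" using s1 by (intro mult_mono) auto
    thus ?thesis by (simp add: C2_def)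
  qed
  have C0: "C0 \<ge> 1"
  proof -
    have "1 * 1 * 1 * 1 \<le> 25 * real s * 32 ^ s * C2 ^ (2 * s - 1)"
      using s1 C2 by (intro mult_mono one_le_power) auto
    thus ?thesis by (simp add: C0_def)
  qed
  have E: "E \<ge> 0" by (simp add: E_def)
  have Cnn: "C \<ge> 0" unfolding C_def using E cc by (intro add_nonneg_nonneg mult_nonneg_nonneg) auto
  show ?thesis
  proof (rule exI[of _ C0], rule conjI[OF C0], rule exI[of _ C], rule conjI[OF Cnn], intro allI impI)
    fix x y N D :: real
    assume xge: "x \<ge> 1" and yx: "C0 * y ^ (2 * s) \<le> x" and xy: "x \<le> y ^ (2 * s + 1)" and N: "N > 0" and y0: "y > 0"
      and D: "D \<ge> 1" "D ^ (2 * s + 2) = x * y"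
    define S where "S = {u::nat. N < real u \<and> real u \<le> 2 * N \<and> (\<exists>m::nat. x < real u ^ s * real m \<and> real u ^ s * real m \<le> x + y)}"
    have y1: "y \<ge> 1"
    proof (rule ccontr)
      assume "\<not> 1 \<le> y"
      hence "y ^ (2 * s + 1) < 1" using power_Suc_less_one[of y "2 * s"] y0 by simp
      thus False using xge xy by simp
    qed
    have yx1: "y \<le> x"
    proof -
      have "1 * y ^ 1 \<le> C0 * y ^ (2 * s)" using C0 y1 s by (intro mult_mono power_increasing) auto
      thus ?thesis using yx by simp
    qed
    \<comment> \<open>This is where x <= y^(2s+1) enters: it says D^(2s+2) = xy <= y^(2s+2).\<close>
    have Dy: "D \<le> y"
    proof -
      have "D ^ (2 * s + 2) \<le> y ^ (2 * s + 1) * y" unfolding D(2) using xy y0 by (intro mult_right_mono) auto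
      also have "\<dots> = y ^ (2 * s + 2)" by simp
      finally show ?thesis using power_le_imp_le_base[of D "2 * s + 1" y] y0 by simp
    qed
    have finS: "finite S"
    proof (rule finite_subset)
      show "S \<subseteq> {..nat \<lfloor>2 * N\<rfloor>}" by (auto simp: S_def intro: le_nat_floor)
    qed simp
    have l1: "1 \<le> 1 + ln x" using xge by simp
    have l4: "1 \<le> (1 + ln x) ^ 4" using l1 by (rule one_le_power)
    have fin_step: "c * D \<le> C * (1 + ln x) ^ 4 * D" if "c \<ge> 0" "c \<le> C" for c
    proof -
      have "c * 1 \<le> C * (1 + ln x) ^ 4" using that l4 by (intro mult_mono) auto
      thus ?thesis using D by (intro mult_right_mono) auto
    qed
    define m where "m u = (SOME m::nat. x < real u ^ s * real m \<and> real u ^ s * real m \<le> x + y)" for u :: nat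
    have nm: "near_multiples s x y N S m"
    proof
      fix u assume u: "u \<in> S"
      show "N < real u \<and> real u \<le> 2 * N" using u by (simp add: S_def)
      have "\<exists>m::nat. x < real u ^ s * real m \<and> real u ^ s * real m \<le> x + y" using u by (simp add: S_def)
      thus "x < real u ^ s * real (m u) \<and> real u ^ s * real (m u) \<le> x + y" unfolding m_def by (rule someI_ex)
    qed (use s xge y0 N finS in auto)
    interpret near_multiples s x y N S m by (rule nm)
    have "real (card S) \<le> C * (1 + ln x) ^ 4 * D"
    proof (cases "S = {}")
      case True
      thus ?thesis using Cnn l4 D by simp
    next
      case False
      then obtain u0 where u0: "u0 \<in> S" by auto
      \<comment> \<open>A point u > N has u^s <= 2x with s >= 2. Together with N > 2E this yields N
        E <= x, the size condition of \<open>three_points_far\<close>.\<close>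
      have N2: "N ^ 2 \<le> 2 * x"
      proof (cases "N \<le> 1")
        case True
        hence "N ^ 2 \<le> 1" using N by (simp add: power_le_one)
        thus ?thesis using xge by linarith
      next
        case False
        have "m u0 \<noteq> 0" using mult[OF u0] xge by (intro notI) simp
        hence m1: "1 \<le> real (m u0)" by simp
        have "N ^ 2 \<le> N ^ s" using False s by (intro power_increasing) auto
        also have "\<dots> \<le> real u0 ^ s" using range[OF u0] N by (intro power_mono) auto
        also have "\<dots> \<le> real u0 ^ s * real (m u0)" using m1 by (simp add: mult_le_cancel_left1)
        also have "\<dots> \<le> 2 * x" using mult[OF u0] yx1 by linarith
        finally show ?thesis .
      qed
      show ?thesis
      proof (cases "N \<ge> C2 * y")
        case large: False
        have hyp: "25 * real s * 32 ^ s * (y * N ^ (2 * s - 1)) \<le> x"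
        proof -
          have "N ^ (2 * s - 1) \<le> (C2 * y) ^ (2 * s - 1)" using large N by (intro power_mono) auto
          hence "25 * real s * 32 ^ s * (y * N ^ (2 * s - 1)) \<le> 25 * real s * 32 ^ s * (y * (C2 * y) ^ (2 * s - 1))"
            using y0 by (intro mult_left_mono) auto
          also have "\<dots> = C0 * (y * y ^ (2 * s - 1))" by (simp add: C0_def power_mult_distrib)
          also have "y * y ^ (2 * s - 1) = y ^ (2 * s)"
          proof -
            have "2 * s = Suc (2 * s - 1)" using s by simp
            thus ?thesis by (metis power_Suc)
          qed
          finally show ?thesis using yx by linarith
        qed
        have "real (card S) \<le> 4 * D + 800 * real s * 8192 ^ s * D"
        proof (rule card_bound_large_y)
          fix u v :: nat assume "u < v"
          hence "1 \<le> (real v - real u) ^ (2 * s - 1)" by (intro one_le_power) auto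
          hence "x * 1 \<le> x * (real v - real u) ^ (2 * s - 1)" using xge by (intro mult_left_mono) auto
          thus "25 * real s * 32 ^ s * (y * N ^ (2 * s - 1)) \<le> x * (real v - real u) ^ (2 * s - 1)" using hyp by linarith
        qed (use large D in \<open>auto simp: C2_def\<close>)
        also have "\<dots> = (4 + 800 * real s * 8192 ^ s) * D" by (simp add: algebra_simps)
        also have "\<dots> \<le> C * (1 + ln x) ^ 4 * D"
          using E cc by (intro fin_step) (auto simp: C_def)
        finally show ?thesis .
      next
        case small: True
        show ?thesis
        proof (cases "N \<le> 2 * E")
          \<comment> \<open>For N below a constant, the number of integers in (N, 2N] is a
            sufficient bound.\<close>
          case True
          have "card S \<le> card {..nat \<lfloor>2 * N\<rfloor>} - card {..nat \<lfloor>N\<rfloor>}"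
          proof -
            have "S \<subseteq> {nat \<lfloor>N\<rfloor><..nat \<lfloor>2 * N\<rfloor>}"
            proof
              fix u assume "u \<in> S"
              hence "N < real u" "real u \<le> 2 * N" by (auto simp: S_def)
              thus "u \<in> {nat \<lfloor>N\<rfloor><..nat \<lfloor>2 * N\<rfloor>}" using N by (auto intro: le_nat_floor) linarith
            qed
            hence "card S \<le> card {nat \<lfloor>N\<rfloor><..nat \<lfloor>2 * N\<rfloor>}" by (intro card_mono) auto
            thus ?thesis by simp
          qed
          hence "real (card S) \<le> N + 1" using N by simp linarith
          hence "real (card S) \<le> (2 * E + 1) * 1" using True by simp
          also have "\<dots> \<le> (2 * E + 1) * D" using D E by (intro mult_left_mono) auto
          also have "\<dots> \<le> C * (1 + ln x) ^ 4 * D"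
            using E cc by (intro fin_step) (auto simp: C_def)
          finally show ?thesis .
        next
          case False
          have NE: "N * E \<le> x"
          proof -
            have "N * (2 * E) \<le> N * N" using False N by (intro mult_left_mono) auto
            thus ?thesis using N2 by (simp add: power2_eq_square)
          qed
          have NX: "N \<le> x"
          proof -
            have "N * 1 \<le> N * E"
            proof (intro mult_left_mono)
              have "1 * 1 * 1 \<le> 8 * real s * 32 ^ s" using s1 by (intro mult_mono) auto
              thus "1 \<le> E" unfolding E_def by (intro one_le_power) simp
            qed (use N in auto)
            thus ?thesis using NE by simp
          qed
          \<comment> \<open>Relations are needed on S for the third point inside a gap, but triples
            are then counted on S' only. The factor 100 = 4 * 25 in the hypothesis on N matches the
            4 in \<open>three_points_far\<close> with the 25 in \<open>H\<close>.\<close>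
          obtain S' where S': "S' \<subseteq> S" "card S \<le> 2 * card S'"
            "\<And>u v. u \<in> S' \<Longrightarrow> v \<in> S' \<Longrightarrow> u < v \<Longrightarrow> \<exists>w\<in>S. u < w \<and> w < v"
            using thin_out[OF finS] by blast
          interpret S': near_multiples s x y N S' m using nm S'(1) by (rule near_multiples_subset)
          have small': "100 * real s * 512 ^ s * y \<le> N" using small by (simp add: C2_def)
          have "real (card S') \<le> 4 * D + (2 * real s + 2 * ln x + 1) ^ 4 * (S'.class_const * D)"
          proof (rule S'.card_bound_small_y)
            fix u v assume uv: "u \<in> S'" "v \<in> S'" "u < v"
            obtain w where w: "w \<in> S" "u < w" "w < v" using S'(3)[OF uv] by auto
            have "N ^ (2 * s) < 4 * (x * (real v - real u) ^ (2 * s - 1))"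
              using uv S'(1) w small' NE by (intro three_points_far[of u w v]) (auto simp: E_def)
            moreover have "4 * (25 * real s * 32 ^ s * (y * N ^ (2 * s - 1))) \<le> N ^ (2 * s)"
            proof -
              have "(32::real) ^ s \<le> 512 ^ s" by (intro power_mono) auto
              hence "100 * real s * 32 ^ s * y \<le> 100 * real s * 512 ^ s * y"
                using y0 by (intro mult_right_mono mult_left_mono) auto
              hence "100 * real s * 32 ^ s * y \<le> N" using small' by linarith
              hence "100 * real s * 32 ^ s * y * N ^ (2 * s - 1) \<le> N * N ^ (2 * s - 1)"
                using N by (intro mult_right_mono) auto
              moreover have "2 * s = Suc (2 * s - 1)" using s by simp
              hence "N * N ^ (2 * s - 1) = N ^ (2 * s)" by (metis power_Suc)
              ultimately show ?thesis by (simp add: mult_ac)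
            qed
            ultimately show "25 * real s * 32 ^ s * (y * N ^ (2 * s - 1)) \<le> x * (real v - real u) ^ (2 * s - 1)" by linarith
          qed (use small' D Dy NX yx1 in auto)
          also have "S'.class_const = cc" by (simp add: S'.class_const_def cc_def)
          also have "4 * D + (2 * real s + 2 * ln x + 1) ^ 4 * (cc * D) \<le> (4 + (2 * real s + 1) ^ 4 * cc) * ((1 + ln x) ^ 4 * D)"
          proof -
            have "2 * real s + 2 * ln x + 1 \<le> (2 * real s + 1) * (1 + ln x)"
            proof -
              have "2 * ln x \<le> (2 * real s) * ln x" using s1 xge by (intro mult_right_mono) auto
              moreover have "0 \<le> ln x" using xge by simp
              ultimately show ?thesis by (simp add: algebra_simps)
            qed
            hence "(2 * real s + 2 * ln x + 1) ^ 4 \<le> ((2 * real s + 1) * (1 + ln x)) ^ 4"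
              using xge by (intro power_mono) auto
            hence "(2 * real s + 2 * ln x + 1) ^ 4 * (cc * D) \<le> ((2 * real s + 1) ^ 4 * (1 + ln x) ^ 4) * (cc * D)"
              unfolding power_mult_distrib using cc D by (intro mult_right_mono) auto
            moreover have "4 * (1 * D) \<le> 4 * ((1 + ln x) ^ 4 * D)"
              using l4 D by (intro mult_left_mono mult_right_mono) auto
            ultimately show ?thesis by (simp add: algebra_simps)
          qed
          finally have "real (card S') \<le> (4 + (2 * real s + 1) ^ 4 * cc) * ((1 + ln x) ^ 4 * D)" .
          hence "2 * real (card S') \<le> 2 * ((4 + (2 * real s + 1) ^ 4 * cc) * ((1 + ln x) ^ 4 * D))" by (rule mult_left_mono) simp
          also have "\<dots> = (2 * (4 + (2 * real s + 1) ^ 4 * cc)) * ((1 + ln x) ^ 4 * D)" by (simp only: mult.assoc)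
          finally have "2 * real (card S') \<le> (2 * (4 + (2 * real s + 1) ^ 4 * cc)) * ((1 + ln x) ^ 4 * D)" .
          also have "\<dots> \<le> C * ((1 + ln x) ^ 4 * D)"
            using E l4 D by (intro mult_right_mono) (auto simp: C_def)
          finally have "2 * real (card S') \<le> C * (1 + ln x) ^ 4 * D" by (simp only: mult.assoc)
          moreover have "real (card S) \<le> 2 * real (card S')" using of_nat_mono[OF S'(2), where ?'a = real] by simp
          ultimately show ?thesis by linarith
        qed
      qed
    qed
    thus "real (card {u::nat. N < real u \<and> real u \<le> 2 * N \<and> (\<exists>m::nat. x < real u ^ s * real m \<and> real u ^ s * real m \<le> x + y)})
      \<le> C * (1 + ln x) ^ 4 * D" by (simp add: S_def)
  qed
qed

section \<open>The divisor function and Moebius inversion\<close>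

abbreviation tau :: "nat \<Rightarrow> nat" where "tau n \<equiv> card {d. d dvd n}"

lemma tau_pos: "n > 0 \<Longrightarrow> tau n \<ge> 1"
  using card_gt_0_iff[of "{d. d dvd n}"] by (auto simp: Suc_le_eq)

lemma tau_mono: "m dvd n \<Longrightarrow> n > 0 \<Longrightarrow> tau m \<le> tau n"
  by (intro card_mono) (auto intro: dvd_trans)

lemma tau_mult_le:
  assumes "a > 0" "b > 0"
  shows "tau (a * b) \<le> tau a * tau b"
proof -
  have "{d. d dvd a * b} \<subseteq> (\<lambda>(c, d). c * d) ` ({d. d dvd a} \<times> {d. d dvd b})"
  proof
    fix d assume "d \<in> {d. d dvd a * b}"
    then obtain b' c' where "d = b' * c'" "b' dvd a" "c' dvd b" using division_decomp by blast
    thus "d \<in> (\<lambda>(c, d). c * d) ` ({d. d dvd a} \<times> {d. d dvd b})" by auto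
  qed
  hence "tau (a * b) \<le> card ((\<lambda>(c, d). c * d) ` ({d. d dvd a} \<times> {d. d dvd b}))"
    using assms by (intro card_mono) auto
  also have "\<dots> \<le> card ({d. d dvd a} \<times> {d. d dvd b})" using assms by (intro card_image_le) auto
  finally show ?thesis by (simp add: card_cartesian_product)
qed

lemma tau_prime_power_le:
  assumes "prime p"
  shows "tau (p ^ k) \<le> k + 1"
proof -
  have "{d. d dvd p ^ k} \<subseteq> (\<lambda>i. p ^ i) ` {..k}"
    using assms by (auto simp: divides_primepow_nat)
  hence "tau (p ^ k) \<le> card ((\<lambda>i. p ^ i) ` {..k})" by (intro card_mono) auto
  also have "\<dots> \<le> card {..k}" by (intro card_image_le) auto
  finally show ?thesis by simp
qed

text \<open>The classical divisor bound. A prime p >= 2^(1/\<epsilon>) satisfies k + 1 <= 2^k <=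
  p^(k\<epsilon>) and costs nothing; each of the finitely many smaller primes costs a factor
  C1.\<close>

lemma tau_le_powr:
  assumes "\<epsilon> > 0"
  shows "\<exists>C\<ge>1. \<forall>n>0. real (tau n) \<le> C * real n powr \<epsilon>"
proof -
  define C1 where "C1 = 1 + 1 / (\<epsilon> * ln 2)"
  define B where "B = 2 powr (1 / \<epsilon>)"
  have C1: "C1 \<ge> 1" using assms by (simp add: C1_def)
  have small: "real (k + 1) \<le> C1 * real (p ^ k) powr \<epsilon>" if "prime p" for p k
  proof -
    have p: "real p \<ge> 2" using that by (simp add: prime_ge_2_nat)
    have "real (k + 1) \<le> C1 * (1 + \<epsilon> * real k * ln 2)"
      using assms by (simp add: C1_def field_simps)
    also have "\<dots> \<le> C1 * exp (\<epsilon> * real k * ln 2)"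
      using C1 by (intro mult_left_mono exp_ge_add_one_self) auto
    also have "exp (\<epsilon> * real k * ln 2) = (2 powr real k) powr \<epsilon>"
      by (simp add: powr_def powr_powr mult_ac)
    also have "\<dots> = real (2 ^ k) powr \<epsilon>" by (simp add: powr_realpow)
    also have "C1 * \<dots> \<le> C1 * real (p ^ k) powr \<epsilon>"
      using C1 p assms by (intro mult_left_mono powr_mono2) (auto intro: power_mono)
    finally show ?thesis .
  qed
  have big: "real (k + 1) \<le> real (p ^ k) powr \<epsilon>" if "prime p" "B \<le> real p" for p k
  proof -
    have p: "real p \<ge> 2" using that by (simp add: prime_ge_2_nat)
    have "k + 1 \<le> 2 ^ k" by (induction k) auto
    hence "real (k + 1) \<le> real (2 ^ k)" by (simp only: of_nat_le_iff)
    also have "\<dots> = 2 ^ k" by simp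
    also have "2 = B powr \<epsilon>" using assms by (simp add: B_def powr_powr)
    also have "(B powr \<epsilon>) ^ k \<le> (real p powr \<epsilon>) ^ k"
      using that assms by (intro power_mono powr_mono2) (auto simp: B_def)
    also have "\<dots> = real (p ^ k) powr \<epsilon>"
      using p by (simp add: powr_powr powr_realpow[symmetric] mult_ac)
    finally show ?thesis .
  qed
  have main: "real (tau n) \<le> C1 ^ card {p \<in> prime_factors n. real p < B} * real n powr \<epsilon>" if "n > 0" for n
    using that
  proof (induction n rule: less_induct)
    case (less n)
    show ?case
    proof (cases "n = 1")
      case True
      thus ?thesis using assms by simp
    next
      case False
      then obtain p where p: "prime p" "p dvd n" using prime_factor_nat by blast
      define k where "k = multiplicity p n"
      have np: "\<not> is_unit p" using p(1) by (simp add: prime_nat_iff)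
      obtain m where m: "n = p ^ k * m" "\<not> p dvd m"
        using multiplicity_decompose'[of n p] less.prems np by (auto simp: k_def)
      have m0: "m > 0" using m(1) less.prems by (cases "m = 0") auto
      have k0: "k > 0" using p less.prems by (simp add: k_def prime_multiplicity_gt_zero_iff)
      have "1 < p ^ k" using k0 p(1) by (intro one_less_power) (auto simp: prime_gt_Suc_0_nat)
      hence mn: "m < n" using m(1) m0 by simp
      have pf: "prime_factors n = insert p (prime_factors m)"
        using p(1) m m0 k0 by (auto simp: prime_factors_dvd prime_dvd_mult_iff prime_dvd_power_iff primes_dvd_imp_eq)
      have pm: "p \<notin> prime_factors m" using m(2) by (auto simp: prime_factors_dvd)
      let ?c = "\<lambda>n. card {p \<in> prime_factors n. real p < B}"
      have step: "real (k + 1) * C1 ^ ?c m \<le> C1 ^ ?c n * real (p ^ k) powr \<epsilon>"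
      proof (cases "real p < B")
        case True
        have "{q \<in> prime_factors n. real q < B} = insert p {q \<in> prime_factors m. real q < B}"
          using True pf by auto
        hence "?c n = Suc (?c m)" using pm by simp
        thus ?thesis using mult_right_mono[OF small[OF p(1), of k], of "C1 ^ ?c m"] C1 by (simp add: mult_ac)
      next
        case False
        have "{q \<in> prime_factors n. real q < B} = {q \<in> prime_factors m. real q < B}"
          using False pf by auto
        thus ?thesis using mult_right_mono[OF big[OF p(1), of k], of "C1 ^ ?c m"] C1 False by (simp add: mult_ac)
      qed
      have "tau n \<le> tau (p ^ k) * tau m" unfolding m(1) using m0 p(1) by (intro tau_mult_le) (auto simp: prime_gt_0_nat)
      also have "\<dots> \<le> (k + 1) * tau m" using tau_prime_power_le[OF p(1)] by (intro mult_right_mono) auto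
      finally have "real (tau n) \<le> real ((k + 1) * tau m)" by (simp only: of_nat_le_iff)
      also have "\<dots> = real (k + 1) * real (tau m)" by (simp only: of_nat_mult)
      also have "\<dots> \<le> real (k + 1) * (C1 ^ ?c m * real m powr \<epsilon>)"
        using less.IH[OF mn m0] by (intro mult_left_mono) auto
      also have "\<dots> = (real (k + 1) * C1 ^ ?c m) * real m powr \<epsilon>" by (simp only: mult.assoc)
      also have "\<dots> \<le> (C1 ^ ?c n * real (p ^ k) powr \<epsilon>) * real m powr \<epsilon>"
        using step by (intro mult_right_mono) auto
      also have "\<dots> = C1 ^ ?c n * real n powr \<epsilon>"
        by (subst (3) m(1)) (simp add: powr_mult mult.assoc)
      finally show ?thesis .
    qed
  qed
  have "real (tau n) \<le> C1 ^ nat \<lceil>B\<rceil> * real n powr \<epsilon>" if "n > 0" for n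
  proof -
    have "{p \<in> prime_factors n. real p < B} \<subseteq> {..<nat \<lceil>B\<rceil>}" by auto linarith
    hence "card {p \<in> prime_factors n. real p < B} \<le> card {..<nat \<lceil>B\<rceil>}" by (intro card_mono) auto
    hence "C1 ^ card {p \<in> prime_factors n. real p < B} \<le> C1 ^ nat \<lceil>B\<rceil>"
      using C1 by (intro power_increasing) auto
    hence "C1 ^ card {p \<in> prime_factors n. real p < B} * real n powr \<epsilon> \<le> C1 ^ nat \<lceil>B\<rceil> * real n powr \<epsilon>"
      by (intro mult_right_mono) auto
    thus ?thesis using main[OF that] by linarith
  qed
  moreover have "C1 ^ nat \<lceil>B\<rceil> \<ge> 1" using C1 by (rule one_le_power)
  ultimately show ?thesis by blast
qed

section \<open>Moebius inversion over sets of primes\<close>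

lemma prod_primes_dvd:
  fixes n :: nat
  assumes "finite T" "\<And>p. p \<in> T \<Longrightarrow> prime p \<and> p dvd n"
  shows "\<Prod>T dvd n"
  using assms
proof (induction T rule: finite_induct)
  case (insert p T)
  have "coprime p (\<Prod>T)"
  proof (rule prod_coprime_right)
    fix q assume "q \<in> T"
    thus "coprime p q" using insert by (intro primes_coprime) auto
  qed
  thus ?case using insert by (simp add: divides_mult)
qed simp

lemma sum_Pow_alternating:
  assumes "finite A"
  shows "(\<Sum>T\<in>Pow A. (-1) ^ card T) = (if A = {} then 1 else 0 :: real)"
proof (cases "A = {}")
  case False
  then obtain a B where aB: "A = insert a B" "a \<notin> B" by (meson Set.set_insert ex_in_conv)
  have fB: "finite B" using assms aB by simp
  have "(\<Sum>T\<in>Pow A. (-1) ^ card T) = (\<Sum>T\<in>Pow B. (-1) ^ card T) + (\<Sum>T\<in>insert a ` Pow B. (-1 :: real) ^ card T)"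
    unfolding aB(1) Pow_insert using fB aB(2) by (intro sum.union_disjoint) auto
  also have "(\<Sum>T\<in>insert a ` Pow B. (-1 :: real) ^ card T) = (\<Sum>T\<in>Pow B. (-1) ^ card (insert a T))"
    using aB(2) by (subst sum.reindex) (auto simp: inj_on_def)
  also have "\<dots> = (\<Sum>T\<in>Pow B. - ((-1) ^ card T))"
  proof (intro sum.cong refl)
    fix T assume "T \<in> Pow B"
    hence "a \<notin> T" "finite T" using aB(2) fB by (auto intro: finite_subset)
    thus "(-1 :: real) ^ card (insert a T) = - ((-1) ^ card T)" by simp
  qed
  finally show ?thesis using False by (simp add: sum_negf)
qed simp

text \<open>The convolution of \<open>F\<close> with the Moebius function, written as a sum over sets of primes.\<close>

definition moebius_conv :: "(nat \<Rightarrow> real) \<Rightarrow> nat \<Rightarrow> real" where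
  "moebius_conv F n = (\<Sum>T\<in>Pow (prime_factors n). (-1) ^ card T * F (n div \<Prod>T))"

text \<open>Reorder the pairs (d, T) by e = d / prod T. For fixed e the sets T run through all
  subsets of the primes of n/e, so the alternating sum vanishes unless e = n.\<close>

lemma sum_moebius_conv:
  assumes n: "n > 0"
  shows "(\<Sum>d | d dvd n. moebius_conv F d) = F n"
proof -
  have fin: "finite {d. d dvd n}" using n by simp
  have prT: "finite T \<and> \<Prod>T > 0 \<and> (\<forall>p\<in>T. prime p \<and> p dvd m)" if T: "T \<subseteq> prime_factors m" for T and m :: nat
  proof -
    have "finite T" using T by (rule finite_subset) simp
    moreover have pr: "\<forall>p\<in>T. prime p \<and> p dvd m" using T by auto
    moreover have "\<Prod>T > 0" using pr by (intro prod_pos) (auto simp: prime_gt_0_nat)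
    ultimately show ?thesis by blast
  qed
  have "(\<Sum>d | d dvd n. moebius_conv F d)
      = (\<Sum>(d, T)\<in>Sigma {d. d dvd n} (\<lambda>d. Pow (prime_factors d)). (-1) ^ card T * F (d div \<Prod>T))"
    unfolding moebius_conv_def using fin by (intro sum.Sigma) auto
  also have "\<dots> = (\<Sum>(e, T)\<in>Sigma {d. d dvd n} (\<lambda>e. Pow (prime_factors (n div e))). (-1) ^ card T * F e)"
  proof -
    have div_eq: "d div \<Prod>T * \<Prod>T = d" if "T \<subseteq> prime_factors d" for d :: nat and T
      using prT[OF that] prod_primes_dvd[of T d] by simp
    have fwd: "d div \<Prod>T dvd n \<and> T \<subseteq> prime_factors (n div (d div \<Prod>T))" if dn: "d dvd n" and Td: "T \<subseteq> prime_factors d" for d T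
    proof -
      have T: "finite T" "\<Prod>T > 0" "\<And>p. p \<in> T \<Longrightarrow> prime p \<and> p dvd d" using prT[OF Td] by auto
      obtain c where c: "n = d * c" using dn by auto
      define e where "e = d div \<Prod>T"
      have e: "d = e * \<Prod>T" using div_eq[OF Td] by (simp add: e_def)
      have e0: "e > 0" using c n e by (cases "e = 0") auto
      have ne: "n div e = \<Prod>T * c" using e0 by (simp add: c e mult.assoc)
      have ne0: "n div e \<noteq> 0" using ne n c T(2) by (cases "c = 0") auto
      have "p \<in> prime_factors (n div e)" if "p \<in> T" for p
      proof -
        have "p dvd \<Prod>T" using dvd_prodI[OF T(1) that, of "\<lambda>x. x"] by simp
        thus ?thesis using T(3)[OF that] ne ne0 by (auto simp: in_prime_factors_iff)
      qed
      moreover have "e dvd n" using c e by simp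
      ultimately show ?thesis by (auto simp: e_def)
    qed
    have bwd: "e * \<Prod>T dvd n \<and> T \<subseteq> prime_factors (e * \<Prod>T) \<and> e * \<Prod>T div \<Prod>T = e"
      if "e dvd n" "T \<subseteq> prime_factors (n div e)" for e T
    proof -
      have T: "finite T" "\<Prod>T > 0" "\<And>p. p \<in> T \<Longrightarrow> prime p \<and> p dvd n div e" using prT[OF that(2)] by auto
      have Td: "\<Prod>T dvd n div e" using T by (intro prod_primes_dvd) auto
      have e0: "e > 0" using that n by (auto intro: Nat.gr0I)
      have "e * \<Prod>T dvd e * (n div e)" using Td by simp
      hence "e * \<Prod>T dvd n" using that by simp
      moreover have "p \<in> prime_factors (e * \<Prod>T)" if "p \<in> T" for p
      proof -
        have "p dvd \<Prod>T" using dvd_prodI[OF T(1) that, of "\<lambda>x. x"] by simp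
        thus ?thesis using T(2) T(3)[OF that] e0 by (auto simp: in_prime_factors_iff)
      qed
      ultimately show ?thesis using T(2) by auto
    qed
    define S1 where "S1 = Sigma {d. d dvd n} (\<lambda>d. Pow (prime_factors d))"
    define S2 where "S2 = Sigma {d. d dvd n} (\<lambda>e. Pow (prime_factors (n div e)))"
    have A: "(d div \<Prod>T, T) \<in> S2 \<and> d div \<Prod>T * \<Prod>T = d" if "(d, T) \<in> S1" for d T
    proof -
      have "d dvd n" "T \<subseteq> prime_factors d" using that by (auto simp: S1_def)
      from fwd[OF this] div_eq[OF this(2)] show ?thesis by (simp add: S2_def)
    qed
    have B: "(e * \<Prod>T, T) \<in> S1 \<and> e * \<Prod>T div \<Prod>T = e" if "(e, T) \<in> S2" for e T
    proof -
      have "e dvd n" "T \<subseteq> prime_factors (n div e)" using that by (auto simp: S2_def)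
      from bwd[OF this] show ?thesis by (simp add: S1_def)
    qed
    have "(\<Sum>(d, T)\<in>S1. (-1) ^ card T * F (d div \<Prod>T)) = (\<Sum>(e, T)\<in>S2. (-1) ^ card T * F e)"
    proof (rule sum.reindex_bij_witness[of _ "\<lambda>(e, T). (e * \<Prod>T, T)" "\<lambda>(d, T). (d div \<Prod>T, T)"], goal_cases)
      case (1 z) thus ?case using A[of "fst z" "snd z"] by (cases z) simp
    next
      case (2 z) thus ?case using A[of "fst z" "snd z"] by (cases z) simp
    next
      case (3 z) thus ?case using B[of "fst z" "snd z"] by (cases z) simp
    next
      case (4 z) thus ?case using B[of "fst z" "snd z"] by (cases z) simp
    next
      case (5 z) thus ?case by (cases z) simp
    qed
    thus ?thesis by (simp only: S1_def S2_def)
  qed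
  also have "\<dots> = (\<Sum>e | e dvd n. F e * (\<Sum>T\<in>Pow (prime_factors (n div e)). (-1) ^ card T))"
    using fin by (subst sum.Sigma[symmetric]) (auto simp: sum_distrib_left mult.commute)
  also have "\<dots> = (\<Sum>e | e dvd n. if e = n then F e else 0)"
  proof (intro sum.cong refl)
    fix e assume "e \<in> {e. e dvd n}"
    hence e: "e dvd n" by simp
    hence "prime_factors (n div e) = {} \<longleftrightarrow> e = n"
      using n by (auto simp: prime_factorization_empty_iff dvd_div_eq_0_iff elim!: dvdE)
    thus "F e * (\<Sum>T\<in>Pow (prime_factors (n div e)). (-1) ^ card T) = (if e = n then F e else 0)"
      by (subst sum_Pow_alternating) auto
  qed
  also have "\<dots> = F n" using fin by (simp add: sum.delta)
  finally show ?thesis .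
qed

text \<open>The terms are indexed by sets of primes of n, and by unique factorization the product
  maps these injectively to divisors of n.\<close>

lemma abs_moebius_conv_le_tau:
  assumes n: "n > 0" and F: "\<And>m. \<bar>F m\<bar> \<le> 1"
  shows "\<bar>moebius_conv F n\<bar> \<le> real (tau n)"
proof -
  have "\<bar>moebius_conv F n\<bar> \<le> (\<Sum>T\<in>Pow (prime_factors n). 1)"
    unfolding moebius_conv_def using F by (intro order_trans[OF sum_abs] sum_mono) (auto simp: abs_mult power_abs)
  also have "\<dots> = real (card (Pow (prime_factors n)))" by simp
  also have "card (Pow (prime_factors n)) \<le> tau n"
  proof (rule card_inj_on_le[where f = "\<lambda>T. \<Prod>T"])
    have mem: "p \<in> T \<longleftrightarrow> prime p \<and> p dvd \<Prod>T" if "T \<subseteq> prime_factors n" for p T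
    proof
      have fT: "finite T" using that by (rule finite_subset) simp
      show "prime p \<and> p dvd \<Prod>T" if "p \<in> T"
      proof
        show "prime p" using that \<open>T \<subseteq> prime_factors n\<close> by auto
        show "p dvd \<Prod>T" using dvd_prodI[OF fT that, of "\<lambda>x. x"] by simp
      qed
      assume p: "prime p \<and> p dvd \<Prod>T"
      then obtain q where q: "q \<in> T" "p dvd q" using fT by (auto simp: prime_dvd_prod_iff)
      have "prime q" using q(1) that by auto
      hence "p = q" using p q(2) by (intro primes_dvd_imp_eq) auto
      thus "p \<in> T" using q by simp
    qed
    show "inj_on (\<lambda>T. \<Prod>T) (Pow (prime_factors n))"
    proof (rule inj_onI)
      fix T T' assume "T \<in> Pow (prime_factors n)" "T' \<in> Pow (prime_factors n)" "\<Prod>T = \<Prod>T'"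
      hence "p \<in> T \<longleftrightarrow> p \<in> T'" for p using mem[of T p] mem[of T' p] by simp
      thus "T = T'" by blast
    qed
    show "(\<lambda>T. \<Prod>T) ` Pow (prime_factors n) \<subseteq> {d. d dvd n}"
    proof (intro image_subsetI CollectI prod_primes_dvd)
      fix T p assume T: "T \<in> Pow (prime_factors n)"
      thus "finite T" by (intro finite_subset[OF _ finite_set_mset]) auto
      show "prime p \<and> p dvd n" if "p \<in> T" using T that by auto
    qed
    show "finite {d. d dvd n}" using n by simp
  qed
  finally show ?thesis by simp
qed

section \<open>Support on powerful numbers\<close>

definition powerful :: "nat \<Rightarrow> nat \<Rightarrow> bool" where
  "powerful r n \<longleftrightarrow> (\<forall>p. prime p \<longrightarrow> p dvd n \<longrightarrow> p ^ r dvd n)"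

text \<open>Let n = p^k m with 0 < k < r and p not dividing m. Summing the convolution over the
  divisors of n gives F(n) = F(m), and the divisors of m alone already contribute F(m). The
  remaining divisors are multiples of p but not of p^r, so by induction all but n contribute 0, and
  then n does as well.\<close>

lemma moebius_conv_eq_0:
  assumes F: "\<And>p e m. prime p \<Longrightarrow> e < r \<Longrightarrow> m > 0 \<Longrightarrow> \<not> p dvd m \<Longrightarrow> F (p ^ e * m) = F m"
    and "n > 0" "\<not> powerful r n"
  shows "moebius_conv F n = 0"
proof -
  obtain p where p: "prime p" "p dvd n" "\<not> p ^ r dvd n" using assms by (auto simp: powerful_def)
  have "moebius_conv F n = 0" if "n > 0" "p dvd n" "\<not> p ^ r dvd n" for n
    using that
  proof (induction n rule: less_induct)
    case (less n)
    define k where "k = multiplicity p n"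
    have np: "\<not> is_unit p" using p(1) by (simp add: prime_nat_iff)
    obtain m where m: "n = p ^ k * m" "\<not> p dvd m"
      using multiplicity_decompose'[of n p] less.prems np by (auto simp: k_def)
    have m0: "m > 0" using m(1) less.prems by (cases "m = 0") auto
    have kr: "k < r"
    proof (rule ccontr)
      assume "\<not> k < r"
      hence "p ^ r dvd p ^ k" by (intro le_imp_power_dvd) auto
      thus False using less.prems m(1) by auto
    qed
    have fin: "finite {d. d dvd n}" using less.prems by simp
    have split: "{d. d dvd n} = {d. d dvd m} \<union> insert n {d. d dvd n \<and> p dvd d \<and> d \<noteq> n}"
    proof -
      have A: "d dvd m" if "d dvd n" "\<not> p dvd d" for d
      proof -
        have "coprime d (p ^ k)" using prime_imp_coprime[OF p(1) that(2)] by (simp add: coprime_commute)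
        moreover have "d dvd p ^ k * m" using that(1) m(1) by metis
        ultimately show ?thesis by (simp add: coprime_dvd_mult_right_iff)
      qed
      have "m dvd p ^ k * m" by (rule dvd_triv_right)
      hence mn: "m dvd n" by (simp only: m(1)[symmetric])
      show ?thesis
      proof (intro set_eqI iffI)
        fix d assume "d \<in> {d. d dvd n}"
        thus "d \<in> {d. d dvd m} \<union> insert n {d. d dvd n \<and> p dvd d \<and> d \<noteq> n}" using A[of d] by blast
      next
        fix d assume "d \<in> {d. d dvd m} \<union> insert n {d. d dvd n \<and> p dvd d \<and> d \<noteq> n}"
        thus "d \<in> {d. d dvd n}" using dvd_trans[OF _ mn, of d] by auto
      qed
    qed
    have "F n = (\<Sum>d | d dvd n. moebius_conv F d)" using less.prems by (simp add: sum_moebius_conv)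
    also have "\<dots> = (\<Sum>d | d dvd m. moebius_conv F d) + (\<Sum>d\<in>insert n {d. d dvd n \<and> p dvd d \<and> d \<noteq> n}. moebius_conv F d)"
      unfolding split
    proof (rule sum.union_disjoint)
      show "finite {d. d dvd m}" using m0 by simp
      show "finite (insert n {d. d dvd n \<and> p dvd d \<and> d \<noteq> n})" using fin by simp
      have "\<not> p dvd d" if "d dvd m" for d
      proof
        assume "p dvd d"
        from dvd_trans[OF this that] show False using m(2) by contradiction
      qed
      thus "{d. d dvd m} \<inter> insert n {d. d dvd n \<and> p dvd d \<and> d \<noteq> n} = {}" using less.prems(2) by blast
    qed
    also have "(\<Sum>d | d dvd m. moebius_conv F d) = F m" using m0 by (rule sum_moebius_conv)
    also have "F m = F n" using F[OF p(1) kr m0 m(2)] by (simp only: m(1)[symmetric])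
    also have "(\<Sum>d\<in>insert n {d. d dvd n \<and> p dvd d \<and> d \<noteq> n}. moebius_conv F d)
        = moebius_conv F n + (\<Sum>d | d dvd n \<and> p dvd d \<and> d \<noteq> n. moebius_conv F d)"
      using fin by (subst sum.insert) auto
    also have "(\<Sum>d | d dvd n \<and> p dvd d \<and> d \<noteq> n. moebius_conv F d) = 0"
    proof (intro sum.neutral ballI)
      fix d assume "d \<in> {d. d dvd n \<and> p dvd d \<and> d \<noteq> n}"
      hence d: "d dvd n" "p dvd d" "d \<noteq> n" by auto
      have "d \<le> n" "d > 0" using d less.prems by (auto intro: dvd_imp_le Nat.gr0I)
      moreover have "\<not> p ^ r dvd d" using less.prems(3) dvd_trans[OF _ d(1), of "p ^ r"] by blast
      ultimately show "moebius_conv F d = 0" using d by (intro less.IH) auto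
    qed
    finally show ?case by simp
  qed
  thus ?thesis using p assms by blast
qed

text \<open>Take v maximal with v^r dividing n. Maximality makes the cofactor w free of r-th powers
  of primes. A prime of w that missed v would occur in n through w only, hence to a power below r,
  against r-fullness.\<close>

lemma powerful_decompose:
  assumes "n > 0" "powerful r n" "r \<ge> 1"
  obtains v w where "n = v ^ r * w" "w dvd v ^ (r - 1)" "v > 0"
proof -
  define V where "V = {v. v ^ r dvd n}"
  have "V \<subseteq> {..n}"
  proof
    fix v assume "v \<in> V"
    hence "v ^ r dvd n" by (simp add: V_def)
    hence "v ^ r \<le> n" using assms by (intro dvd_imp_le) auto
    moreover have "v \<le> v ^ r" using assms by (cases "v = 0") (auto intro: self_le_power)
    ultimately show "v \<in> {..n}" by simp
  qed
  hence fV: "finite V" by (rule finite_subset) simp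
  have V1: "1 \<in> V" by (simp add: V_def)
  define v where "v = Max V"
  have vV: "v \<in> V" unfolding v_def using fV V1 by (intro Max_in) auto
  have v1: "v \<ge> 1" unfolding v_def using fV V1 by (intro Max_ge) auto
  obtain w where w: "n = v ^ r * w" using vV by (auto simp: V_def)
  have w0: "w > 0" using w assms by (cases "w = 0") auto
  have nr: "\<not> p ^ r dvd w" if "prime p" for p
  proof
    assume "p ^ r dvd w"
    hence "(v * p) ^ r dvd n" unfolding w by (simp add: power_mult_distrib)
    hence "v * p \<le> v" unfolding v_def using fV by (intro Max_ge) (auto simp: V_def)
    thus False using v1 that prime_gt_1_nat[of p] by simp
  qed
  have "w dvd v ^ (r - 1)"
  proof (rule multiplicity_le_imp_dvd)
    fix p :: nat assume p: "prime p"
    show "multiplicity p w \<le> multiplicity p (v ^ (r - 1))"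
    proof (cases "p dvd w")
      case True
      have a: "multiplicity p w \<le> r - 1"
      proof (rule ccontr)
        assume "\<not> multiplicity p w \<le> r - 1"
        hence "r \<le> multiplicity p w" by simp
        hence "p ^ r dvd w" by (rule multiplicity_dvd')
        thus False using nr[OF p] by simp
      qed
      have "p dvd v"
      proof (rule ccontr)
        assume nv: "\<not> p dvd v"
        have "p ^ r dvd v ^ r * w" using assms(2) p True w by (auto simp: powerful_def)
        moreover have "coprime (p ^ r) (v ^ r)" using nv p by (simp add: prime_imp_coprime_nat)
        ultimately have "p ^ r dvd w" by (simp add: coprime_dvd_mult_right_iff)
        thus False using nr[OF p] by simp
      qed
      hence "p ^ (r - 1) dvd v ^ (r - 1)" by (rule dvd_power_same)
      hence "r - 1 \<le> multiplicity p (v ^ (r - 1))"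
        using v1 p by (intro multiplicity_geI) (auto simp: prime_nat_iff)
      thus ?thesis using a by simp
    qed (simp add: not_dvd_imp_multiplicity_0)
  qed (use w0 in auto)
  thus ?thesis using that w v1 by auto
qed

section \<open>Multiples of large powers in short intervals\<close>

lemma card_nat_interval:
  fixes a b :: real
  assumes "0 \<le> a" "a \<le> b"
  shows "finite {k::nat. a < real k \<and> real k \<le> b}" "real (card {k::nat. a < real k \<and> real k \<le> b}) = real_of_int (\<lfloor>b\<rfloor> - \<lfloor>a\<rfloor>)"
proof -
  have eq: "{k::nat. a < real k \<and> real k \<le> b} = {nat \<lfloor>a\<rfloor><..nat \<lfloor>b\<rfloor>}"
  proof (intro set_eqI)
    fix k :: nat
    have "real k \<le> b \<longleftrightarrow> k \<le> nat \<lfloor>b\<rfloor>" "real k \<le> a \<longleftrightarrow> k \<le> nat \<lfloor>a\<rfloor>"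
      using assms by (auto simp: le_nat_iff le_floor_iff)
    thus "k \<in> {k. a < real k \<and> real k \<le> b} \<longleftrightarrow> k \<in> {nat \<lfloor>a\<rfloor><..nat \<lfloor>b\<rfloor>}"
      by (simp only: mem_Collect_eq greaterThanAtMost_iff not_le[symmetric])
  qed
  show "finite {k::nat. a < real k \<and> real k \<le> b}" unfolding eq by simp
  have "\<lfloor>a\<rfloor> \<le> \<lfloor>b\<rfloor>" "0 \<le> \<lfloor>a\<rfloor>" "0 \<le> \<lfloor>b\<rfloor>" using assms by (auto intro: floor_mono)
  thus "real (card {k::nat. a < real k \<and> real k \<le> b}) = real_of_int (\<lfloor>b\<rfloor> - \<lfloor>a\<rfloor>)"
    unfolding eq by simp
qed

text \<open>The third claim has no additive error: from the origin the count is a plain floor. This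
  lets the density be handled without information on short intervals.\<close>

lemma card_multiples_interval:
  fixes x y :: real and d :: nat
  assumes "0 \<le> x" "0 \<le> y" "d > 0"
  shows "finite {n::nat. x < real n \<and> real n \<le> x + y \<and> d dvd n}"
    and "\<bar>real (card {n::nat. x < real n \<and> real n \<le> x + y \<and> d dvd n}) - y / real d\<bar> \<le> 1"
    and "x = 0 \<Longrightarrow> real (card {n::nat. x < real n \<and> real n \<le> x + y \<and> d dvd n}) \<le> y / real d"
proof -
  let ?A = "{n::nat. x < real n \<and> real n \<le> x + y \<and> d dvd n}"
  let ?B = "{k::nat. x / d < real k \<and> real k \<le> (x + y) / d}"
  have eq: "?A = (\<lambda>k. d * k) ` ?B"
  proof (intro set_eqI iffI)
    fix n assume "n \<in> ?A"
    hence n: "x < real n" "real n \<le> x + y" "d dvd n" by auto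
    obtain k where k: "n = d * k" using n(3) by auto
    have "k \<in> ?B" using n(1,2) assms(3) by (simp add: k pos_divide_less_eq pos_le_divide_eq mult.commute)
    thus "n \<in> (\<lambda>k. d * k) ` ?B" unfolding k by (rule imageI)
  next
    fix n assume "n \<in> (\<lambda>k. d * k) ` ?B"
    then obtain k where k: "n = d * k" "x / d < real k" "real k \<le> (x + y) / d" by auto
    thus "n \<in> ?A" using assms(3) by (simp add: pos_divide_less_eq pos_le_divide_eq mult.commute)
  qed
  have le: "0 \<le> x / d" "x / d \<le> (x + y) / d" using assms by (auto intro: divide_right_mono)
  show "finite ?A" unfolding eq by (intro finite_imageI card_nat_interval le)
  have "card ?A = card ?B" unfolding eq using assms by (intro card_image) (auto simp: inj_on_def)
  hence c: "real (card ?A) = real_of_int (\<lfloor>(x + y) / d\<rfloor> - \<lfloor>x / d\<rfloor>)" using card_nat_interval[OF le] by simp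
  have "(x + y) / d = x / d + y / d" by (simp add: add_divide_distrib)
  thus "\<bar>real (card ?A) - y / real d\<bar> \<le> 1" unfolding c by linarith
  show "real (card ?A) \<le> y / real d" if "x = 0" unfolding c using that by simp
qed

lemma dyadic_exponent:
  fixes t :: real
  assumes "t > 1"
  shows "\<exists>i::nat. 2 ^ i < t \<and> t \<le> 2 ^ (i + 1)"
proof -
  obtain n where n: "t < 2 ^ n" using real_arch_pow[of 2 t] by auto
  define k where "k = (LEAST k. t \<le> 2 ^ k)"
  have k: "t \<le> 2 ^ k" unfolding k_def using LeastI[of "\<lambda>k. t \<le> 2 ^ k" n] n by simp
  hence "k \<noteq> 0" using assms by (intro notI) simp
  then obtain i where i: "k = Suc i" by (cases k) auto
  have "\<not> t \<le> 2 ^ i" using not_less_Least[of i "\<lambda>k. t \<le> 2 ^ k"] i by (simp add: k_def)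
  thus ?thesis using k i by (intro exI[of _ i]) auto
qed

text \<open>Split v > U dyadically. Each v has at most y/v^r + 1 multiples of v^r in the interval;
  the first part sums to O(y/U) per range because v^r >= v^2, and the second is the number of
  admissible v, bounded by the dyadic result. The number of ranges is the fifth logarithm.\<close>

lemma power_multiple_count_short:
  assumes r: "r \<ge> (2::nat)"
  shows "\<exists>C0\<ge>1. \<exists>C\<ge>0. \<forall>x y U :: real. x \<ge> 1 \<longrightarrow> y > 0 \<longrightarrow> U \<ge> 1 \<longrightarrow> C0 * y ^ (2 * r) \<le> x \<longrightarrow> x \<le> y ^ (2 * r + 1) \<longrightarrow>
    real (card {n::nat. x < real n \<and> real n \<le> x + y \<and> (\<exists>v. U < real v \<and> v ^ r dvd n)})
      \<le> C * (1 + ln x) ^ 5 * ((x * y) powr (1 / (2 * real r + 2)) + y / U)"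
proof -
  obtain C0 C where C0: "C0 \<ge> 1" and C: "C \<ge> 0" and main: "\<And>x y N D :: real. x \<ge> 1 \<Longrightarrow> C0 * y ^ (2 * r) \<le> x \<Longrightarrow> x \<le> y ^ (2 * r + 1) \<Longrightarrow> N > 0 \<Longrightarrow> y > 0 \<Longrightarrow>
    D \<ge> 1 \<Longrightarrow> D ^ (2 * r + 2) = x * y \<Longrightarrow>
    real (card {u::nat. N < real u \<and> real u \<le> 2 * N \<and> (\<exists>m::nat. x < real u ^ r * real m \<and> real u ^ r * real m \<le> x + y)})
      \<le> C * (1 + ln x) ^ 4 * D"
    using card_near_multiples_dyadic[OF r] by blast
  define C' where "C' = 3 * (C + 2)"
  show ?thesis
  proof (rule exI[of _ C0], rule conjI[OF C0], rule exI[of _ C'], rule conjI, goal_cases)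
    case 1 show ?case using C by (simp add: C'_def)
  next
    case 2
    show ?case
    proof (intro allI impI)
      fix x y U :: real
      assume x: "x \<ge> 1" and y: "y > 0" and U: "U \<ge> 1" and c1: "C0 * y ^ (2 * r) \<le> x" and c2: "x \<le> y ^ (2 * r + 1)"
      have y1: "y \<ge> 1"
      proof (rule ccontr)
        assume "\<not> 1 \<le> y"
        hence "y ^ (2 * r + 1) < 1" using power_Suc_less_one[of y "2 * r"] y by simp
        thus False using x c2 by simp
      qed
      have yx: "y \<le> x"
      proof -
        have "1 * y ^ 1 \<le> C0 * y ^ (2 * r)" using C0 y1 r by (intro mult_mono power_increasing) auto
        thus ?thesis using c1 by simp
      qed
      have xy1: "1 \<le> x * y" using mult_mono[of 1 x 1 y] x y1 by simp
      define D where "D = (x * y) powr (1 / (2 * real r + 2))"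
      have D1: "D \<ge> 1" unfolding D_def using xy1 by (intro ge_one_powr_ge_zero) auto
      have D2: "D ^ (2 * r + 2) = x * y"
      proof -
        have "D ^ (2 * r + 2) = D powr real (2 * r + 2)" using D1 by (intro powr_realpow[symmetric]) simp
        also have "\<dots> = (x * y) powr (1 / (2 * real r + 2) * real (2 * r + 2))" by (simp only: D_def powr_powr)
        also have "1 / (2 * real r + 2) * real (2 * r + 2) = 1" by simp
        finally show ?thesis using xy1 by simp
      qed
      \<comment> \<open>From v <= v^r <= n <= x + y <= 2x and U >= 1, only ranges with 2^i < 2x can
        occur.\<close>
      define L where "L = nat \<lceil>log 2 (2 * x)\<rceil>"
      have L: "2 * x \<le> 2 ^ L"
      proof -
        have "log 2 (2 * x) \<le> real L" unfolding L_def by linarith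
        hence "2 * x \<le> 2 powr real L" using x by (simp add: log_le_iff)
        thus ?thesis by (simp add: powr_realpow)
      qed
      have lx: "ln x \<ge> 0" using x by simp
      have L2: "real L \<le> 3 * (1 + ln x)"
      proof -
        have "1 / 2 \<le> ln (2::real)" using ln_le_minus_one[of "1 / 2 :: real"] by (simp add: ln_div)
        hence "ln x / ln 2 \<le> ln x / (1 / 2)" using lx by (intro divide_left_mono) auto
        hence 1: "log 2 x \<le> 2 * ln x" by (simp add: log_def)
        have "log 2 (2 * x) = 1 + log 2 x" using x by (simp add: log_mult)
        moreover have "0 \<le> log 2 x" using x by simp
        ultimately have "real L \<le> (1 + log 2 x) + 1" unfolding L_def by linarith
        with 1 have "real L \<le> 2 + 2 * ln x" by simp
        thus ?thesis using lx by (simp add: distrib_left)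
      qed
      define S where "S i = {u::nat. U * 2 ^ i < real u \<and> real u \<le> 2 * (U * 2 ^ i) \<and> (\<exists>m::nat. x < real u ^ r * real m \<and> real u ^ r * real m \<le> x + y)}" for i
      define M where "M v = {n::nat. x < real n \<and> real n \<le> x + y \<and> v ^ r dvd n}" for v
      have Ni: "U * 2 ^ i \<ge> U" "U * 2 ^ i \<ge> 1" for i
      proof -
        have "U * 1 \<le> U * 2 ^ i" using U by (intro mult_left_mono) auto
        thus "U * 2 ^ i \<ge> U" by simp
        thus "U * 2 ^ i \<ge> 1" using U by linarith
      qed
      have sub: "S i \<subseteq> {1..nat \<lfloor>2 * (U * 2 ^ i)\<rfloor>}" for i
      proof
        fix u assume "u \<in> S i"
        hence "U * 2 ^ i < real u" "real u \<le> 2 * (U * 2 ^ i)" by (auto simp: S_def)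
        moreover from this have "u \<ge> 1" using Ni[of i] by linarith
        ultimately show "u \<in> {1..nat \<lfloor>2 * (U * 2 ^ i)\<rfloor>}" by (auto intro: le_nat_floor)
      qed
      have finS: "finite (S i)" for i using sub[of i] by (rule finite_subset) simp
      have cS: "real (card (S i)) \<le> 2 * (U * 2 ^ i)" for i
      proof -
        have "card (S i) \<le> card {1..nat \<lfloor>2 * (U * 2 ^ i)\<rfloor>}" using sub[of i] by (intro card_mono) auto
        hence "real (card (S i)) \<le> real (nat \<lfloor>2 * (U * 2 ^ i)\<rfloor>)" by simp
        also have "\<dots> \<le> 2 * (U * 2 ^ i)" using Ni[of i] by simp
        finally show ?thesis .
      qed
      have finM: "finite (M v)" if "v > 0" for v
        unfolding M_def using card_multiples_interval(1)[of x y "v ^ r"] that x y by simp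
      have vpos: "v > 0" if "v \<in> S i" for v i using sub[of i] that by auto
      let ?B = "{n::nat. x < real n \<and> real n \<le> x + y \<and> (\<exists>v. U < real v \<and> v ^ r dvd n)}"
      have "?B \<subseteq> (\<Union>i\<in>{..<L}. \<Union>v\<in>S i. M v)"
      proof
        fix n assume n: "n \<in> ?B"
        then obtain v where v: "U < real v" "v ^ r dvd n" by auto
        obtain m where m: "n = v ^ r * m" using v(2) by auto
        have n0: "n > 0" using n x by (cases "n = 0") auto
        have "v \<le> v ^ r" using v(1) U r by (intro self_le_power) (auto simp: Suc_le_eq intro!: Nat.gr0I)
        also have "\<dots> \<le> n" using v(2) n0 by (intro dvd_imp_le)
        finally have "real v \<le> real n" by simp
        hence v2: "real v \<le> 2 * x" using n yx by auto
        have "real v / U > 1" using v(1) U by simp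
        then obtain i where i: "2 ^ i < real v / U" "real v / U \<le> 2 ^ (i + 1)" using dyadic_exponent by blast
        have "real v / U \<le> real v" using U by (simp add: divide_le_eq mult_le_cancel_left1)
        hence "(2::real) ^ i < 2 ^ L" using i(1) v2 L by linarith
        hence iL: "i < L" by simp
        have "U * 2 ^ i < real v" "real v \<le> 2 * (U * 2 ^ i)" using i U by (auto simp: field_simps)
        moreover have "x < real v ^ r * real m" "real v ^ r * real m \<le> x + y" using n by (auto simp: m)
        ultimately have "v \<in> S i" by (auto simp: S_def)
        moreover have "n \<in> M v" using n v(2) by (simp add: M_def)
        ultimately show "n \<in> (\<Union>i\<in>{..<L}. \<Union>v\<in>S i. M v)" using iL by auto
      qed
      moreover have "finite (\<Union>i\<in>{..<L}. \<Union>v\<in>S i. M v)" using finS finM vpos by blast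
      ultimately have "card ?B \<le> card (\<Union>i\<in>{..<L}. \<Union>v\<in>S i. M v)" by (rule card_mono[rotated])
      also have "\<dots> \<le> (\<Sum>i<L. card (\<Union>v\<in>S i. M v))" by (intro card_UN_le) simp
      also have "\<dots> \<le> (\<Sum>i<L. \<Sum>v\<in>S i. card (M v))" by (intro sum_mono card_UN_le finS)
      finally have "real (card ?B) \<le> (\<Sum>i<L. \<Sum>v\<in>S i. real (card (M v)))" by (simp flip: of_nat_sum)
      also have "\<dots> \<le> (\<Sum>i<L. C * (1 + ln x) ^ 4 * D + 2 * y / U)"
      proof (intro sum_mono)
        fix i
        define N where "N = U * 2 ^ i"
        have N: "N \<ge> 1" "N \<ge> U" using Ni[of i] by (auto simp: N_def)
        have "(\<Sum>v\<in>S i. real (card (M v))) \<le> (\<Sum>v\<in>S i. y / N ^ 2 + 1)"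
        proof (intro sum_mono)
          fix v assume v: "v \<in> S i"
          have Nv: "N < real v" using v by (simp add: S_def N_def)
          have "N ^ 2 \<le> N ^ r" using N r by (intro power_increasing) auto
          also have "\<dots> \<le> real v ^ r" using Nv N by (intro power_mono) auto
          finally have "y / real v ^ r \<le> y / N ^ 2" using y N Nv by (intro divide_left_mono) auto
          moreover have "\<bar>real (card (M v)) - y / real (v ^ r)\<bar> \<le> 1"
            unfolding M_def using x y vpos[OF v] by (intro card_multiples_interval(2)) auto
          ultimately show "real (card (M v)) \<le> y / N ^ 2 + 1" by simp
        qed
        also have "\<dots> = real (card (S i)) * (y / N ^ 2) + real (card (S i))" by (simp add: algebra_simps)
        also have "\<dots> \<le> 2 * N * (y / N ^ 2) + C * (1 + ln x) ^ 4 * D"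
        proof (intro add_mono mult_right_mono)
          show "real (card (S i)) \<le> 2 * N" using cS[of i] by (simp add: N_def)
          show "real (card (S i)) \<le> C * (1 + ln x) ^ 4 * D"
            unfolding S_def using N by (intro main x c1 c2 y D1 D2) (auto simp: N_def)
        qed (use y in auto)
        also have "2 * N * (y / N ^ 2) = 2 * y / N" using N by (simp add: power2_eq_square)
        also have "2 * y / N \<le> 2 * y / U" using N U y by (intro divide_left_mono) auto
        finally show "(\<Sum>v\<in>S i. real (card (M v))) \<le> C * (1 + ln x) ^ 4 * D + 2 * y / U" by linarith
      qed
      also have "\<dots> = real L * (C * (1 + ln x) ^ 4 * D + 2 * y / U)" by simp
      also have "\<dots> \<le> (3 * (1 + ln x)) * ((C + 2) * (1 + ln x) ^ 4 * (D + y / U))"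
      proof (intro mult_mono L2)
        have l4: "1 \<le> (1 + ln x) ^ 4" using lx by (intro one_le_power) simp
        have "C * (1 + ln x) ^ 4 * D \<le> (C + 2) * (1 + ln x) ^ 4 * D"
          using C l4 D1 by (intro mult_right_mono) auto
        moreover have "2 * 1 * (y / U) \<le> (C + 2) * (1 + ln x) ^ 4 * (y / U)"
          using C l4 y U by (intro mult_right_mono mult_mono) auto
        ultimately show "C * (1 + ln x) ^ 4 * D + 2 * y / U \<le> (C + 2) * (1 + ln x) ^ 4 * (D + y / U)"
          by (simp add: distrib_left)
        show "0 \<le> C * (1 + ln x) ^ 4 * D + 2 * y / U"
          using C l4 D1 y U by (intro add_nonneg_nonneg mult_nonneg_nonneg) auto
      qed (use lx in auto)
      also have "\<dots> = C' * (1 + ln x) ^ 5 * (D + y / U)"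
      proof -
        have "w ^ 5 = w * w ^ 4" for w :: real by (simp flip: power_Suc)
        thus ?thesis by (simp only: C'_def mult_ac)
      qed
      finally show "real (card ?B) \<le> C' * (1 + ln x) ^ 5 * ((x * y) powr (1 / (2 * real r + 2)) + y / U)"
        by (simp only: D_def)
    qed
  qed
qed

text \<open>\<open>\<tau>\<close> is the midpoint of 1/(2R+1) and 1/(2R), the exponents between
  which the short interval bound is valid. The first two identities give the slack at the two ends;
  the third gives the saving over the length x^\<tau>.\<close>

lemma exponent_identities:
  fixes R :: real
  assumes "R > 0"
  defines "\<tau> \<equiv> (4 * R + 1) / (4 * R * (2 * R + 1))"
  shows "1 / (4 * R + 2) + \<tau> * (2 * R) = 1" "1 / (4 * R) + 1 = \<tau> * (2 * R + 1)"
    "(1 + \<tau>) * (1 / (2 * R + 2)) = \<tau> - 1 / (8 * R * (R + 1))"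
proof -
  have nz: "R \<noteq> 0" "2 * R + 1 \<noteq> 0" "4 * R + 2 = 2 * (2 * R + 1)" "2 * R + 2 = 2 * (R + 1)" "R + 1 \<noteq> 0" using assms by auto
  show "1 / (4 * R + 2) + \<tau> * (2 * R) = 1"
    unfolding \<tau>_def nz(3) using nz(1,2) by (simp add: divide_simps) (simp add: algebra_simps)
  show "1 / (4 * R) + 1 = \<tau> * (2 * R + 1)"
    unfolding \<tau>_def using nz(1,2) by (simp add: divide_simps)
  show "(1 + \<tau>) * (1 / (2 * R + 2)) = \<tau> - 1 / (8 * R * (R + 1))"
    unfolding \<tau>_def nz(4) using nz(1,2,5) by (simp add: divide_simps) (simp add: algebra_simps)
qed
text \<open>Intervals longer than y0 = x^\<tau> are cut into pieces of length y0, each counted with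
  a saving x^(-1/(8r(r+1))) over its length. This produces the term proportional to y.\<close>

lemma power_multiple_count:
  assumes r: "r \<ge> (2::nat)"
  shows "\<exists>x0\<ge>1. \<exists>C\<ge>0. \<forall>x y U :: real. x \<ge> x0 \<longrightarrow> x powr (1 / (2 * real r + 1)) \<le> y \<longrightarrow> y \<le> x \<longrightarrow> U \<ge> 1 \<longrightarrow>
    real (card {n::nat. x < real n \<and> real n \<le> x + y \<and> (\<exists>v. U < real v \<and> v ^ r dvd n)})
      \<le> C * (1 + ln x) ^ 5 * ((x * y) powr (1 / (2 * real r + 2)) + y * x powr (- (1 / (8 * real r * (real r + 1)))) + y / U)"
proof -
  obtain C0 C where C0: "C0 \<ge> 1" and C: "C \<ge> 0" and main: "\<And>x y U :: real. x \<ge> 1 \<Longrightarrow> y > 0 \<Longrightarrow> U \<ge> 1 \<Longrightarrow> C0 * y ^ (2 * r) \<le> x \<Longrightarrow> x \<le> y ^ (2 * r + 1) \<Longrightarrow>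
    real (card {n::nat. x < real n \<and> real n \<le> x + y \<and> (\<exists>v. U < real v \<and> v ^ r dvd n)})
      \<le> C * (1 + ln x) ^ 5 * ((x * y) powr (1 / (2 * real r + 2)) + y / U)"
    using power_multiple_count_short[OF r] by blast
  \<comment> \<open>Beyond x0 the constant C0 is at most x^(1/(4r+2)) and 2 is at most x^(1/(4r)),
    which is the slack available for y0.\<close>
  define x0 where "x0 = max (C0 ^ (4 * r + 2)) (2 ^ (4 * r))"
  define C' where "C' = 128 * C"
  have rr: "real r \<ge> 2" using r by simp
  have x0: "x0 \<ge> 1" using C0 by (simp add: x0_def le_max_iff_disj one_le_power)
  show ?thesis
  proof (rule exI[of _ x0], rule conjI[OF x0], rule exI[of _ C'], rule conjI, goal_cases)
    case 1 show ?case using C by (simp add: C'_def)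
  next
    case 2
    show ?case
    proof (intro allI impI)
      fix x y U :: real
      assume xx0: "x \<ge> x0" and yl: "x powr (1 / (2 * real r + 1)) \<le> y" and yx: "y \<le> x" and U: "U \<ge> 1"
      let ?B = "\<lambda>x y. {n::nat. x < real n \<and> real n \<le> x + y \<and> (\<exists>v. U < real v \<and> v ^ r dvd n)}"
      define \<delta> where "\<delta> = 1 / (8 * real r * (real r + 1))"
      define \<tau> where "\<tau> = (4 * real r + 1) / (4 * real r * (2 * real r + 1))"
      define y0 where "y0 = x powr \<tau>"
      have x1: "x \<ge> 1" using xx0 x0 by simp
      have y1: "y \<ge> 1"
      proof -
        have "1 \<le> x powr (1 / (2 * real r + 1))" using x1 by (intro ge_one_powr_ge_zero) auto
        thus ?thesis using yl by simp
      qed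
      have lx: "0 \<le> ln x" using x1 by simp
      have l5: "0 \<le> (1 + ln x) ^ 5" using lx by simp
      have pw: "(x powr a) ^ n = x powr (a * real n)" for a n
        using x1 by (simp add: powr_realpow[symmetric] powr_powr)
      have y0: "y0 \<ge> 1" unfolding y0_def using x1 by (intro ge_one_powr_ge_zero) (auto simp: \<tau>_def)
      have c1: "C0 * y0 ^ (2 * r) \<le> x"
      proof -
        have "C0 = (C0 ^ (4 * r + 2)) powr (1 / real (4 * r + 2))"
          using C0 by (subst powr_realpow[symmetric]) (auto simp: powr_powr)
        also have "\<dots> \<le> x powr (1 / real (4 * r + 2))"
          using xx0 C0 by (intro powr_mono2) (auto simp: x0_def)
        finally have "C0 * y0 ^ (2 * r) \<le> x powr (1 / real (4 * r + 2)) * x powr (\<tau> * real (2 * r))"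
          unfolding y0_def pw by (intro mult_right_mono) auto
        also have "\<dots> = x powr (1 / real (4 * r + 2) + \<tau> * real (2 * r))" by (simp only: powr_add)
        also have "1 / real (4 * r + 2) + \<tau> * real (2 * r) = 1"
          using exponent_identities(1)[of "real r"] rr by (simp add: \<tau>_def add_ac)
        finally show ?thesis using x1 by simp
      qed
      \<comment> \<open>The factor 2 is needed because the pieces start at points up to 2x.\<close>
      have c2: "2 * x \<le> y0 ^ (2 * r + 1)"
      proof -
        have "2 = ((2::real) ^ (4 * r)) powr (1 / real (4 * r))"
          using r by (subst powr_realpow[symmetric]) (auto simp: powr_powr)
        also have "\<dots> \<le> x powr (1 / real (4 * r))"
          using xx0 by (intro powr_mono2) (auto simp: x0_def)
        finally have "2 * x \<le> x powr (1 / real (4 * r)) * x powr 1"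
          using x1 by (simp add: mult_right_mono)
        also have "\<dots> = x powr (1 / real (4 * r) + 1)" by (simp only: powr_add)
        also have "1 / real (4 * r) + 1 = \<tau> * real (2 * r + 1)"
          using exponent_identities(2)[of "real r"] rr by (simp add: \<tau>_def add_ac)
        finally show ?thesis unfolding y0_def pw .
      qed
      have "real (card (?B x y)) \<le> C' * (1 + ln x) ^ 5 * ((x * y) powr (1 / (2 * real r + 2)) + y * x powr (- \<delta>) + y / U)"
      proof (cases "y \<le> y0")
        case True
        have "C0 * y ^ (2 * r) \<le> C0 * y0 ^ (2 * r)" using True y1 C0 by (intro mult_left_mono power_mono) auto
        hence "C0 * y ^ (2 * r) \<le> x" using c1 by linarith
        moreover have "x \<le> y ^ (2 * r + 1)"
        proof -
          have "x = (x powr (1 / (2 * real r + 1))) ^ (2 * r + 1)"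
            unfolding pw using x1 rr by (simp add: field_simps)
          also have "\<dots> \<le> y ^ (2 * r + 1)" using yl by (intro power_mono) auto
          finally show ?thesis .
        qed
        ultimately have "real (card (?B x y)) \<le> C * (1 + ln x) ^ 5 * ((x * y) powr (1 / (2 * real r + 2)) + y / U)"
          using x1 y1 U by (intro main) auto
        also have "\<dots> \<le> C' * (1 + ln x) ^ 5 * ((x * y) powr (1 / (2 * real r + 2)) + y * x powr (- \<delta>) + y / U)"
          using C l5 y1 U by (intro mult_mono) (auto simp: C'_def)
        finally show ?thesis .
      next
        case False
        define K where "K = nat \<lceil>y / y0\<rceil>"
        have yy0: "y / y0 > 1" using False y0 by simp
        have K: "real K \<le> 2 * (y / y0)" "y / y0 \<le> real K" unfolding K_def using yy0 by linarith+
        have sub: "?B x y \<subseteq> (\<Union>j\<in>{..<K}. ?B (x + real j * y0) y0)"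
        proof
          fix n assume n: "n \<in> ?B x y"
          define t where "t = (real n - x) / y0"
          have t: "t > 0" "t \<le> y / y0" using n y0 by (auto simp: t_def intro!: divide_right_mono)
          define j where "j = nat (\<lceil>t\<rceil> - 1)"
          have j: "real j < t" "t \<le> real j + 1" unfolding j_def using t by linarith+
          have "j < K" using j(1) t(2) K(2) by linarith
          moreover have "real n = x + t * y0" using y0 by (simp add: t_def)
          hence "x + real j * y0 < real n" "real n \<le> x + real j * y0 + y0"
          proof -
            assume e: "real n = x + t * y0"
            have "real j * y0 < t * y0" "t * y0 \<le> (real j + 1) * y0"
              using j y0 by (auto intro!: mult_strict_right_mono mult_right_mono)
            thus "x + real j * y0 < real n" "real n \<le> x + real j * y0 + y0" using e by (auto simp: algebra_simps)
          qed
          ultimately show "n \<in> (\<Union>j\<in>{..<K}. ?B (x + real j * y0) y0)" using n by auto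
        qed
        have finB: "finite (?B x y)" if "0 \<le> x" "0 \<le> y" for x y
          by (rule finite_subset[OF _ card_nat_interval(1)[of x "x + y"]]) (use that in auto)
        have fin: "finite (\<Union>j\<in>{..<K}. ?B (x + real j * y0) y0)"
          using x1 y0 by (intro finite_UN_I finB) auto
        define P where "P = 2 * y0 * x powr (- \<delta>) + y0 / U"
        have each: "real (card (?B (x + real j * y0) y0)) \<le> 32 * C * (1 + ln x) ^ 5 * P" if j: "j < K" for j
        proof -
          define xj where "xj = x + real j * y0"
          have "real j \<le> y / y0" using j unfolding K_def using yy0 by linarith
          hence "real j * y0 \<le> y" using y0 by (simp add: field_simps)
          hence xj: "x \<le> xj" "xj \<le> 2 * x" using yx y0 by (auto simp: xj_def)
          have "real (card (?B xj y0)) \<le> C * (1 + ln xj) ^ 5 * ((xj * y0) powr (1 / (2 * real r + 2)) + y0 / U)"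
            using xj x1 y0 U c1 c2 by (intro main) auto
          also have "\<dots> \<le> C * (2 * (1 + ln x)) ^ 5 * P"
          proof (intro mult_mono power_mono C order_refl)
            show "0 \<le> (1 + ln xj) ^ 5" using xj x1 by simp
            have "ln xj \<le> ln (2 * x)" using xj x1 by simp
            also have "\<dots> = ln 2 + ln x" using x1 by (simp add: ln_mult)
            finally have "ln xj \<le> ln 2 + ln x" .
            moreover have "ln (2::real) \<le> 1" using ln_le_minus_one[of "2::real"] by simp
            ultimately have "ln xj \<le> 1 + ln x" by simp
            thus "1 + ln xj \<le> 2 * (1 + ln x)" using lx by (simp add: distrib_left)
            show "0 \<le> 1 + ln xj" using xj x1 by simp
            have "(xj * y0) powr (1 / (2 * real r + 2)) \<le> (2 * (x * y0)) powr (1 / (2 * real r + 2))"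
              using xj x1 y0 by (intro powr_mono2) (auto intro: mult_right_mono)
            also have "\<dots> = 2 powr (1 / (2 * real r + 2)) * (x * y0) powr (1 / (2 * real r + 2))"
              using x1 y0 by (simp add: powr_mult)
            also have "\<dots> \<le> 2 powr 1 * (x * y0) powr (1 / (2 * real r + 2))"
              using rr by (intro mult_right_mono powr_mono) auto
            also have "(x * y0) powr (1 / (2 * real r + 2)) = y0 * x powr (- \<delta>)"
            proof -
              have "x * y0 = x powr (1 + \<tau>)" using x1 by (simp add: y0_def powr_add)
              hence "(x * y0) powr (1 / (2 * real r + 2)) = x powr ((1 + \<tau>) * (1 / (2 * real r + 2)))"
                by (simp only: powr_powr)
              also have "(1 + \<tau>) * (1 / (2 * real r + 2)) = \<tau> + - \<delta>"
                using exponent_identities(3)[of "real r"] rr by (simp add: \<tau>_def \<delta>_def)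
              finally show ?thesis by (simp only: powr_add y0_def)
            qed
            finally show "(xj * y0) powr (1 / (2 * real r + 2)) + y0 / U \<le> P" by (simp add: P_def)
            show "0 \<le> C * (2 * (1 + ln x)) ^ 5" using C lx by simp
            show "0 \<le> (xj * y0) powr (1 / (2 * real r + 2)) + y0 / U" using y0 U by simp
          qed
          also have "\<dots> = 32 * C * (1 + ln x) ^ 5 * P" by (simp only: power_mult_distrib) simp
          finally show ?thesis by (simp only: xj_def)
        qed
        have "card (?B x y) \<le> card (\<Union>j\<in>{..<K}. ?B (x + real j * y0) y0)" using fin sub by (rule card_mono)
        also have "\<dots> \<le> (\<Sum>j<K. card (?B (x + real j * y0) y0))" by (intro card_UN_le) simp
        finally have "real (card (?B x y)) \<le> real (\<Sum>j<K. card (?B (x + real j * y0) y0))" by (simp only: of_nat_le_iff)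
        also have "\<dots> = (\<Sum>j<K. real (card (?B (x + real j * y0) y0)))" by (simp only: of_nat_sum)
        also have "\<dots> \<le> (\<Sum>j<K. 32 * C * (1 + ln x) ^ 5 * P)" using each by (intro sum_mono) auto
        also have "\<dots> = real K * (32 * C * (1 + ln x) ^ 5 * P)" by simp
        also have "\<dots> \<le> 2 * (y / y0) * (32 * C * (1 + ln x) ^ 5 * P)"
          using K C l5 y0 U by (intro mult_right_mono) (auto simp: P_def)
        also have "\<dots> = 32 * C * (1 + ln x) ^ 5 * (2 * (y / y0) * P)" by (simp only: mult_ac)
        also have "2 * (y / y0) * P = 4 * (y * x powr (- \<delta>)) + 2 * (y / U)"
          using y0 U by (simp add: P_def field_simps)
        also have "32 * C * (1 + ln x) ^ 5 * (4 * (y * x powr (- \<delta>)) + 2 * (y / U))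
          \<le> 32 * C * (1 + ln x) ^ 5 * (4 * ((x * y) powr (1 / (2 * real r + 2)) + y * x powr (- \<delta>) + y / U))"
        proof (intro mult_left_mono)
          have "0 \<le> y / U" using y1 U by simp
          thus "4 * (y * x powr (- \<delta>)) + 2 * (y / U) \<le> 4 * ((x * y) powr (1 / (2 * real r + 2)) + y * x powr (- \<delta>) + y / U)"
            using powr_ge_zero[of "x * y" "1 / (2 * real r + 2)"] by argo
        qed (use C l5 in auto)
        also have "\<dots> = C' * (1 + ln x) ^ 5 * ((x * y) powr (1 / (2 * real r + 2)) + y * x powr (- \<delta>) + y / U)"
          by (simp add: C'_def)
        finally show ?thesis .
      qed
      thus "real (card (?B x y)) \<le> C' * (1 + ln x) ^ 5 * ((x * y) powr (1 / (2 * real r + 2)) + y * x powr (- (1 / (8 * real r * (real r + 1)))) + y / U)"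
        by (simp only: \<delta>_def)
    qed
  qed
qed

section \<open>Functions of the powerful part\<close>

text \<open>Comparison with the integral in telescoped form: \<theta> n^(-1-\<theta>) <=
  (n-1)^(-\<theta>) - n^(-\<theta>), a consequence of 1 + t <= exp t.\<close>

lemma sum_powr_le:
  fixes \<theta> :: real and V :: "nat set"
  assumes "finite V" "\<And>v. v \<in> V \<Longrightarrow> v > 0" "\<theta> > 0"
  shows "(\<Sum>v\<in>V. real v powr (- 1 - \<theta>)) \<le> 1 + 1 / \<theta>"
proof -
  have tel: "(\<Sum>v=1..M. real v powr (- 1 - \<theta>)) \<le> 1 + (1 - real M powr (- \<theta>)) / \<theta>" if "M \<ge> 1" for M
    using that
  proof (induction M rule: dec_induct)
    case (step M)
    define n where "n = real (Suc M)"
    have n: "n > 1" "real M = n - 1" "M \<ge> 1" using step by (auto simp: n_def)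
    have "1 + \<theta> / n \<le> exp (\<theta> / n)" by (rule exp_ge_add_one_self)
    also have "\<dots> \<le> exp (- \<theta> * ln ((n - 1) / n))"
    proof -
      have "ln ((n - 1) / n) \<le> (n - 1) / n - 1" using n by (intro ln_le_minus_one) auto
      also have "(n - 1) / n - 1 = - (1 / n)" using n by (simp add: field_simps)
      finally have "\<theta> * (1 / n) \<le> \<theta> * (- ln ((n - 1) / n))" using assms by (intro mult_left_mono) auto
      thus ?thesis by simp
    qed
    also have "\<dots> = ((n - 1) / n) powr (- \<theta>)" using n by (simp add: powr_def)
    also have "\<dots> = (n - 1) powr (- \<theta>) / n powr (- \<theta>)" using n by (simp add: powr_divide)
    finally have "(1 + \<theta> / n) * n powr (- \<theta>) \<le> (n - 1) powr (- \<theta>)"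
      using n by (simp add: pos_le_divide_eq)
    moreover have "n powr (- 1 - \<theta>) = n powr (- \<theta>) / n"
    proof -
      have "- 1 - \<theta> = - \<theta> - 1" by simp
      thus ?thesis using n powr_diff[of n "- \<theta>" 1] by (simp only: powr_one)
    qed
    ultimately have "\<theta> * n powr (- 1 - \<theta>) \<le> (n - 1) powr (- \<theta>) - n powr (- \<theta>)"
      by (simp add: algebra_simps)
    hence "n powr (- 1 - \<theta>) \<le> ((n - 1) powr (- \<theta>) - n powr (- \<theta>)) / \<theta>"
      using assms by (simp add: pos_le_divide_eq mult.commute)
    hence "real (Suc M) powr (- 1 - \<theta>) \<le> (real M powr (- \<theta>) - real (Suc M) powr (- \<theta>)) / \<theta>"
      unfolding n(2) n_def[symmetric] .
    moreover have "(1 - real M powr (- \<theta>)) / \<theta> + (real M powr (- \<theta>) - real (Suc M) powr (- \<theta>)) / \<theta>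
        = (1 - real (Suc M) powr (- \<theta>)) / \<theta>"
      by (simp flip: add_divide_distrib)
    moreover have "(\<Sum>v=1..Suc M. real v powr (- 1 - \<theta>)) = (\<Sum>v=1..M. real v powr (- 1 - \<theta>)) + real (Suc M) powr (- 1 - \<theta>)"
      by simp
    ultimately show ?case using step.IH by linarith
  qed simp
  define M where "M = Max (insert 1 V)"
  have M: "M \<ge> 1" unfolding M_def using assms by (intro Max_ge) auto
  have "V \<subseteq> {1..M}"
  proof
    fix v assume "v \<in> V"
    thus "v \<in> {1..M}" using assms(2)[of v] assms(1) by (auto simp: M_def)
  qed
  hence "(\<Sum>v\<in>V. real v powr (- 1 - \<theta>)) \<le> (\<Sum>v=1..M. real v powr (- 1 - \<theta>))"
    by (intro sum_mono2) auto
  also have "\<dots> \<le> 1 + (1 - real M powr (- \<theta>)) / \<theta>" by (rule tel[OF M])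
  also have "\<dots> \<le> 1 + 1 / \<theta>" using assms by (intro add_left_mono divide_right_mono) auto
  finally show ?thesis .
qed

text \<open>These assumptions are all that is kept of F, so every bound below depends on r, \<theta>
  and \<open>Ct\<close> only. The divisor exponent \<theta>/(3r) is chosen so that the divisor
  functions of v^(2r-1) and v^(r-1) together cost at most v^\<theta>.\<close>

locale depends_on_powerful_part =
  fixes r :: nat and F :: "nat \<Rightarrow> real" and \<theta> Ct :: real
  assumes r: "r \<ge> 2" and F1: "\<And>n. \<bar>F n\<bar> \<le> 1"
    and Finv: "\<And>p e m. prime p \<Longrightarrow> e < r \<Longrightarrow> m > 0 \<Longrightarrow> \<not> p dvd m \<Longrightarrow> F (p ^ e * m) = F m"
    and \<theta>: "0 < \<theta>" "\<theta> \<le> 1 / 4" and Ct: "Ct \<ge> 1"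
    and tau_bound: "\<And>n. n > 0 \<Longrightarrow> real (tau n) \<le> Ct * real n powr (\<theta> / (3 * real r))"
begin

abbreviation G where "G \<equiv> moebius_conv F"

definition of_root :: "nat \<Rightarrow> nat set" where
  "of_root v = (\<lambda>w. v ^ r * w) ` {w. w dvd v ^ (r - 1)}"

text \<open>The truncation is by the root v and not by the size of d: a d outside
  \<open>small U\<close> with G d nonzero is then divisible by some v^r with v > U.\<close>

definition small :: "real \<Rightarrow> nat set" where
  "small U = (\<Union>v\<in>{v. 0 < v \<and> real v \<le> U}. of_root v)"

lemma finite_roots: "finite {v::nat. 0 < v \<and> real v \<le> U}"
  by (rule finite_subset[of _ "{..nat \<lfloor>U\<rfloor>}"]) (auto intro: le_nat_floor)

lemma finite_small: "finite (small U)"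
  unfolding small_def of_root_def by (intro finite_UN_I finite_roots finite_imageI) auto

lemma root_obtain:
  assumes "d > 0" "G d \<noteq> 0"
  obtains v where "v > 0" "d \<in> of_root v"
proof -
  have "powerful r d" using moebius_conv_eq_0[of r F d] Finv assms by blast
  then obtain v w where "d = v ^ r * w" "w dvd v ^ (r - 1)" "v > 0"
    using powerful_decompose[of d r] assms r by auto
  thus ?thesis using that by (auto simp: of_root_def)
qed

lemma tau_of_root:
  assumes "v > 0" "d \<in> of_root v"
  shows "real (tau d) * real (tau (v ^ (r - 1))) \<le> Ct ^ 2 * real v powr \<theta>" "v ^ r \<le> d" "d > 0" "v ^ r dvd d"
proof -
  define \<eta> where "\<eta> = \<theta> / (3 * real r)"
  obtain w where w: "d = v ^ r * w" "w dvd v ^ (r - 1)" using assms by (auto simp: of_root_def)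
  have w0: "w > 0" using w(2) assms(1) by (auto intro: Nat.gr0I)
  show d0: "d > 0" "v ^ r \<le> d" "v ^ r dvd d" using w assms w0 by auto
  have "d dvd v ^ r * v ^ (r - 1)" using w by simp
  hence "tau d \<le> tau (v ^ r * v ^ (r - 1))" using assms by (intro tau_mono) auto
  also have "v ^ r * v ^ (r - 1) = v ^ (2 * r - 1)"
  proof -
    have "r + (r - 1) = 2 * r - 1" using r by simp
    thus ?thesis by (metis power_add)
  qed
  finally have "real (tau d) \<le> real (tau (v ^ (2 * r - 1)))" by simp
  also have "\<dots> \<le> Ct * real (v ^ (2 * r - 1)) powr \<eta>" unfolding \<eta>_def using assms by (intro tau_bound) simp
  finally have 1: "real (tau d) \<le> Ct * real (v ^ (2 * r - 1)) powr \<eta>" .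
  have 2: "real (tau (v ^ (r - 1))) \<le> Ct * real (v ^ (r - 1)) powr \<eta>"
    unfolding \<eta>_def using assms by (intro tau_bound) simp
  have pw: "real (v ^ n) powr \<eta> = real v powr (\<eta> * real n)" for n
    using assms by (simp add: powr_realpow[symmetric] powr_powr mult.commute)
  have "real (tau d) * real (tau (v ^ (r - 1))) \<le> (Ct * real v powr (\<eta> * real (2 * r - 1))) * (Ct * real v powr (\<eta> * real (r - 1)))"
    using mult_mono[OF 1 2] Ct unfolding pw by simp
  also have "\<dots> = Ct ^ 2 * real v powr (\<eta> * real (2 * r - 1) + \<eta> * real (r - 1))"
    by (simp add: powr_add power2_eq_square)
  also have "\<dots> \<le> Ct ^ 2 * real v powr \<theta>"
  proof (intro mult_left_mono powr_mono)
    have "\<eta> * real (2 * r - 1) + \<eta> * real (r - 1) = \<eta> * real ((2 * r - 1) + (r - 1))"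
      by (simp only: of_nat_add distrib_left)
    also have "\<dots> \<le> \<eta> * real (3 * r)" using \<theta> by (intro mult_left_mono) (auto simp: \<eta>_def)
    also have "\<dots> = \<theta>" using r by (simp add: \<eta>_def)
    finally show "\<eta> * real (2 * r - 1) + \<eta> * real (r - 1) \<le> \<theta>" .
  qed (use assms in auto)
  finally show "real (tau d) * real (tau (v ^ (r - 1))) \<le> Ct ^ 2 * real v powr \<theta>" .
qed

lemma G_le: "d > 0 \<Longrightarrow> \<bar>G d\<bar> \<le> real (tau d)"
  using abs_moebius_conv_le_tau F1 by blast

text \<open>There are at most tau(v^(r-1)) elements with root v, so the bound B v is shared equally
  among the cofactors w. A d with several roots is merely counted more than once.\<close>

lemma sum_of_roots_le:
  fixes h :: "nat \<Rightarrow> real" and B :: "nat \<Rightarrow> real"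
  assumes "finite A" "finite V" "\<And>v. v \<in> V \<Longrightarrow> v > 0" "A \<subseteq> (\<Union>v\<in>V. of_root v)"
    and h: "\<And>v d. v \<in> V \<Longrightarrow> d \<in> of_root v \<Longrightarrow> h d * real (tau (v ^ (r - 1))) \<le> B v"
    and B: "\<And>v. v \<in> V \<Longrightarrow> 0 \<le> B v"
  shows "sum h A \<le> sum B V"
proof -
  define g where "g = (\<lambda>(v, w::nat). B v / real (tau (v ^ (r - 1))))"
  define T where "T = Sigma V (\<lambda>v. {w. w dvd v ^ (r - 1)})"
  have fin: "finite {w. w dvd v ^ (r - 1)}" if "v \<in> V" for v using assms(3)[OF that] by simp
  have tp: "real (tau (v ^ (r - 1))) > 0" if "v \<in> V" for v
    using tau_pos[of "v ^ (r - 1)"] assms(3)[OF that] by simp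
  have "sum h A \<le> sum g T"
  proof (rule sum_le_included[where i = "\<lambda>(v, w). v ^ r * w"])
    show "finite A" "finite T" using assms fin by (auto simp: T_def)
    show "\<forall>y\<in>T. 0 \<le> g y" using B tp by (auto simp: T_def g_def intro!: divide_nonneg_nonneg)
    show "\<forall>d\<in>A. \<exists>y\<in>T. (case y of (v, w) \<Rightarrow> v ^ r * w) = d \<and> h d \<le> g y"
    proof
      fix d assume "d \<in> A"
      then obtain v where v: "v \<in> V" "d \<in> of_root v" using assms(4) by auto
      then obtain w where w: "w dvd v ^ (r - 1)" "d = v ^ r * w" by (auto simp: of_root_def)
      have "h d \<le> B v / real (tau (v ^ (r - 1)))" using h[OF v] tp[OF v(1)] by (simp add: pos_le_divide_eq)
      thus "\<exists>y\<in>T. (case y of (v, w) \<Rightarrow> v ^ r * w) = d \<and> h d \<le> g y"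
        using v w by (intro bexI[of _ "(v, w)"]) (auto simp: T_def g_def)
    qed
  qed
  also have "sum g T = (\<Sum>v\<in>V. \<Sum>w | w dvd v ^ (r - 1). B v / real (tau (v ^ (r - 1))))"
    unfolding T_def g_def using assms(2) fin by (subst sum.Sigma) auto
  also have "\<dots> = sum B V"
    using tp by (intro sum.cong) (auto dest!: tp)
  finally show ?thesis .
qed

lemma sum_small_le:
  assumes "U \<ge> 1"
  shows "(\<Sum>d\<in>small U. \<bar>G d\<bar>) \<le> Ct ^ 2 * U powr (1 + \<theta>)"
proof -
  let ?V = "{v. 0 < v \<and> real v \<le> U}"
  have "(\<Sum>d\<in>small U. \<bar>G d\<bar>) \<le> (\<Sum>v\<in>?V. Ct ^ 2 * U powr \<theta>)"
  proof (rule sum_of_roots_le[OF finite_small finite_roots])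
    show "small U \<subseteq> (\<Union>v\<in>?V. of_root v)" by (simp add: small_def)
    fix v d assume v: "v \<in> ?V" "d \<in> of_root v"
    have v0: "v > 0" using v by simp
    note t = tau_of_root[OF v0 v(2)]
    have "\<bar>G d\<bar> * real (tau (v ^ (r - 1))) \<le> real (tau d) * real (tau (v ^ (r - 1)))"
      using G_le[OF t(3)] by (intro mult_right_mono) auto
    also have "\<dots> \<le> Ct ^ 2 * real v powr \<theta>" by (rule t(1))
    also have "\<dots> \<le> Ct ^ 2 * U powr \<theta>" using v \<theta> by (intro mult_left_mono powr_mono2) auto
    finally show "\<bar>G d\<bar> * real (tau (v ^ (r - 1))) \<le> Ct ^ 2 * U powr \<theta>" .
  qed auto
  also have "\<dots> = real (card ?V) * (Ct ^ 2 * U powr \<theta>)" by simp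
  also have "\<dots> \<le> U * (Ct ^ 2 * U powr \<theta>)"
  proof (intro mult_right_mono)
    have "?V \<subseteq> {1..nat \<lfloor>U\<rfloor>}" by (auto intro: le_nat_floor)
    hence "card ?V \<le> card {1..nat \<lfloor>U\<rfloor>}" by (intro card_mono) auto
    hence "real (card ?V) \<le> real (nat \<lfloor>U\<rfloor>)" by simp
    thus "real (card ?V) \<le> U" using assms by linarith
  qed auto
  also have "\<dots> = Ct ^ 2 * U powr (1 + \<theta>)" using assms by (simp add: powr_add)
  finally show ?thesis .
qed

definition tail_bound :: "real \<Rightarrow> real" where
  "tail_bound U = Ct ^ 2 * (1 + 1 / \<theta>) * U powr (- 1 + 2 * \<theta>)"

lemma sum_tail_le:
  assumes A: "finite A" "A \<inter> small U = {}" "0 \<notin> A" and U: "U > 0"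
  shows "(\<Sum>d\<in>A. \<bar>G d\<bar> / real d) \<le> tail_bound U"
proof -
  define A' where "A' = {d \<in> A. G d \<noteq> 0}"
  have "\<forall>d\<in>A'. \<exists>v. v > 0 \<and> d \<in> of_root v"
  proof
    fix d assume "d \<in> A'"
    hence "d > 0" "G d \<noteq> 0" using A by (auto simp: A'_def intro: Nat.gr0I)
    thus "\<exists>v. v > 0 \<and> d \<in> of_root v" using root_obtain by blast
  qed
  then obtain f where f: "\<And>d. d \<in> A' \<Longrightarrow> f d > 0 \<and> d \<in> of_root (f d)" by metis
  define V where "V = f ` A'"
  have V: "finite V" "\<And>v. v \<in> V \<Longrightarrow> v > 0 \<and> U < real v"
  proof -
    show "finite V" using A(1) by (simp add: V_def A'_def)
    fix v assume "v \<in> V"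
    then obtain d where d: "d \<in> A'" "v = f d" by (auto simp: V_def)
    have "d \<notin> small U" using d A by (auto simp: A'_def)
    hence "\<not> real v \<le> U" using f[OF d(1)] d(2) by (auto simp: small_def)
    thus "v > 0 \<and> U < real v" using f[OF d(1)] d(2) by auto
  qed
  have "(\<Sum>d\<in>A. \<bar>G d\<bar> / real d) = (\<Sum>d\<in>A'. \<bar>G d\<bar> / real d)"
    unfolding A'_def using A(1) by (intro sum.mono_neutral_right) auto
  also have "\<dots> \<le> (\<Sum>v\<in>V. Ct ^ 2 * U powr (- 1 + 2 * \<theta>) * real v powr (- 1 - \<theta>))"
  proof (rule sum_of_roots_le)
    show "finite A'" using A(1) by (simp add: A'_def)
    show "finite V" by (rule V(1))
    show "\<And>v. v \<in> V \<Longrightarrow> v > 0" using V(2) by blast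
    show "A' \<subseteq> (\<Union>v\<in>V. of_root v)" using f by (auto simp: V_def)
    fix v d assume v: "v \<in> V" "d \<in> of_root v"
    have v0: "v > 0" "U < real v" using V(2)[OF v(1)] by auto
    note t = tau_of_root[OF v0(1) v(2)]
    have vd: "real v ^ 2 \<le> real d"
    proof -
      have "v ^ 2 \<le> v ^ r" using r v0 by (intro power_increasing) auto
      hence "v ^ 2 \<le> d" using t(2) by simp
      hence "real (v ^ 2) \<le> real d" by (simp only: of_nat_le_iff)
      thus ?thesis by simp
    qed
    have "\<bar>G d\<bar> / real d * real (tau (v ^ (r - 1))) = \<bar>G d\<bar> * real (tau (v ^ (r - 1))) / real d" by simp
    also have "\<dots> \<le> (real (tau d) * real (tau (v ^ (r - 1)))) / real d"
      using G_le[OF t(3)] by (intro divide_right_mono mult_right_mono) auto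
    also have "\<dots> \<le> (Ct ^ 2 * real v powr \<theta>) / real v ^ 2"
      using t(1,3) vd v0 by (intro frac_le) auto
    also have "\<dots> = Ct ^ 2 * real v powr (- 2 + \<theta>)"
      using v0 powr_diff[of "real v" \<theta> 2] by (simp add: algebra_simps powr_numeral)
    \<comment> \<open>The exponent is split so that one part is monotone and can be taken at U,
      while the other still gives a convergent sum over v.\<close>
    also have "- 2 + \<theta> = (- 1 + 2 * \<theta>) + (- 1 - \<theta>)" by simp
    also have "real v powr \<dots> = real v powr (- 1 + 2 * \<theta>) * real v powr (- 1 - \<theta>)" by (rule powr_add)
    also have "Ct ^ 2 * (real v powr (- 1 + 2 * \<theta>) * real v powr (- 1 - \<theta>)) \<le> Ct ^ 2 * (U powr (- 1 + 2 * \<theta>) * real v powr (- 1 - \<theta>))"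
      using U v0 \<theta> by (intro mult_left_mono mult_right_mono powr_mono2') auto
    finally show "\<bar>G d\<bar> / real d * real (tau (v ^ (r - 1))) \<le> Ct ^ 2 * U powr (- 1 + 2 * \<theta>) * real v powr (- 1 - \<theta>)" by simp
  qed auto
  also have "\<dots> = Ct ^ 2 * U powr (- 1 + 2 * \<theta>) * (\<Sum>v\<in>V. real v powr (- 1 - \<theta>))"
    by (simp add: sum_distrib_left)
  also have "\<dots> \<le> Ct ^ 2 * U powr (- 1 + 2 * \<theta>) * (1 + 1 / \<theta>)"
    using V \<theta> by (intro mult_left_mono sum_powr_le) auto
  finally show ?thesis by (simp add: tail_bound_def mult_ac)
qed

text \<open>The term with d = 0 is a division by zero and hence 0.\<close>

definition dens :: real where "dens = (\<Sum>d. G d / real d)"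

lemma summable_dens: "summable (\<lambda>d. G d / real d)"
proof (rule summable_rabs_cancel, rule summableI_nonneg_bounded)
  fix n :: nat
  \<comment> \<open>No positive integer is at most 1/2, so the tail bound at U = 1/2 controls the
    entire series. It is stated for all U > 0 with this in view.\<close>
  have "small (1 / 2) = {}" by (auto simp: small_def)
  hence "(\<Sum>d\<in>{1..<n}. \<bar>G d\<bar> / real d) \<le> tail_bound (1 / 2)" by (intro sum_tail_le) auto
  moreover have "(\<Sum>d<n. \<bar>G d / real d\<bar>) = (\<Sum>d\<in>{1..<n}. \<bar>G d\<bar> / real d)"
  proof -
    have "(\<Sum>d<n. \<bar>G d / real d\<bar>) = (\<Sum>d\<in>{1..<n}. \<bar>G d / real d\<bar>)"
      by (intro sum.mono_neutral_right) (auto simp: not_less_eq_eq)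
    thus ?thesis by simp
  qed
  ultimately show "(\<Sum>d<n. \<bar>G d / real d\<bar>) \<le> tail_bound (1 / 2)" by simp
qed simp

lemma abs_dens_minus_small_le:
  assumes "U > 0"
  shows "\<bar>dens - (\<Sum>d\<in>small U. G d / real d)\<bar> \<le> tail_bound U"
proof -
  have lim: "(\<lambda>n. \<bar>(\<Sum>d<n. G d / real d) - (\<Sum>d\<in>small U. G d / real d)\<bar>) \<longlonglongrightarrow> \<bar>dens - (\<Sum>d\<in>small U. G d / real d)\<bar>"
    unfolding dens_def by (intro tendsto_intros summable_LIMSEQ summable_dens)
  show ?thesis
  proof (rule LIMSEQ_le_const2[OF lim], intro exI allI impI)
    fix n assume n: "Suc (Max (insert 0 (small U))) \<le> n"
    have "small U \<subseteq> {..<n}"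
    proof
      fix d assume "d \<in> small U"
      hence "d \<le> Max (insert 0 (small U))" using finite_small by (intro Max_ge) auto
      thus "d \<in> {..<n}" using n by simp
    qed
    hence "(\<Sum>d<n. G d / real d) - (\<Sum>d\<in>small U. G d / real d) = (\<Sum>d\<in>{..<n} - small U. G d / real d)"
      by (simp add: sum_diff)
    also have "\<dots> = (\<Sum>d\<in>{..<n} - small U - {0}. G d / real d)"
      by (intro sum.mono_neutral_right) auto
    also have "\<bar>\<dots>\<bar> \<le> (\<Sum>d\<in>{..<n} - small U - {0}. \<bar>G d\<bar> / real d)"
      by (rule order_trans[OF sum_abs]) simp
    also have "\<dots> \<le> tail_bound U" using assms by (intro sum_tail_le) auto
    finally show "\<bar>(\<Sum>d<n. G d / real d) - (\<Sum>d\<in>small U. G d / real d)\<bar> \<le> tail_bound U" .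
  qed
qed

lemma abs_dens_le: "\<bar>dens\<bar> \<le> tail_bound (1 / 2)"
proof -
  have "small (1 / 2) = {}" by (auto simp: small_def)
  thus ?thesis using abs_dens_minus_small_le[of "1 / 2"] by simp
qed

section \<open>Sums of \<open>F\<close> over intervals\<close>

abbreviation interval :: "real \<Rightarrow> real \<Rightarrow> nat set" where
  "interval x y \<equiv> {n::nat. x < real n \<and> real n \<le> x + y}"

lemma finite_interval: "0 \<le> x \<Longrightarrow> 0 \<le> y \<Longrightarrow> finite (interval x y)"
  by (rule card_nat_interval(1)) auto

text \<open>Each d in \<open>small U\<close> has y/d multiples up to an error 1, and completing the
  series costs the tail bound. The contribution of the other divisors stays explicit, because
  initial and short intervals need different arguments for it.\<close>

lemma abs_sum_interval_le:
  assumes xy: "0 \<le> x" "0 \<le> y" and U: "U > 0"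
  shows "\<bar>(\<Sum>n\<in>interval x y. F n) - dens * y\<bar> \<le> (\<Sum>d\<in>small U. \<bar>G d\<bar>) + y * tail_bound U
    + (\<Sum>n\<in>interval x y. \<Sum>d | d dvd n \<and> d \<notin> small U. \<bar>G d\<bar>)"
proof -
  let ?I = "interval x y" and ?S = "small U"
  have fI: "finite ?I" using xy by (rule finite_interval)
  have pos: "n > 0" if "n \<in> ?I" for n using that xy by (auto intro: Nat.gr0I)
  have Spos: "d > 0" if "d \<in> ?S" for d using that tau_of_root(3) by (auto simp: small_def)
  have "(\<Sum>n\<in>?I. F n) = (\<Sum>n\<in>?I. (\<Sum>d | d dvd n \<and> d \<in> ?S. G d) + (\<Sum>d | d dvd n \<and> d \<notin> ?S. G d))"
  proof (intro sum.cong refl)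
    fix n assume n: "n \<in> ?I"
    have "F n = (\<Sum>d | d dvd n. G d)" using sum_moebius_conv[OF pos[OF n]] by simp
    also have "{d. d dvd n} = {d. d dvd n \<and> d \<in> ?S} \<union> {d. d dvd n \<and> d \<notin> ?S}" by auto
    also have "(\<Sum>d\<in>\<dots>. G d) = (\<Sum>d | d dvd n \<and> d \<in> ?S. G d) + (\<Sum>d | d dvd n \<and> d \<notin> ?S. G d)"
      using pos[OF n] by (intro sum.union_disjoint) auto
    finally show "F n = (\<Sum>d | d dvd n \<and> d \<in> ?S. G d) + (\<Sum>d | d dvd n \<and> d \<notin> ?S. G d)" .
  qed
  hence eq: "(\<Sum>n\<in>?I. F n) = (\<Sum>n\<in>?I. \<Sum>d | d dvd n \<and> d \<in> ?S. G d) + (\<Sum>n\<in>?I. \<Sum>d | d dvd n \<and> d \<notin> ?S. G d)"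
    by (simp add: sum.distrib)
  have "(\<Sum>n\<in>?I. \<Sum>d | d dvd n \<and> d \<in> ?S. G d) = (\<Sum>n\<in>?I. \<Sum>d\<in>{d \<in> ?S. d dvd n}. G d)"
    by (intro sum.cong) auto
  also have "\<dots> = (\<Sum>d\<in>?S. \<Sum>n\<in>{n \<in> ?I. d dvd n}. G d)"
    using fI finite_small by (rule sum.swap_restrict)
  also have "\<dots> = (\<Sum>d\<in>?S. G d * real (card {n. x < real n \<and> real n \<le> x + y \<and> d dvd n}))"
  proof (intro sum.cong refl)
    fix d
    have "{n \<in> ?I. d dvd n} = {n. x < real n \<and> real n \<le> x + y \<and> d dvd n}" by auto
    thus "(\<Sum>n\<in>{n \<in> ?I. d dvd n}. G d) = G d * real (card {n. x < real n \<and> real n \<le> x + y \<and> d dvd n})"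
      by (simp only: sum_constant mult.commute)
  qed
  finally have s1: "(\<Sum>n\<in>?I. \<Sum>d | d dvd n \<and> d \<in> ?S. G d) = (\<Sum>d\<in>?S. G d * real (card {n. x < real n \<and> real n \<le> x + y \<and> d dvd n}))" .
  have "\<bar>(\<Sum>d\<in>?S. G d * real (card {n. x < real n \<and> real n \<le> x + y \<and> d dvd n})) - (\<Sum>d\<in>?S. G d / real d) * y\<bar>
      = \<bar>\<Sum>d\<in>?S. G d * (real (card {n. x < real n \<and> real n \<le> x + y \<and> d dvd n}) - y / real d)\<bar>"
  proof -
    have "G d * c - G d / real d * y = G d * (c - y / real d)" for c d by (simp add: right_diff_distrib)
    thus ?thesis by (simp only: sum_distrib_right sum_subtractf[symmetric])
  qed
  also have "\<dots> \<le> (\<Sum>d\<in>?S. \<bar>G d\<bar> * 1)"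
  proof (rule order_trans[OF sum_abs], intro sum_mono)
    fix d assume "d \<in> ?S"
    hence "\<bar>real (card {n. x < real n \<and> real n \<le> x + y \<and> d dvd n}) - y / real d\<bar> \<le> 1"
      using xy Spos by (intro card_multiples_interval(2)) auto
    thus "\<bar>G d * (real (card {n. x < real n \<and> real n \<le> x + y \<and> d dvd n}) - y / real d)\<bar> \<le> \<bar>G d\<bar> * 1"
      unfolding abs_mult by (intro mult_left_mono) auto
  qed
  finally have b1: "\<bar>(\<Sum>n\<in>?I. \<Sum>d | d dvd n \<and> d \<in> ?S. G d) - (\<Sum>d\<in>?S. G d / real d) * y\<bar> \<le> (\<Sum>d\<in>?S. \<bar>G d\<bar>)"
    unfolding s1 by simp
  have b2: "\<bar>\<Sum>n\<in>?I. \<Sum>d | d dvd n \<and> d \<notin> ?S. G d\<bar> \<le> (\<Sum>n\<in>?I. \<Sum>d | d dvd n \<and> d \<notin> ?S. \<bar>G d\<bar>)"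
    by (rule order_trans[OF sum_abs]) (intro sum_mono sum_abs)
  have "\<bar>dens - (\<Sum>d\<in>?S. G d / real d)\<bar> * y \<le> tail_bound U * y"
    using abs_dens_minus_small_le[OF U] xy by (intro mult_right_mono)
  then have b3: "\<bar>dens * y - (\<Sum>d\<in>?S. G d / real d) * y\<bar> \<le> y * tail_bound U"
  proof -
    assume b: "\<bar>dens - (\<Sum>d\<in>?S. G d / real d)\<bar> * y \<le> tail_bound U * y"
    have "dens * y - (\<Sum>d\<in>?S. G d / real d) * y = (dens - (\<Sum>d\<in>?S. G d / real d)) * y"
      by (rule left_diff_distrib[symmetric])
    hence "\<bar>dens * y - (\<Sum>d\<in>?S. G d / real d) * y\<bar> = \<bar>dens - (\<Sum>d\<in>?S. G d / real d)\<bar> * y"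
      using xy by (simp only: abs_mult abs_of_nonneg)
    thus ?thesis using b by (simp only: mult.commute)
  qed
  show ?thesis using eq b1 b2 b3 by linarith
qed

lemma sum_initial_tail_le:
  assumes X: "X \<ge> 0" and U: "U > 0"
  shows "(\<Sum>n\<in>interval 0 X. \<Sum>d | d dvd n \<and> d \<notin> small U. \<bar>G d\<bar>) \<le> X * tail_bound U"
proof -
  let ?I = "interval 0 X"
  define A where "A = {d. 0 < d \<and> real d \<le> X \<and> d \<notin> small U}"
  have fA: "finite A" by (rule finite_subset[OF _ finite_roots[of X]]) (auto simp: A_def)
  have fI: "finite ?I" using X by (intro finite_interval) auto
  have "(\<Sum>n\<in>?I. \<Sum>d | d dvd n \<and> d \<notin> small U. \<bar>G d\<bar>) = (\<Sum>n\<in>?I. \<Sum>d\<in>{d \<in> A. d dvd n}. \<bar>G d\<bar>)"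
  proof (intro sum.cong refl)
    fix n assume n: "n \<in> ?I"
    have "d \<le> n \<and> d > 0" if "d dvd n" for d using that n by (auto intro: dvd_imp_le Nat.gr0I)
    moreover have "real d \<le> X" if "d \<le> n" for d using that n by auto
    ultimately have "d dvd n \<and> d \<notin> small U \<longleftrightarrow> d \<in> A \<and> d dvd n" for d unfolding A_def by blast
    thus "{d. d dvd n \<and> d \<notin> small U} = {d \<in> A. d dvd n}" by (rule Collect_cong)
  qed
  also have "\<dots> = (\<Sum>d\<in>A. \<Sum>n\<in>{n \<in> ?I. d dvd n}. \<bar>G d\<bar>)" using fI fA by (rule sum.swap_restrict)
  also have "\<dots> = (\<Sum>d\<in>A. \<bar>G d\<bar> * real (card {n. 0 < real n \<and> real n \<le> 0 + X \<and> d dvd n}))"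
  proof (intro sum.cong refl)
    fix d
    have "{n \<in> ?I. d dvd n} = {n. 0 < real n \<and> real n \<le> 0 + X \<and> d dvd n}" by auto
    thus "(\<Sum>n\<in>{n \<in> ?I. d dvd n}. \<bar>G d\<bar>) = \<bar>G d\<bar> * real (card {n. 0 < real n \<and> real n \<le> 0 + X \<and> d dvd n})"
      by (simp only: sum_constant mult.commute)
  qed
  also have "\<dots> \<le> (\<Sum>d\<in>A. \<bar>G d\<bar> * (X / real d))"
  proof (intro sum_mono mult_left_mono)
    fix d assume "d \<in> A"
    thus "real (card {n. 0 < real n \<and> real n \<le> 0 + X \<and> d dvd n}) \<le> X / real d"
      using X by (intro card_multiples_interval(3)) (auto simp: A_def)
  qed auto
  also have "\<dots> = X * (\<Sum>d\<in>A. \<bar>G d\<bar> / real d)" by (simp add: sum_distrib_left mult_ac)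
  also have "\<dots> \<le> X * tail_bound U" using fA U X by (intro mult_left_mono sum_tail_le) (auto simp: A_def)
  finally show ?thesis .
qed

text \<open>U is fixed first, so that the two tail contributions are at most a quarter of e each;
  then X is taken large against the finite sum over \<open>small U\<close>.\<close>

lemma mean_tendsto_dens: "((\<lambda>X. (\<Sum>n\<in>interval 0 X. F n) / X) \<longlongrightarrow> dens) at_top"
proof (rule tendstoI)
  fix e :: real assume e: "e > 0"
  define K where "K = Ct ^ 2 * (1 + 1 / \<theta>)"
  have K: "K > 0" using Ct \<theta> by (simp add: K_def add_pos_pos)
  \<comment> \<open>As \<theta> <= 1/4, the tail is at most K / sqrt U, and this U brings it down to
    e/4.\<close>
  define U where "U = max 1 ((4 * K / e) ^ 2)"
  have U: "U \<ge> 1" by (simp add: U_def)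
  have tb: "tail_bound U \<le> e / 4"
  proof -
    have "U powr (- 1 + 2 * \<theta>) \<le> U powr (- (1 / 2))" using U \<theta> by (intro powr_mono) auto
    also have "\<dots> = 1 / sqrt U" using U by (simp only: powr_minus_divide) (simp add: powr_half_sqrt)
    also have "\<dots> \<le> 1 / (4 * K / e)"
    proof (intro divide_left_mono)
      have "sqrt ((4 * K / e) ^ 2) \<le> sqrt U" by (intro real_sqrt_le_mono) (simp add: U_def)
      thus "4 * K / e \<le> sqrt U" using K e by simp
    qed (use K e U in auto)
    finally have "K * U powr (- 1 + 2 * \<theta>) \<le> K * (1 / (4 * K / e))" using K by (intro mult_left_mono) auto
    also have "\<dots> = e / 4" using K by simp
    finally show ?thesis by (simp add: tail_bound_def K_def)
  qed
  define S where "S = (\<Sum>d\<in>small U. \<bar>G d\<bar>)"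
  have S: "S \<ge> 0" by (simp add: S_def sum_nonneg)
  show "\<forall>\<^sub>F X in at_top. dist ((\<Sum>n\<in>interval 0 X. F n) / X) dens < e"
    using eventually_gt_at_top[of "max 1 (4 * S / e)"]
  proof eventually_elim
    case (elim X)
    have X: "X > 1" "4 * S / e < X" using elim by auto
    have S4: "S < X * (e / 4)" using X e by (simp add: field_simps)
    have "\<bar>(\<Sum>n\<in>interval 0 X. F n) - dens * X\<bar> \<le> S + X * tail_bound U + X * tail_bound U"
      using abs_sum_interval_le[of 0 X U] sum_initial_tail_le[of X U] X U by (simp add: S_def)
    also have "\<dots> < X * (e / 4) + X * (e / 4) + X * (e / 4)"
      using S4 mult_left_mono[OF tb, of X] X by linarith
    also have "\<dots> < X * e" using X e by simp
    finally have b: "\<bar>(\<Sum>n\<in>interval 0 X. F n) - dens * X\<bar> < X * e" .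
    have "dist ((\<Sum>n\<in>interval 0 X. F n) / X) dens = \<bar>(\<Sum>n\<in>interval 0 X. F n) - dens * X\<bar> / X"
    proof -
      have "(\<Sum>n\<in>interval 0 X. F n) / X - dens = ((\<Sum>n\<in>interval 0 X. F n) - dens * X) / X"
        using X by (simp add: diff_divide_distrib)
      thus ?thesis using X by (simp add: dist_real_def)
    qed
    also have "\<dots> < e" using b X by (simp add: pos_divide_less_eq mult.commute)
    finally show ?case .
  qed
qed

text \<open>Only an n divisible by some v^r with v > U has a divisor outside \<open>small U\<close>
  on which G is nonzero. Such an n contributes at most tau(n)^2, a small power of x.\<close>

lemma sum_interval_tail_le:
  assumes xy: "1 \<le> x" "0 \<le> y" "y \<le> x"
  shows "(\<Sum>n\<in>interval x y. \<Sum>d | d dvd n \<and> d \<notin> small U. \<bar>G d\<bar>)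
    \<le> real (card {n::nat. x < real n \<and> real n \<le> x + y \<and> (\<exists>v. U < real v \<and> v ^ r dvd n)}) * (Ct ^ 2 * (2 * x) powr (2 * \<theta>))"
proof -
  let ?I = "interval x y" and ?B = "{n::nat. x < real n \<and> real n \<le> x + y \<and> (\<exists>v. U < real v \<and> v ^ r dvd n)}"
  have fI: "finite ?I" using xy by (intro finite_interval) auto
  have z: "(\<Sum>d | d dvd n \<and> d \<notin> small U. \<bar>G d\<bar>) = 0" if n: "n \<in> ?I - ?B" for n
  proof (intro sum.neutral ballI)
    fix d assume d: "d \<in> {d. d dvd n \<and> d \<notin> small U}"
    have n0: "n > 0" using n xy by (auto intro: Nat.gr0I)
    hence d0: "d > 0" using d by (auto intro: Nat.gr0I)
    show "\<bar>G d\<bar> = 0"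
    proof (rule ccontr)
      assume "\<bar>G d\<bar> \<noteq> 0"
      then obtain v where v: "v > 0" "d \<in> of_root v" using root_obtain[OF d0] by auto
      have "\<not> real v \<le> U" using d v by (auto simp: small_def)
      moreover have "v ^ r dvd n" using tau_of_root(4)[OF v] d dvd_trans by blast
      ultimately show False using n by auto
    qed
  qed
  have "(\<Sum>n\<in>?I. \<Sum>d | d dvd n \<and> d \<notin> small U. \<bar>G d\<bar>) = (\<Sum>n\<in>?B. \<Sum>d | d dvd n \<and> d \<notin> small U. \<bar>G d\<bar>)"
    using fI z by (intro sum.mono_neutral_right) auto
  also have "\<dots> \<le> (\<Sum>n\<in>?B. Ct ^ 2 * (2 * x) powr (2 * \<theta>))"
  proof (intro sum_mono)
    fix n assume n: "n \<in> ?B"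
    have n0: "n > 0" using n xy by (auto intro: Nat.gr0I)
    have "(\<Sum>d | d dvd n \<and> d \<notin> small U. \<bar>G d\<bar>) \<le> (\<Sum>d | d dvd n. \<bar>G d\<bar>)" using n0 by (intro sum_mono2) auto
    also have "\<dots> \<le> (\<Sum>d | d dvd n. real (tau n))"
    proof (intro sum_mono)
      fix d assume "d \<in> {d. d dvd n}"
      hence d: "d dvd n" "d > 0" using n0 by (auto intro: Nat.gr0I)
      have "\<bar>G d\<bar> \<le> real (tau d)" by (rule G_le[OF d(2)])
      also have "\<dots> \<le> real (tau n)" using tau_mono[OF d(1) n0] by simp
      finally show "\<bar>G d\<bar> \<le> real (tau n)" .
    qed
    also have "\<dots> = real (tau n) * real (tau n)" by simp
    also have "\<dots> \<le> (Ct * (2 * x) powr \<theta>) * (Ct * (2 * x) powr \<theta>)"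
    proof -
      have "real (tau n) \<le> Ct * real n powr (\<theta> / (3 * real r))" by (rule tau_bound[OF n0])
      also have "\<dots> \<le> Ct * (2 * x) powr \<theta>"
      proof (intro mult_left_mono)
        have "real n powr (\<theta> / (3 * real r)) \<le> (2 * x) powr (\<theta> / (3 * real r))"
          using n xy \<theta> r by (intro powr_mono2) auto
        also have "\<dots> \<le> (2 * x) powr \<theta>"
          using xy \<theta> r by (intro powr_mono) (auto simp: divide_le_eq mult_le_cancel_left1)
        finally show "real n powr (\<theta> / (3 * real r)) \<le> (2 * x) powr \<theta>" .
      qed (use Ct in auto)
      finally show ?thesis using Ct by (intro mult_mono) auto
    qed
    also have "\<dots> = Ct ^ 2 * (2 * x) powr (2 * \<theta>)"
    proof -
      have "(2 * x) powr (2 * \<theta>) = (2 * x) powr \<theta> * (2 * x) powr \<theta>" by (simp add: powr_add[symmetric])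
      thus ?thesis by (simp add: power2_eq_square)
    qed
    finally show "(\<Sum>d | d dvd n \<and> d \<notin> small U. \<bar>G d\<bar>) \<le> Ct ^ 2 * (2 * x) powr (2 * \<theta>)" .
  qed
  also have "\<dots> = real (card ?B) * (Ct ^ 2 * (2 * x) powr (2 * \<theta>))" by simp
  finally show ?thesis .
qed

end

text \<open>On taking logarithms and clearing denominators, the difference of the two sides is
  2((2r+1) ln y - ln x). The inequality is thus equivalent to the lower bound on y, with equality at
  y = x^(1/(2r+1)).\<close>

lemma geometric_term_le:
  fixes x y :: real and r :: nat
  assumes x: "x \<ge> 1" and y: "x powr (1 / (2 * real r + 1)) \<le> y" and r: "r \<ge> 2"
  shows "(x * y) powr (1 / (2 * real r + 2)) \<le> (x powr (real r - 1) * y powr (real r + 1)) powr (1 / (2 * real r ^ 2))"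
proof -
  define R where "R = real r"
  have R: "R \<ge> 2" using r by (simp add: R_def)
  have y0: "y > 0"
  proof -
    have "0 < x powr (1 / (2 * real r + 1))" using x by simp
    thus ?thesis using y by linarith
  qed
  have l: "ln x \<le> (2 * R + 1) * ln y"
  proof -
    have "ln (x powr (1 / (2 * R + 1))) \<le> ln y" using y x y0 unfolding R_def by (intro ln_mono) auto
    moreover have "ln (x powr (1 / (2 * R + 1))) = ln x / (2 * R + 1)" using x by (simp add: ln_powr)
    ultimately have "ln x / (2 * R + 1) \<le> ln y" by linarith
    thus ?thesis using R by (simp add: pos_divide_le_eq mult.commute)
  qed
  have "(ln x + ln y) / (2 * R + 2) \<le> ((R - 1) * ln x + (R + 1) * ln y) / (2 * R ^ 2)"
  proof -
    have "((R - 1) * ln x + (R + 1) * ln y) * (2 * R + 2) - (ln x + ln y) * (2 * R ^ 2) = 2 * ((2 * R + 1) * ln y - ln x)"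
      by (simp add: algebra_simps power2_eq_square)
    moreover have "0 \<le> 2 * ((2 * R + 1) * ln y - ln x)" using l by simp
    ultimately have "(ln x + ln y) * (2 * R ^ 2) \<le> ((R - 1) * ln x + (R + 1) * ln y) * (2 * R + 2)"
      by (metis diff_ge_0_iff_ge)
    thus ?thesis using R by (simp add: divide_le_eq le_divide_eq mult.commute mult.assoc)
  qed
  hence "exp ((1 / (2 * R + 2)) * (ln x + ln y)) \<le> exp ((1 / (2 * R ^ 2)) * ((R - 1) * ln x + (R + 1) * ln y))"
    by simp
  moreover have "(x * y) powr (1 / (2 * R + 2)) = exp ((1 / (2 * R + 2)) * (ln x + ln y))"
    using x y0 by (simp add: powr_def ln_mult)
  moreover have "(x powr (R - 1) * y powr (R + 1)) powr (1 / (2 * R ^ 2)) = exp ((1 / (2 * R ^ 2)) * ((R - 1) * ln x + (R + 1) * ln y))"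
    using x y0 by (simp add: powr_def exp_add[symmetric])
  ultimately show ?thesis by (simp only: R_def)
qed

text \<open>The third bound says that the saving obtained by cutting is at least x^(-\<delta>). The
  fourth allows truncation at U = x^\<delta>: then U^2 <= y x^(-\<delta>).\<close>

lemma density_exponent_bounds:
  fixes R :: real
  assumes R: "R \<ge> 2"
  defines "\<delta> \<equiv> 1 / (6 * (4 * R - 1) * (2 * R - 1))"
  shows "\<delta> > 0" "\<delta> \<le> 1 / 4" "\<delta> \<le> 1 / (8 * R * (R + 1))" "3 * \<delta> \<le> 1 / (2 * R + 1)"
proof -
  have RR: "2 * R \<le> R * R" using R by (intro mult_right_mono) auto
  have e: "6 * (4 * R - 1) * (2 * R - 1) = 48 * (R * R) - 36 * R + 6" by (simp add: algebra_simps)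
  have p: "0 < 48 * (R * R) - 36 * R + 6" using RR R by linarith
  show "\<delta> > 0" unfolding \<delta>_def e using p by simp
  have 1: "4 \<le> 48 * (R * R) - 36 * R + 6" "8 * (R * R) + 8 * R \<le> 48 * (R * R) - 36 * R + 6"
    "6 * R + 3 \<le> 48 * (R * R) - 36 * R + 6"
    using RR R by linarith+
  have 3: "3 * (2 * R + 1) = 6 * R + 3" by simp
  have 2: "8 * R * (R + 1) = 8 * (R * R) + 8 * R" by (simp add: algebra_simps)
  have pp: "0 < 8 * (R * R) + 8 * R" "0 < 3 * (2 * R + 1)" using R by (auto intro: add_pos_pos)
  show "\<delta> \<le> 1 / 4" unfolding \<delta>_def e using 1(1) by (intro divide_left_mono mult_pos_pos p) auto
  show "\<delta> \<le> 1 / (8 * R * (R + 1))" unfolding \<delta>_def e 2 using 1(2) by (intro divide_left_mono mult_pos_pos p pp) auto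
  have "\<delta> \<le> 1 / (3 * (2 * R + 1))" unfolding \<delta>_def e using 1(3) unfolding 3[symmetric] by (intro divide_left_mono mult_pos_pos p pp) auto
  also have "\<dots> = 1 / (2 * R + 1) / 3" by simp
  finally show "3 * \<delta> \<le> 1 / (2 * R + 1)" by (simp only: le_divide_eq_numeral1 mult.commute)
qed

lemma prime_independent_cond_invariant:
  assumes f: "prime_independent f g" and g1: "\<forall>\<alpha>. 1 \<le> \<alpha> \<and> \<alpha> < r \<longrightarrow> g \<alpha> = 1"
    and p: "prime p" "e < r" "m > 0" "\<not> p dvd m"
  shows "f (p ^ e * m) = f m"
proof (cases "e = 0")
  case False
  have "coprime (p ^ e) m" using p prime_imp_coprime[of p m] by simp
  moreover have "p ^ e \<ge> 1" using p by (simp add: prime_gt_0_nat Suc_le_eq)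
  ultimately have "f (p ^ e * m) = f (p ^ e) * f m"
    using f p by (auto simp: prime_independent_def multiplicative_def Suc_le_eq)
  also have "f (p ^ e) = 1" using f g1 p False by (auto simp: prime_independent_def Suc_le_eq)
  finally show ?thesis by simp
qed simp

theorem theorem1:
  fixes r :: nat and \<epsilon> :: real
  assumes "r \<ge> 2" and "\<epsilon> > 0"
  shows "\<exists>C::real. \<forall>(k::nat) (f :: nat \<Rightarrow> real) (g :: nat \<Rightarrow> real).
    k \<ge> 1 \<longrightarrow>
    prime_independent f g \<longrightarrow>
    (\<forall>n\<ge>1. f n \<in> \<int>) \<longrightarrow>
    (\<forall>p. prime p \<longrightarrow> f p = 1) \<longrightarrow>
    (\<forall>\<alpha>. 1 \<le> \<alpha> \<and> \<alpha> < r \<longrightarrow> g \<alpha> = 1) \<longrightarrow>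
    (\<forall>\<alpha>\<ge>r. g \<alpha> > 1) \<longrightarrow>
      (mean_count f k \<longlongrightarrow> local_density f k) at_top \<and>
      (\<forall>x y :: real.
         x \<ge> 1 \<longrightarrow>
         x powr (1 / (2 * real r + 1) + \<epsilon>) \<le> y \<longrightarrow>
         y \<le> 4 powr (- (2 * real r ^ 2)) * x \<longrightarrow>
         \<bar>real (card {n::nat. x < real n \<and> real n \<le> x + y \<and> f n = real k})
             - local_density f k * y\<bar>
         \<le> C * ((x powr (real r - 1) * y powr (real r + 1)) powr (1 / (2 * real r ^ 2)) * x powr \<epsilon>
              + y * x powr (- (1 / (6 * (4 * real r - 1) * (2 * real r - 1))) + \<epsilon>)
              + y powr (1 - 2 * (real r - 1) / (real r * (3 * real r - 1))) * x powr \<epsilon>))"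
proof -
  note r = assms(1) and \<epsilon> = assms(2)
  define \<delta> where "\<delta> = 1 / (6 * (4 * real r - 1) * (2 * real r - 1))"
  have \<delta>: "\<delta> > 0" "\<delta> \<le> 1 / 4" "\<delta> \<le> 1 / (8 * real r * (real r + 1))" "3 * \<delta> \<le> 1 / (2 * real r + 1)"
    unfolding \<delta>_def using density_exponent_bounds[of "real r"] r by auto
  \<comment> \<open>The bound 1/4 is demanded by the locale; \<epsilon>/8 ensures (2x)^(2\<theta>)
    <= 2 x^(\<epsilon>/2).\<close>
  define \<theta> where "\<theta> = min (1 / 4) (\<epsilon> / 8)"
  have \<theta>: "0 < \<theta>" "\<theta> \<le> 1 / 4" and \<theta>\<epsilon>: "\<theta> \<le> \<epsilon> / 8" using \<epsilon> by (auto simp: \<theta>_def)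
  obtain Ct where Ct: "Ct \<ge> 1" "\<And>n. n > 0 \<Longrightarrow> real (tau n) \<le> Ct * real n powr (\<theta> / (3 * real r))"
    using tau_le_powr[of "\<theta> / (3 * real r)"] \<theta> r by auto
  obtain x0 Cb where x0: "x0 \<ge> 1" and Cb: "Cb \<ge> 0"
    and bad: "\<And>x y U :: real. x \<ge> x0 \<Longrightarrow> x powr (1 / (2 * real r + 1)) \<le> y \<Longrightarrow> y \<le> x \<Longrightarrow> U \<ge> 1 \<Longrightarrow>
    real (card {n::nat. x < real n \<and> real n \<le> x + y \<and> (\<exists>v. U < real v \<and> v ^ r dvd n)})
      \<le> Cb * (1 + ln x) ^ 5 * ((x * y) powr (1 / (2 * real r + 2)) + y * x powr (- (1 / (8 * real r * (real r + 1)))) + y / U)"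
    using power_multiple_count[OF r] by blast
  \<comment> \<open>The value of \<open>tail_bound\<close> at 1/2, written out because C must be
    chosen before F, hence before the locale is interpreted. It bounds the density.\<close>
  define Kd where "Kd = Ct ^ 2 * (1 + 1 / \<theta>) * (1 / 2) powr (- 1 + 2 * \<theta>)"
  have Kd: "Kd \<ge> 0" using \<theta> by (simp add: Kd_def)
  define c where "c = (1 + 10 / \<epsilon>) ^ 5"
  have c: "c \<ge> 0" using \<epsilon> by (simp add: c_def)
  define C where "C = (2 + Kd) * x0 + (Ct ^ 2 + Ct ^ 2 * (1 + 1 / \<theta>) + 4 * Cb * c * Ct ^ 2)"
  have Cnn: "C \<ge> (2 + Kd) * x0" "C \<ge> Ct ^ 2 + Ct ^ 2 * (1 + 1 / \<theta>) + 4 * Cb * c * Ct ^ 2" "C \<ge> 0"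
  proof -
    have "0 \<le> (2 + Kd) * x0" using Kd x0 by simp
    moreover have "0 \<le> Ct ^ 2 + Ct ^ 2 * (1 + 1 / \<theta>) + 4 * Cb * c * Ct ^ 2"
      using \<theta> Cb c by (intro add_nonneg_nonneg mult_nonneg_nonneg) auto
    ultimately show "C \<ge> (2 + Kd) * x0" "C \<ge> Ct ^ 2 + Ct ^ 2 * (1 + 1 / \<theta>) + 4 * Cb * c * Ct ^ 2" "C \<ge> 0"
      unfolding C_def by linarith+
  qed
  show ?thesis
  proof (rule exI[of _ C], intro allI impI)
    fix k :: nat and f g :: "nat \<Rightarrow> real"
    assume f: "prime_independent f g" and g1: "\<forall>\<alpha>. 1 \<le> \<alpha> \<and> \<alpha> < r \<longrightarrow> g \<alpha> = 1"
    define F where "F n = (if f n = real k then 1 else 0 :: real)" for n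
    \<comment> \<open>F enters only through |F| <= 1 and its invariance, so C does not depend on k,
      f or g.\<close>
    interpret depends_on_powerful_part r F \<theta> Ct
    proof
      show "F (p ^ e * m) = F m" if "prime p" "e < r" "m > 0" "\<not> p dvd m" for p e m
        unfolding F_def using prime_independent_cond_invariant[OF f g1 that] by simp
    qed (use r \<theta> Ct in \<open>auto simp: F_def\<close>)
    have cardF: "real (card {n::nat. x < real n \<and> real n \<le> x + y \<and> f n = real k}) = (\<Sum>n\<in>interval x y. F n)"
      if "0 \<le> x" "0 \<le> y" for x y
    proof -
      have "{n::nat. x < real n \<and> real n \<le> x + y \<and> f n = real k} = {n \<in> interval x y. f n = real k}" by auto
      thus ?thesis using finite_interval[OF that] by (simp add: F_def sum.If_cases Int_def)
    qed
    have "((\<lambda>X. (\<Sum>n\<in>interval 0 X. F n) / X) \<longlongrightarrow> dens) at_top" by (rule mean_tendsto_dens)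
    moreover have "\<forall>\<^sub>F X in at_top. (\<Sum>n\<in>interval 0 X. F n) / X = mean_count f k X"
      using eventually_ge_at_top[of 0]
    proof eventually_elim
      case (elim X)
      have "{n::nat. 1 \<le> n \<and> real n \<le> X \<and> f n = real k} = {n::nat. 0 < real n \<and> real n \<le> 0 + X \<and> f n = real k}" by auto
      thus ?case using cardF[of 0 X] elim by (simp only: mean_count_def)
    qed
    ultimately have lim: "(mean_count f k \<longlongrightarrow> dens) at_top"
      by (rule Lim_transform_eventually)
    hence ld: "local_density f k = dens"
      unfolding local_density_def by (intro tendsto_Lim) auto
    have short: "\<bar>real (card {n::nat. x < real n \<and> real n \<le> x + y \<and> f n = real k}) - local_density f k * y\<bar>
         \<le> C * ((x powr (real r - 1) * y powr (real r + 1)) powr (1 / (2 * real r ^ 2)) * x powr \<epsilon>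
              + y * x powr (- \<delta> + \<epsilon>)
              + y powr (1 - 2 * (real r - 1) / (real r * (3 * real r - 1))) * x powr \<epsilon>)"
      if x: "x \<ge> 1" and yl: "x powr (1 / (2 * real r + 1) + \<epsilon>) \<le> y" and yu: "y \<le> 4 powr (- (2 * real r ^ 2)) * x" for x y
    proof -
      define W where "W = (x powr (real r - 1) * y powr (real r + 1)) powr (1 / (2 * real r ^ 2))"
      have yl': "x powr (1 / (2 * real r + 1)) \<le> y"
      proof -
        have "x powr (1 / (2 * real r + 1)) \<le> x powr (1 / (2 * real r + 1) + \<epsilon>)" using x \<epsilon> by (intro powr_mono) auto
        thus ?thesis using yl by linarith
      qed
      have y1: "y \<ge> 1"
      proof -
        have "1 \<le> x powr (1 / (2 * real r + 1))" using x by (intro ge_one_powr_ge_zero) auto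
        thus ?thesis using yl' by linarith
      qed
      have yx: "y \<le> x"
      proof -
        have "4 powr (- (2 * real r ^ 2)) \<le> (4::real) powr 0" by (intro powr_mono) auto
        hence "4 powr (- (2 * real r ^ 2)) * x \<le> 1 * x" using x by (intro mult_right_mono) auto
        thus ?thesis using yu by linarith
      qed
      have W1: "W \<ge> 1"
      proof -
        have "1 * 1 \<le> x powr (real r - 1) * y powr (real r + 1)"
          using x y1 r by (intro mult_mono ge_one_powr_ge_zero) auto
        thus ?thesis unfolding W_def by (intro ge_one_powr_ge_zero) auto
      qed
      have xe: "x powr \<epsilon> \<ge> 1" using x \<epsilon> by (intro ge_one_powr_ge_zero) auto
      have "\<bar>(\<Sum>n\<in>interval x y. F n) - dens * y\<bar> \<le> C * (W * x powr \<epsilon> + y * x powr (- \<delta> + \<epsilon>))"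
      proof (cases "x < x0")
        \<comment> \<open>For bounded x everything on the left is bounded, while the first error
          term is at least 1.\<close>
        case True
        have "(\<Sum>n\<in>interval x y. F n) \<le> (\<Sum>n\<in>interval x y. 1)" by (intro sum_mono) (simp add: F_def)
        also have "\<dots> = real (card (interval x y))" by simp
        also have "\<dots> \<le> y + 1"
          using card_multiples_interval(2)[of x y 1] x y1 by simp
        finally have 1: "(\<Sum>n\<in>interval x y. F n) \<le> y + 1" .
        have 2: "0 \<le> (\<Sum>n\<in>interval x y. F n)" by (intro sum_nonneg) (simp add: F_def)
        have "\<bar>dens * y\<bar> \<le> Kd * y"
          using abs_dens_le y1 unfolding tail_bound_def Kd_def abs_mult by (intro mult_mono) auto
        hence "\<bar>(\<Sum>n\<in>interval x y. F n) - dens * y\<bar> \<le> (y + 1) + Kd * y" using 1 2 by linarith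
        also have "\<dots> \<le> (2 + Kd) * y" using y1 by (simp add: algebra_simps)
        also have "\<dots> \<le> (2 + Kd) * x0" using yx True Kd by (intro mult_left_mono) auto
        also have "\<dots> \<le> C * 1" using Cnn by simp
        also have "\<dots> \<le> C * (W * x powr \<epsilon> + y * x powr (- \<delta> + \<epsilon>))"
        proof (intro mult_left_mono Cnn)
          have "1 * 1 \<le> W * x powr \<epsilon>" using W1 xe by (intro mult_mono) auto
          moreover have "0 \<le> y * x powr (- \<delta> + \<epsilon>)" using y1 by simp
          ultimately show "1 \<le> W * x powr \<epsilon> + y * x powr (- \<delta> + \<epsilon>)" by linarith
        qed
        finally show ?thesis .
      next
        case False
        \<comment> \<open>Truncation at x^\<delta> balances the terms: y/U is exactly the second
          error term without x^\<epsilon>, and the sum over \<open>small U\<close>, of order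
          U^(1+\<theta>) <= U^2, is below it as well.\<close>
        define U where "U = x powr \<delta>"
        have U: "U \<ge> 1" unfolding U_def using x \<delta> by (intro ge_one_powr_ge_zero) auto
        define Y where "Y = y * x powr (- \<delta>)"
        have Y: "Y \<ge> 0" using y1 by (simp add: Y_def)
        have YE: "Y * x powr \<epsilon> = y * x powr (- \<delta> + \<epsilon>)" by (simp only: Y_def powr_add mult.assoc)
        have s: "(\<Sum>d\<in>small U. \<bar>G d\<bar>) \<le> Ct ^ 2 * (Y * x powr \<epsilon>)"
        proof -
          have "U powr (1 + \<theta>) \<le> U powr 2" using U \<theta> by (intro powr_mono) auto
          also have "\<dots> = x powr (3 * \<delta>) * x powr (- \<delta>)" by (simp add: U_def powr_powr powr_add[symmetric] mult.commute)
          also have "\<dots> \<le> y * x powr (- \<delta>)"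
          proof (intro mult_right_mono)
            have "x powr (3 * \<delta>) \<le> x powr (1 / (2 * real r + 1))" using x \<delta> by (intro powr_mono) auto
            thus "x powr (3 * \<delta>) \<le> y" using yl' by linarith
          qed auto
          also have "\<dots> = Y * 1" by (simp add: Y_def)
          also have "\<dots> \<le> Y * x powr \<epsilon>" using xe Y by (intro mult_left_mono)
          finally have "Ct ^ 2 * U powr (1 + \<theta>) \<le> Ct ^ 2 * (Y * x powr \<epsilon>)" by (intro mult_left_mono) auto
          thus ?thesis using sum_small_le[OF U] by linarith
        qed
        have t: "y * tail_bound U \<le> Ct ^ 2 * (1 + 1 / \<theta>) * (Y * x powr \<epsilon>)"
        proof -
          have "U powr (- 1 + 2 * \<theta>) = x powr (- \<delta>) * x powr (2 * \<delta> * \<theta>)"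
            by (simp add: U_def powr_powr powr_add[symmetric] algebra_simps)
          also have "\<dots> \<le> x powr (- \<delta>) * x powr \<epsilon>"
          proof (intro mult_left_mono powr_mono)
            have "2 * \<delta> * \<theta> \<le> 2 * (1 / 4) * (\<epsilon> / 8)" using \<delta> \<theta> \<theta>\<epsilon> by (intro mult_mono) auto
            thus "2 * \<delta> * \<theta> \<le> \<epsilon>" using \<epsilon> by linarith
          qed (use x in auto)
          finally have "y * U powr (- 1 + 2 * \<theta>) \<le> y * (x powr (- \<delta>) * x powr \<epsilon>)" using y1 by (intro mult_left_mono) auto
          hence "Ct ^ 2 * (1 + 1 / \<theta>) * (y * U powr (- 1 + 2 * \<theta>)) \<le> Ct ^ 2 * (1 + 1 / \<theta>) * (Y * x powr \<epsilon>)"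
            using \<theta> by (intro mult_left_mono) (auto simp: Y_def)
          thus ?thesis by (simp add: tail_bound_def mult_ac)
        qed
        let ?B = "{n::nat. x < real n \<and> real n \<le> x + y \<and> (\<exists>v. U < real v \<and> v ^ r dvd n)}"
        have cB: "real (card ?B) \<le> Cb * (c * x powr (\<epsilon> / 2)) * (2 * (W + Y))"
        proof -
          have "real (card ?B) \<le> Cb * (1 + ln x) ^ 5 * ((x * y) powr (1 / (2 * real r + 2)) + y * x powr (- (1 / (8 * real r * (real r + 1)))) + y / U)"
            using False U yl' yx by (intro bad) auto
          also have "\<dots> \<le> Cb * (c * x powr (\<epsilon> / 2)) * (2 * (W + Y))"
          proof (intro mult_mono mult_left_mono Cb order_refl)
            \<comment> \<open>The exponent \<epsilon>/10 is chosen so that five logarithms cost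
              x^(\<epsilon>/2); the other half of x^\<epsilon> is spent on the divisor
              bound.\<close>
            have "ln x \<le> x powr (\<epsilon> / 10) / (\<epsilon> / 10)" using x \<epsilon> by (intro ln_powr_bound) auto
            moreover have "1 \<le> x powr (\<epsilon> / 10)" using x \<epsilon> by (intro ge_one_powr_ge_zero) auto
            ultimately have "1 + ln x \<le> (1 + 10 / \<epsilon>) * x powr (\<epsilon> / 10)" by (simp add: algebra_simps)
            hence "(1 + ln x) ^ 5 \<le> ((1 + 10 / \<epsilon>) * x powr (\<epsilon> / 10)) ^ 5" using x by (intro power_mono) auto
            also have "\<dots> = c * x powr (\<epsilon> / 2)"
              using x by (simp add: power_mult_distrib c_def powr_power)
            finally show "(1 + ln x) ^ 5 \<le> c * x powr (\<epsilon> / 2)" .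
            have a1: "(x * y) powr (1 / (2 * real r + 2)) \<le> W" unfolding W_def by (rule geometric_term_le[OF x yl' r])
            have a2: "y * x powr (- (1 / (8 * real r * (real r + 1)))) \<le> Y"
              unfolding Y_def using x y1 \<delta> by (intro mult_left_mono powr_mono) auto
            have a3: "y / U = Y" by (simp add: U_def Y_def powr_minus divide_inverse)
            show "(x * y) powr (1 / (2 * real r + 2)) + y * x powr (- (1 / (8 * real r * (real r + 1)))) + y / U \<le> 2 * (W + Y)"
              unfolding a3 using add_mono[OF a1 a2] W1 by simp
            show "0 \<le> (x * y) powr (1 / (2 * real r + 2)) + y * x powr (- (1 / (8 * real r * (real r + 1)))) + y / U"
              using y1 U by simp
            show "0 \<le> Cb * (c * x powr (\<epsilon> / 2))" using Cb c by simp
            show "0 \<le> (1 + ln x) ^ 5" using x by simp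
          qed
          finally show ?thesis .
        qed
        have "(\<Sum>n\<in>interval x y. \<Sum>d | d dvd n \<and> d \<notin> small U. \<bar>G d\<bar>) \<le> real (card ?B) * (Ct ^ 2 * (2 * x) powr (2 * \<theta>))"
          using x y1 yx by (intro sum_interval_tail_le) auto
        also have "\<dots> \<le> (Cb * (c * x powr (\<epsilon> / 2)) * (2 * (W + Y))) * (Ct ^ 2 * (2 * x powr (\<epsilon> / 2)))"
        proof (intro mult_mono cB mult_left_mono)
          have "(2 * x) powr (2 * \<theta>) = 2 powr (2 * \<theta>) * x powr (2 * \<theta>)" using x by (simp add: powr_mult)
          also have "\<dots> \<le> 2 powr 1 * x powr (\<epsilon> / 2)" using x \<theta> \<theta>\<epsilon> by (intro mult_mono powr_mono) auto
          finally show "(2 * x) powr (2 * \<theta>) \<le> 2 * x powr (\<epsilon> / 2)" by simp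
          show "0 \<le> Cb * (c * x powr (\<epsilon> / 2)) * (2 * (W + Y))" using Cb c W1 Y by simp
        qed auto
        also have "\<dots> = 4 * Cb * c * Ct ^ 2 * ((W + Y) * (x powr (\<epsilon> / 2) * x powr (\<epsilon> / 2)))" by simp
        also have "x powr (\<epsilon> / 2) * x powr (\<epsilon> / 2) = x powr \<epsilon>" by (simp flip: powr_add)
        finally have b: "(\<Sum>n\<in>interval x y. \<Sum>d | d dvd n \<and> d \<notin> small U. \<bar>G d\<bar>) \<le> 4 * Cb * c * Ct ^ 2 * ((W + Y) * x powr \<epsilon>)" .
        define Z where "Z = (W + Y) * x powr \<epsilon>"
        have YZ: "Y * x powr \<epsilon> \<le> Z" unfolding Z_def using W1 by (intro mult_right_mono) auto
        have Z0: "0 \<le> Z" using W1 Y by (simp add: Z_def)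
        have "\<bar>(\<Sum>n\<in>interval x y. F n) - dens * y\<bar> \<le> (\<Sum>d\<in>small U. \<bar>G d\<bar>) + y * tail_bound U
          + (\<Sum>n\<in>interval x y. \<Sum>d | d dvd n \<and> d \<notin> small U. \<bar>G d\<bar>)"
          using x y1 U by (intro abs_sum_interval_le) auto
        also have "\<dots> \<le> Ct ^ 2 * Z + Ct ^ 2 * (1 + 1 / \<theta>) * Z + 4 * Cb * c * Ct ^ 2 * Z"
        proof (intro add_mono)
          have "Ct ^ 2 * (Y * x powr \<epsilon>) \<le> Ct ^ 2 * Z" using YZ by (intro mult_left_mono) auto
          thus "(\<Sum>d\<in>small U. \<bar>G d\<bar>) \<le> Ct ^ 2 * Z" using s by linarith
          have "Ct ^ 2 * (1 + 1 / \<theta>) * (Y * x powr \<epsilon>) \<le> Ct ^ 2 * (1 + 1 / \<theta>) * Z"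
            using YZ \<theta> by (intro mult_left_mono) auto
          thus "y * tail_bound U \<le> Ct ^ 2 * (1 + 1 / \<theta>) * Z" using t by linarith
          show "(\<Sum>n\<in>interval x y. \<Sum>d | d dvd n \<and> d \<notin> small U. \<bar>G d\<bar>) \<le> 4 * Cb * c * Ct ^ 2 * Z"
            using b by (simp only: Z_def)
        qed
        also have "\<dots> = (Ct ^ 2 + Ct ^ 2 * (1 + 1 / \<theta>) + 4 * Cb * c * Ct ^ 2) * Z" by (simp only: distrib_right)
        also have "\<dots> \<le> C * Z" using Cnn Z0 by (intro mult_right_mono)
        also have "Z = W * x powr \<epsilon> + y * x powr (- \<delta> + \<epsilon>)" unfolding Z_def YE[symmetric] by (rule distrib_right)
        finally show ?thesis .
      qed
      also have "\<dots> \<le> C * (W * x powr \<epsilon> + y * x powr (- \<delta> + \<epsilon>)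
              + y powr (1 - 2 * (real r - 1) / (real r * (3 * real r - 1))) * x powr \<epsilon>)"
        using Cnn by (intro mult_left_mono) auto
      finally show ?thesis using cardF[of x y] x y1 unfolding ld W_def by simp
    qed
    show "(mean_count f k \<longlongrightarrow> local_density f k) at_top \<and>
      (\<forall>x y :: real.
         x \<ge> 1 \<longrightarrow>
         x powr (1 / (2 * real r + 1) + \<epsilon>) \<le> y \<longrightarrow>
         y \<le> 4 powr (- (2 * real r ^ 2)) * x \<longrightarrow>
         \<bar>real (card {n::nat. x < real n \<and> real n \<le> x + y \<and> f n = real k})
             - local_density f k * y\<bar>
         \<le> C * ((x powr (real r - 1) * y powr (real r + 1)) powr (1 / (2 * real r ^ 2)) * x powr \<epsilon>
              + y * x powr (- (1 / (6 * (4 * real r - 1) * (2 * real r - 1))) + \<epsilon>)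
              + y powr (1 - 2 * (real r - 1) / (real r * (3 * real r - 1))) * x powr \<epsilon>))"
      using lim ld short unfolding \<delta>_def by simp
  qed
qed

end
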